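(* Every closed infinite dimensional subspace of an order continuous Banach lattice contains an unconditional uo-bibasic sequence.
   Context: A net $(z_\alpha)$ converges in order to $z$ in a vector lattice $X$ if there is a net $(u_\gamma)$ (possibly with a different index set) with $u_\gamma\downarrow0$ such that for every $\gamma$ there is $\alpha_0$ with $|z_\alpha-z|\le u_\gamma$ for all $\alpha\ge\alpha_0$. A Banach lattice is order continuous if every net converging in order to $0$ converges to $0$ in norm. A net $(z_\alpha)$ in an Archimedean vector lattice $X$ uo-converges to $z$ if $|z_\alpha-z|\wedge u$ converges in order to $0$ for every $u\ge0$ in $X$. A sequence $(x_k)$ in a Banach lattice $X$ is uo-bibasic if it is a Schauder basic sequence and for each $x\in[x_k]$ (the closed linear span), with norm expansion $x=\sum_{k=1}^\infty\alpha_kx_k$, the partial sums $\sum_{k=1}^n\alpha_kx_k$ uo-converge to $x$ in $X$. An unconditional uo-bibasic sequence is a uo-bibasic sequence which is also an unconditional basic sequence. *)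

theory Defs
  imports "HOL-Analysis.Analysis" "HOL-Library.Lattice_Algebras"
begin

section \<open>Banach lattices\<close>

class banach_lattice = banach + ordered_real_vector + lattice_ab_group_add_abs +
  assumes norm_mono_abs: "\<bar>x\<bar> \<le> \<bar>y\<bar> \<Longrightarrow> norm x \<le> norm y"

instance real :: banach_lattice
  by standard simp

section \<open>Nets and order convergence\<close>

text \<open>
  A net is a function on an index set \<open>A\<close> that is directed upwards by a preorder \<open>r\<close>;
  \<open>r \<alpha> \<beta>\<close> is read as \<open>\<alpha> \<le> \<beta>\<close>.
\<close>

definition directed_set :: "'i set \<Rightarrow> ('i \<Rightarrow> 'i \<Rightarrow> bool) \<Rightarrow> bool" where
  "directed_set A r \<longleftrightarrow>
     A \<noteq> {} \<and>
     (\<forall>a\<in>A. r a a) \<and>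
     (\<forall>a\<in>A. \<forall>b\<in>A. \<forall>c\<in>A. r a b \<longrightarrow> r b c \<longrightarrow> r a c) \<and>
     (\<forall>a\<in>A. \<forall>b\<in>A. \<exists>c\<in>A. r a c \<and> r b c)"

definition net_decreases_to ::
  "'i set \<Rightarrow> ('i \<Rightarrow> 'i \<Rightarrow> bool) \<Rightarrow> ('i \<Rightarrow> 'a::order) \<Rightarrow> 'a \<Rightarrow> bool" where
  "net_decreases_to A r u l \<longleftrightarrow>
     directed_set A r \<and>
     (\<forall>a\<in>A. \<forall>b\<in>A. r a b \<longrightarrow> u b \<le> u a) \<and>
     (\<forall>a\<in>A. l \<le> u a) \<and>
     (\<forall>w. (\<forall>a\<in>A. w \<le> u a) \<longrightarrow> w \<le> l)"

text \<open>
  HOL cannot quantify over types inside a definition, so the index set of the dominating net is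
  taken inside the lattice itself. This is no restriction: a decreasing net can be re-indexed by
  its range, so dominating nets with an arbitrary index type are covered by
  \<open>order_convergesI\<close> below.
\<close>

definition order_converges ::
  "'i set \<Rightarrow> ('i \<Rightarrow> 'i \<Rightarrow> bool) \<Rightarrow> ('i \<Rightarrow> 'a::lattice_ab_group_add_abs) \<Rightarrow> 'a \<Rightarrow> bool" where
  "order_converges A r z l \<longleftrightarrow>
     (\<exists>(G::'a set) s u. net_decreases_to G s u 0 \<and>
        (\<forall>\<gamma>\<in>G. \<exists>\<alpha>\<^sub>0\<in>A. \<forall>\<alpha>\<in>A. r \<alpha>\<^sub>0 \<alpha> \<longrightarrow> \<bar>z \<alpha> - l\<bar> \<le> u \<gamma>))"

lemma order_convergesI:
  fixes u :: "'j \<Rightarrow> 'a::lattice_ab_group_add_abs"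
  assumes u: "net_decreases_to G s u 0"
    and dom: "\<And>\<gamma>. \<gamma> \<in> G \<Longrightarrow> \<exists>\<alpha>\<^sub>0\<in>A. \<forall>\<alpha>\<in>A. r \<alpha>\<^sub>0 \<alpha> \<longrightarrow> \<bar>z \<alpha> - l\<bar> \<le> u \<gamma>"
  shows "order_converges A r z l"
proof -
  have dir: "\<exists>c\<in>G. s a c \<and> s b c" if "a \<in> G" "b \<in> G" for a b
    using u that unfolding net_decreases_to_def directed_set_def by blast
  have mono: "u b \<le> u a" if "a \<in> G" "b \<in> G" "s a b" for a b
    using u that unfolding net_decreases_to_def by blast
  have low: "\<And>a. a \<in> G \<Longrightarrow> 0 \<le> u a" "\<And>w. \<forall>a\<in>G. w \<le> u a \<Longrightarrow> w \<le> 0"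
    using u unfolding net_decreases_to_def by blast+
  have ne: "G \<noteq> {}"
    using u unfolding net_decreases_to_def directed_set_def by blast
  have "\<exists>c\<in>G. u c \<le> u a \<and> u c \<le> u b" if "a \<in> G" "b \<in> G" for a b
    using dir[OF that] mono that by blast
  then have "directed_set (u ` G) (\<lambda>x y. y \<le> x)"
    using ne unfolding directed_set_def ball_simps bex_simps by (auto intro: order_trans)
  then have "net_decreases_to (u ` G) (\<lambda>x y. y \<le> x) (\<lambda>x. x) 0"
    using low unfolding net_decreases_to_def ball_simps by blast
  then show ?thesis
    unfolding order_converges_def using dom by blast
qed

definition uo_converges ::
  "'i set \<Rightarrow> ('i \<Rightarrow> 'i \<Rightarrow> bool) \<Rightarrow> ('i \<Rightarrow> 'a::lattice_ab_group_add_abs) \<Rightarrow> 'a \<Rightarrow> bool" where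
  "uo_converges A r z l \<longleftrightarrow> (\<forall>u\<ge>0. order_converges A r (\<lambda>\<alpha>. inf \<bar>z \<alpha> - l\<bar> u) 0)"

definition norm_converges ::
  "'i set \<Rightarrow> ('i \<Rightarrow> 'i \<Rightarrow> bool) \<Rightarrow> ('i \<Rightarrow> 'a::real_normed_vector) \<Rightarrow> 'a \<Rightarrow> bool" where
  "norm_converges A r z l \<longleftrightarrow>
     (\<forall>e>0. \<exists>\<alpha>\<^sub>0\<in>A. \<forall>\<alpha>\<in>A. r \<alpha>\<^sub>0 \<alpha> \<longrightarrow> norm (z \<alpha> - l) < e)"

text \<open>
  The nets in this definition are again indexed by subsets of the lattice; by
  \<open>order_continuousD\<close> below, the property then holds for nets with an arbitrary index type.
\<close>

definition order_continuous :: "'a::banach_lattice itself \<Rightarrow> bool" where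
  "order_continuous (_::'a itself) \<longleftrightarrow>
     (\<forall>(A::'a set) r (z::'a \<Rightarrow> 'a).
        directed_set A r \<longrightarrow> order_converges A r z 0 \<longrightarrow> norm_converges A r z 0)"

lemma order_continuousD:
  fixes z :: "'i \<Rightarrow> 'a::banach_lattice"
  assumes oc: "order_continuous TYPE('a)"
    and conv: "order_converges A r z 0"
  shows "norm_converges A r z 0"
proof -
  obtain G :: "'a set" and s u where u: "net_decreases_to G s u 0"
    and dom: "\<And>\<gamma>. \<gamma> \<in> G \<Longrightarrow> \<exists>\<alpha>\<^sub>0\<in>A. \<forall>\<alpha>\<in>A. r \<alpha>\<^sub>0 \<alpha> \<longrightarrow> \<bar>z \<alpha> - 0\<bar> \<le> u \<gamma>"
    using conv unfolding order_converges_def by blast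
  have dir: "directed_set G s"
    and pos: "\<And>\<gamma>. \<gamma> \<in> G \<Longrightarrow> 0 \<le> u \<gamma>"
    and mono: "\<And>\<gamma> \<delta>. \<gamma> \<in> G \<Longrightarrow> \<delta> \<in> G \<Longrightarrow> s \<gamma> \<delta> \<Longrightarrow> u \<delta> \<le> u \<gamma>"
    using u unfolding net_decreases_to_def by blast+
  have "order_converges G s u 0"
  proof (rule order_convergesI[OF u])
    fix \<gamma> assume \<gamma>: "\<gamma> \<in> G"
    have "\<bar>u \<delta> - 0\<bar> \<le> u \<gamma>" if "\<delta> \<in> G" "s \<gamma> \<delta>" for \<delta>
      using mono[OF \<gamma> that] pos[OF that(1)] by simp
    with \<gamma> show "\<exists>\<alpha>\<^sub>0\<in>G. \<forall>\<alpha>\<in>G. s \<alpha>\<^sub>0 \<alpha> \<longrightarrow> \<bar>u \<alpha> - 0\<bar> \<le> u \<gamma>" by blast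
  qed
  then have unorm: "norm_converges G s u 0"
    using oc dir unfolding order_continuous_def by blast
  show ?thesis
    unfolding norm_converges_def
  proof (intro allI impI)
    fix e :: real assume "e > 0"
    then obtain \<gamma> where \<gamma>': "\<gamma> \<in> G" "\<forall>\<delta>\<in>G. s \<gamma> \<delta> \<longrightarrow> norm (u \<delta> - 0) < e"
      using unorm unfolding norm_converges_def by blast
    moreover have "s \<gamma> \<gamma>"
      using dir \<gamma>'(1) unfolding directed_set_def by blast
    ultimately have \<gamma>: "\<gamma> \<in> G" "norm (u \<gamma>) < e"
      by simp_all
    obtain \<alpha>\<^sub>0 where \<alpha>\<^sub>0: "\<alpha>\<^sub>0 \<in> A" "\<And>\<alpha>. \<alpha> \<in> A \<Longrightarrow> r \<alpha>\<^sub>0 \<alpha> \<Longrightarrow> \<bar>z \<alpha> - 0\<bar> \<le> u \<gamma>"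
      using dom[OF \<gamma>(1)] by blast
    have "norm (z \<alpha> - 0) < e" if "\<alpha> \<in> A" "r \<alpha>\<^sub>0 \<alpha>" for \<alpha>
    proof -
      have "\<bar>z \<alpha> - 0\<bar> \<le> \<bar>u \<gamma>\<bar>"
        using \<alpha>\<^sub>0(2)[OF that] pos[OF \<gamma>(1)] by simp
      then show ?thesis
        using norm_mono_abs[of "z \<alpha> - 0" "u \<gamma>"] \<gamma>(2) by linarith
    qed
    with \<alpha>\<^sub>0(1) show "\<exists>\<alpha>\<^sub>0\<in>A. \<forall>\<alpha>\<in>A. r \<alpha>\<^sub>0 \<alpha> \<longrightarrow> norm (z \<alpha> - 0) < e" by blast
  qed
qed

section \<open>Basic sequences\<close>

definition closed_span :: "(nat \<Rightarrow> 'a::real_normed_vector) \<Rightarrow> 'a set" where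
  "closed_span x = closure (span (range x))"

definition schauder_basic :: "(nat \<Rightarrow> 'a::banach) \<Rightarrow> bool" where
  "schauder_basic x \<longleftrightarrow>
     (\<forall>v\<in>closed_span x. \<exists>!a::nat \<Rightarrow> real. (\<lambda>k. a k *\<^sub>R x k) sums v)"

text \<open>Unconditional: every rearrangement of every basis expansion converges.\<close>

definition unconditional_basic :: "(nat \<Rightarrow> 'a::banach) \<Rightarrow> bool" where
  "unconditional_basic x \<longleftrightarrow>
     schauder_basic x \<and>
     (\<forall>v\<in>closed_span x. \<forall>a::nat \<Rightarrow> real. (\<lambda>k. a k *\<^sub>R x k) sums v \<longrightarrow>
        (\<forall>\<pi>. bij \<pi> \<longrightarrow> (\<lambda>k. a (\<pi> k) *\<^sub>R x (\<pi> k)) sums v))"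

definition uo_bibasic :: "(nat \<Rightarrow> 'a::banach_lattice) \<Rightarrow> bool" where
  "uo_bibasic x \<longleftrightarrow>
     schauder_basic x \<and>
     (\<forall>v\<in>closed_span x. \<forall>a::nat \<Rightarrow> real. (\<lambda>k. a k *\<^sub>R x k) sums v \<longrightarrow>
        uo_converges UNIV (\<le>) (\<lambda>n::nat. \<Sum>k\<le>n. a k *\<^sub>R x k) v)"

definition unconditional_uo_bibasic :: "(nat \<Rightarrow> 'a::banach_lattice) \<Rightarrow> bool" where
  "unconditional_uo_bibasic x \<longleftrightarrow> uo_bibasic x \<and> unconditional_basic x"

definition infinite_dimensional :: "'a::real_vector set \<Rightarrow> bool" where
  "infinite_dimensional S \<longleftrightarrow> (\<nexists>B. finite B \<and> S \<subseteq> span B)"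

end

theory Submission
  imports Defs
begin

text \<open>
  Let \<open>V\<close> be the span of a linearly independent sequence in \<open>S\<close> and \<open>e\<close> a positive element
  such that every element of \<open>V\<close> is dominated by a multiple of \<open>e\<close>. If unit vectors \<open>x\<close> of \<open>V\<close>
  can have \<open>inf \<bar>x\<bar> e\<close> of arbitrarily small norm, then \<open>V\<close> contains a small perturbation
  of a disjoint sequence, along which all expansions converge absolutely.

  Otherwise \<open>norm (inf \<bar>x\<bar> e)\<close> is bounded below on the unit sphere of \<open>V\<close>. Order continuity
  yields a positive functional \<open>\<phi>\<close> that controls the norm on the interval between \<open>0\<close> and \<open>e\<close>,
  so that smallness in \<open>\<phi>\<close>-measure implies smallness in norm on \<open>V\<close>. One then picks unit vectors
  of \<open>V\<close> close to a martingale difference sequence for the finite algebras generated by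
  components of \<open>e\<close>. Burkholder's weak type \<open>(1,1)\<close> inequality for martingale transforms, which
  in general does not bound transforms in \<open>L\<^sup>1\<close>, bounds them here because weak and strong
  smallness agree on \<open>V\<close>; this gives unconditionality. Applied to a stopped martingale, the same
  inequality is a maximal inequality, which gives the uo-convergence of the partial sums.
\<close>

section \<open>Banach lattice preliminaries\<close>

text \<open>The case split is made on an algebraic span, since one \<open>e\<close> can dominate all
  of it up to multiples, which fails in general for a closed span. The lattice is not represented as
  a function space: \<open>e\<close> stands for the constant one, its components for indicator
  functions, and all martingale estimates concern finite sums over atoms weighted by
  \<open>\<phi>\<close>. The vectors \<open>y k\<close> are taken in \<open>V\<close> itself because
  only there is the norm bounded by a truncated mean; the differences \<open>d k\<close> need not
  lie in \<open>V\<close>, so each estimate passes from \<open>V\<close> to the differences and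
  back. Hence \<open>y k - d k\<close> is made small relative to \<open>e\<close>, which controls
  norm, order and \<open>\<phi>\<close> at once. The errors are proportional to the largest
  coefficient, which is absorbed by testing the estimate on a single coordinate. For the
  uo-convergence, suprema truncated by \<open>e\<close> suffice, because elements of the closure of
  \<open>V\<close> are disjoint from whatever is disjoint from \<open>e\<close>; so a maximal
  inequality for truncated means is enough.\<close>

lemma norm_abs_banach_lattice [simp]:
  fixes x :: "'a::banach_lattice" shows "norm \<bar>x\<bar> = norm x"
  by (rule antisym) (simp_all add: norm_mono_abs)

lemma norm_le_of_abs_le:
  fixes x y :: "'a::banach_lattice" assumes "\<bar>x\<bar> \<le> y" shows "norm x \<le> norm y"
  using assms abs_ge_self[of y] order_trans by (intro norm_mono_abs) blast

lemma tendsto_abs_banach_lattice: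
  fixes f :: "'i \<Rightarrow> 'a::banach_lattice" assumes "(f \<longlongrightarrow> l) F"
  shows "((\<lambda>i. \<bar>f i\<bar>) \<longlongrightarrow> \<bar>l\<bar>) F"
proof -
  have "((\<lambda>i. f i - l) \<longlongrightarrow> 0) F" using assms by (simp add: LIM_zero)
  then have "((\<lambda>i. norm (f i - l)) \<longlongrightarrow> 0) F" by (simp add: tendsto_norm_zero)
  then have "((\<lambda>i. \<bar>f i\<bar> - \<bar>l\<bar>) \<longlongrightarrow> 0) F"
    by (rule Lim_null_comparison[rotated])
      (auto intro!: always_eventually norm_mono_abs abs_triangle_ineq3)
  then show ?thesis by (simp add: LIM_zero_iff)
qed

text \<open>Continuity of \<open>inf\<close> reduces in this way to continuity of the modulus, and
  disjointness of \<open>x\<close> and \<open>y\<close> to the equation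
  \<open>\<bar>x - y\<bar> = x + y\<close>.\<close>

lemma inf_eq_half_diff_abs:
  fixes x y :: "'a::banach_lattice" shows "inf x y = (1/2) *\<^sub>R (x + y - \<bar>x - y\<bar>)"
proof -
  define P where "P = sup 0 (x - y)"
  define Q where "Q = sup 0 (y - x)"
  have 1: "inf x y = x - P"
    unfolding P_def diff_sup_eq_inf add_inf_distrib_left by simp
  have 2: "inf x y = y - Q"
    unfolding Q_def diff_sup_eq_inf add_inf_distrib_left by (simp add: inf.commute)
  have "nprt (x - y) = - Q"
    unfolding nprt_def Q_def neg_sup_eq_inf by (simp add: inf.commute)
  then have 3: "\<bar>x - y\<bar> = P + Q"
    using abs_prts[of "x - y"] by (simp add: pprt_def P_def sup.commute)
  have "2 *\<^sub>R inf x y = (x - P) + (y - Q)" using 1 2 unfolding scaleR_2 by metis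
  also have "\<dots> = x + y - \<bar>x - y\<bar>" unfolding 3 by simp
  finally have "(1/2) *\<^sub>R (2 *\<^sub>R inf x y) = (1/2) *\<^sub>R (x + y - \<bar>x - y\<bar>)" by (rule arg_cong)
  then show ?thesis by (simp only: scaleR_scaleR) simp
qed

lemma sup_eq_half_add_abs:
  fixes x y :: "'a::banach_lattice" shows "sup x y = (1/2) *\<^sub>R (x + y + \<bar>x - y\<bar>)"
  using inf_eq_half_diff_abs[of "-x" "-y"]
  by (simp add: sup_eq_neg_inf abs_minus_commute[of x y] scaleR_right_diff_distrib scaleR_right_distrib)

lemma tendsto_inf_banach_lattice:
  fixes f g :: "'i \<Rightarrow> 'a::banach_lattice" assumes "(f \<longlongrightarrow> l) F" "(g \<longlongrightarrow> m) F"
  shows "((\<lambda>i. inf (f i) (g i)) \<longlongrightarrow> inf l m) F"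
  unfolding inf_eq_half_diff_abs
  by (intro tendsto_intros tendsto_abs_banach_lattice assms)

text \<open>The inequality \<open>x \<le> f n\<close> is the equation
  \<open>inf x (f n) = x\<close>, which passes to the limit.\<close>

lemma le_of_tendsto_banach_lattice:
  fixes f :: "nat \<Rightarrow> 'a::banach_lattice"
  assumes f: "f \<longlonglongrightarrow> l" and le: "\<And>n. N \<le> n \<Longrightarrow> x \<le> f n" shows "x \<le> l"
proof -
  have "(\<lambda>n. inf x (f n)) \<longlonglongrightarrow> inf x l"
    by (intro tendsto_inf_banach_lattice f tendsto_const)
  moreover have "(\<lambda>n. inf x (f n)) \<longlonglongrightarrow> x"
    by (rule tendsto_eventually) (use le in \<open>auto simp: eventually_sequentially inf_absorb1 intro!: exI[of _ N]\<close>)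
  ultimately have "inf x l = x" using LIMSEQ_unique by blast
  then show ?thesis by (metis inf.cobounded2)
qed

lemma tendsto_le_banach_lattice:
  fixes f :: "nat \<Rightarrow> 'a::banach_lattice"
  assumes f: "f \<longlonglongrightarrow> l" and le: "\<And>n. N \<le> n \<Longrightarrow> f n \<le> x" shows "l \<le> x"
proof -
  have "-x \<le> -l" by (rule le_of_tendsto_banach_lattice[of "\<lambda>n. - f n" _ N]) (use f le in \<open>auto intro: tendsto_minus\<close>)
  then show ?thesis by simp
qed

lemma inf_scaleR:
  fixes x y :: "'a::banach_lattice" assumes "0 \<le> c"
  shows "inf (c *\<^sub>R x) (c *\<^sub>R y) = c *\<^sub>R inf x y"
proof (cases "c = 0")
  case False
  then have c: "c > 0" using assms by simp
  show ?thesis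
  proof (rule antisym)
    have *: "(1/c) *\<^sub>R inf (c *\<^sub>R x) (c *\<^sub>R y) \<le> z" if "z = x \<or> z = y" for z
    proof -
      have "(1/c) *\<^sub>R inf (c *\<^sub>R x) (c *\<^sub>R y) \<le> (1/c) *\<^sub>R (c *\<^sub>R z)"
        using c that by (intro scaleR_left_mono) auto
      then show ?thesis using c by simp
    qed
    have "c *\<^sub>R ((1/c) *\<^sub>R inf (c *\<^sub>R x) (c *\<^sub>R y)) \<le> c *\<^sub>R inf x y"
      using * c by (intro scaleR_left_mono) auto
    then show "inf (c *\<^sub>R x) (c *\<^sub>R y) \<le> c *\<^sub>R inf x y" using c by simp
  qed (use assms in \<open>auto intro: scaleR_left_mono\<close>)
qed simp

lemma abs_scaleR_banach_lattice:
  fixes x :: "'a::banach_lattice" shows "\<bar>c *\<^sub>R x\<bar> = \<bar>c\<bar> *\<^sub>R \<bar>x\<bar>"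
proof -
  have *: "\<bar>c *\<^sub>R x\<bar> = c *\<^sub>R \<bar>x\<bar>" if "0 \<le> c" for c and x :: 'a
  proof -
    have "inf (c *\<^sub>R x) (- (c *\<^sub>R x)) = c *\<^sub>R inf x (- x)"
      using inf_scaleR[OF that, of x "-x"] by simp
    moreover have abs: "\<bar>z\<bar> = - inf z (- z)" for z :: 'a
      unfolding neg_inf_eq_sup abs_lattice by (simp add: sup.commute)
    ultimately show ?thesis unfolding abs by (simp only: scaleR_minus_right)
  qed
  show ?thesis
  proof (cases "0 \<le> c")
    case False
    then have "\<bar>c *\<^sub>R x\<bar> = \<bar>(-c) *\<^sub>R x\<bar>" by simp
    also have "\<dots> = (-c) *\<^sub>R \<bar>x\<bar>" using False by (intro *) simp
    finally show ?thesis using False by simp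
  qed (simp add: *)
qed

section \<open>Truncation and disjointness\<close>

lemma inf_add_le:
  fixes x y u :: "'a::banach_lattice" assumes "0 \<le> x" "0 \<le> y" "0 \<le> u"
  shows "inf (x + y) u \<le> inf x u + inf y u"
proof -
  have "inf (x + y) u - inf x u \<le> y"
  proof -
    have "inf (x + y) u \<le> inf (x + y) (u + y)"
      using assms by (intro inf_mono) auto
    also have "\<dots> = inf x u + y" by (simp add: add_inf_distrib_right)
    finally show ?thesis by (simp only: diff_le_eq add.commute)
  qed
  moreover have "inf (x + y) u - inf x u \<le> u"
    using diff_mono[of "inf (x + y) u" u 0 "inf x u"] assms by simp
  ultimately have "inf (x + y) u - inf x u \<le> inf y u" by simp
  then show ?thesis by (simp only: diff_le_eq add.commute)
qed

lemma inf_sum_le: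
  fixes f :: "'i \<Rightarrow> 'a::banach_lattice" assumes "finite A" "\<And>i. i \<in> A \<Longrightarrow> 0 \<le> f i" "0 \<le> u"
  shows "inf (sum f A) u \<le> (\<Sum>i\<in>A. inf (f i) u)"
  using assms(1,2)
proof (induction A rule: finite_induct)
  case empty then show ?case using assms by simp
next
  case (insert i A)
  have "inf (f i + sum f A) u \<le> inf (f i) u + inf (sum f A) u"
    using insert assms by (intro inf_add_le sum_nonneg) auto
  also have "\<dots> \<le> inf (f i) u + (\<Sum>i\<in>A. inf (f i) u)"
    using insert by (intro add_left_mono) auto
  finally show ?case using insert by simp
qed

text \<open>Truncations of disjoint elements are disjoint, so their sum is their supremum, and both
  of them lie below \<open>x + y\<close> and \<open>u\<close>.\<close>

lemma inf_add_of_disjoint: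
  fixes x y u :: "'a::banach_lattice" assumes "0 \<le> x" "0 \<le> y" "0 \<le> u" "inf x y = 0"
  shows "inf (x + y) u = inf x u + inf y u"
proof (rule antisym[OF inf_add_le[OF assms(1-3)]])
  have "inf (inf x u) (inf y u) = 0"
  proof (rule antisym)
    show "inf (inf x u) (inf y u) \<le> 0"
      using assms(4) by (metis inf.cobounded1 inf_mono)
  qed (use assms in auto)
  then have "inf x u + inf y u = sup (inf x u) (inf y u)"
    using add_eq_inf_sup[of "inf x u" "inf y u"] by simp
  also have "\<dots> \<le> inf (x + y) u"
    using assms by (auto intro: le_infI1 add_increasing add_increasing2)
  finally show "inf x u + inf y u \<le> inf (x + y) u" .
qed

lemma abs_diff_of_disjoint:
  fixes x y :: "'a::banach_lattice" assumes "inf x y = 0"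
  shows "\<bar>x - y\<bar> = x + y"
proof -
  have "x + y - \<bar>x - y\<bar> = 0" using assms unfolding inf_eq_half_diff_abs scaleR_eq_0_iff by simp
  then show ?thesis by simp
qed

lemma inf_scaleR_eq_0:
  fixes x y :: "'a::banach_lattice" assumes "0 \<le> x" "0 \<le> y" "inf x y = 0" "0 \<le> c" "0 \<le> d"
  shows "inf (c *\<^sub>R x) (d *\<^sub>R y) = 0"
proof (rule antisym)
  have "inf (c *\<^sub>R x) (d *\<^sub>R y) \<le> inf (max c d *\<^sub>R x) (max c d *\<^sub>R y)"
    using assms by (intro inf_mono scaleR_right_mono) auto
  also have "\<dots> = 0" using assms by (simp add: inf_scaleR)
  finally show "inf (c *\<^sub>R x) (d *\<^sub>R y) \<le> 0" .
qed (use assms in \<open>auto intro: scaleR_nonneg_nonneg\<close>)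

lemma inf_eq_0_mono:
  fixes x y :: "'a::banach_lattice" assumes "inf x y = 0" "0 \<le> u" "u \<le> x" "0 \<le> v" "v \<le> y"
  shows "inf u v = 0"
  using assms by (metis antisym inf_mono le_inf_iff)

lemma inf_sum_eq_0:
  fixes f :: "'i \<Rightarrow> 'a::banach_lattice"
  assumes "finite A" "\<And>i. i \<in> A \<Longrightarrow> 0 \<le> f i" "0 \<le> u" "\<And>i. i \<in> A \<Longrightarrow> inf (f i) u = 0"
  shows "inf (sum f A) u = 0"
proof (rule antisym)
  have "inf (sum f A) u \<le> (\<Sum>i\<in>A. inf (f i) u)" by (rule inf_sum_le) (use assms in auto)
  also have "\<dots> = 0" using assms by (intro sum.neutral) auto
  finally show "inf (sum f A) u \<le> 0" .
qed (use assms in \<open>auto intro: sum_nonneg\<close>)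

lemma abs_add_of_disjoint:
  fixes x y :: "'a::banach_lattice" assumes "inf \<bar>x\<bar> \<bar>y\<bar> = 0"
  shows "\<bar>x + y\<bar> = \<bar>x\<bar> + \<bar>y\<bar>"
proof (rule antisym[OF abs_triangle_ineq])
  have "\<bar>x\<bar> + \<bar>y\<bar> = \<bar>\<bar>x\<bar> - \<bar>y\<bar>\<bar>" using abs_diff_of_disjoint[OF assms] by simp
  also have "\<dots> \<le> \<bar>x - (- y)\<bar>" using abs_triangle_ineq3[of x "-y"] by simp
  finally show "\<bar>x\<bar> + \<bar>y\<bar> \<le> \<bar>x + y\<bar>" by simp
qed

lemma abs_diff_le_of_nonneg:
  fixes a b c :: "'a::banach_lattice" assumes "0 \<le> a" "a \<le> c" "0 \<le> b" "b \<le> c"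
  shows "\<bar>a - b\<bar> \<le> c"
proof (rule abs_leI)
  show "a - b \<le> c" using diff_mono[OF assms(2,3)] by simp
  show "- (a - b) \<le> c" using diff_mono[OF assms(4,1)] by simp
qed

lemma abs_sum_of_disjoint:
  fixes f :: "'i \<Rightarrow> 'a::banach_lattice"
  assumes "finite A" "\<And>i j. i \<in> A \<Longrightarrow> j \<in> A \<Longrightarrow> i \<noteq> j \<Longrightarrow> inf \<bar>f i\<bar> \<bar>f j\<bar> = 0"
  shows "\<bar>sum f A\<bar> = (\<Sum>i\<in>A. \<bar>f i\<bar>)"
  using assms
proof (induction A rule: finite_induct)
  case (insert i A)
  have "inf (\<Sum>j\<in>A. \<bar>f j\<bar>) \<bar>f i\<bar> = 0"
  proof (rule inf_sum_eq_0)
    show "inf \<bar>f j\<bar> \<bar>f i\<bar> = 0" if "j \<in> A" for j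
      using that insert.hyps(2) by (intro insert.prems) auto
  qed (use insert.hyps in auto)
  then have "\<bar>f i + sum f A\<bar> = \<bar>f i\<bar> + \<bar>sum f A\<bar>"
    using insert by (intro abs_add_of_disjoint) (simp add: inf.commute)
  then show ?case using insert by simp
qed simp

section \<open>Archimedean property and convergence of bounded increasing sequences\<close>

lemma archimedean_banach_lattice:
  fixes x y :: "'a::banach_lattice" assumes "\<And>n::nat. real n *\<^sub>R x \<le> y" shows "x \<le> 0"
proof -
  have le: "x \<le> (1 / real (Suc n)) *\<^sub>R y" for n
  proof -
    have "(1 / real (Suc n)) *\<^sub>R (real (Suc n) *\<^sub>R x) \<le> (1 / real (Suc n)) *\<^sub>R y"
      by (rule scaleR_left_mono[OF assms]) simp
    then show ?thesis by (simp del: of_nat_Suc)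
  qed
  have "(\<lambda>n. (1 / real (Suc n)) *\<^sub>R y) \<longlonglongrightarrow> 0 *\<^sub>R y"
    using LIMSEQ_inverse_real_of_nat
    by (intro tendsto_scaleR tendsto_const) (simp only: inverse_eq_divide)
  then have "(\<lambda>n. (1 / real (Suc n)) *\<^sub>R y) \<longlonglongrightarrow> 0" by (simp only: scaleR_zero_left)
  then show ?thesis by (rule le_of_tendsto_banach_lattice[where N=0]) (rule le)
qed

text \<open>No supremum of \<open>x\<close> is known beforehand, so \<open>x\<close> is compared
  with all its upper bounds at once: the differences \<open>y - x n\<close>, indexed by pairs of an
  index and an upper bound, decrease to \<open>0\<close>. They are then small in norm, which makes
  \<open>x\<close> a Cauchy sequence.\<close>

lemma order_continuous_convergent:
  fixes x :: "nat \<Rightarrow> 'a::banach_lattice"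
  assumes oc: "order_continuous TYPE('a)" and x: "incseq x" "\<And>n. x n \<le> b"
  shows "convergent x"
proof -
  define D where "D = {y. \<forall>n. x n \<le> y}"
  define r :: "nat \<times> 'a \<Rightarrow> nat \<times> 'a \<Rightarrow> bool" where "r p q \<longleftrightarrow> fst p \<le> fst q \<and> snd q \<le> snd p" for p q
  define A where "A = (UNIV :: nat set) \<times> D"
  define u where "u p = snd p - x (fst p)" for p
  have bD: "b \<in> D" using x by (auto simp: D_def)
  have dir: "directed_set A r"
    unfolding directed_set_def
  proof (intro conjI ballI impI)
    show "A \<noteq> {}" using bD by (auto simp: A_def)
    fix a c assume ac: "a \<in> A" "c \<in> A"
    then have "(max (fst a) (fst c), inf (snd a) (snd c)) \<in> A" by (auto simp: A_def D_def)
    then show "\<exists>d\<in>A. r a d \<and> r c d" by (rule bexI[rotated]) (auto simp: r_def)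
  qed (auto simp: r_def)
  have dec: "net_decreases_to A r u 0"
    unfolding net_decreases_to_def
  proof (intro conjI ballI allI impI dir)
    show "u c \<le> u a" if "r a c" for a c
      using that incseqD[OF x(1)] by (auto simp: r_def u_def intro: diff_mono)
    show "0 \<le> u a" if "a \<in> A" for a using that by (auto simp: A_def D_def u_def)
    fix w assume w: "\<forall>a\<in>A. w \<le> u a"
    \<comment> \<open>A lower bound \<open>w\<close> of all differences can be subtracted from any
      upper bound and leaves an upper bound. Repetition puts every multiple of \<open>w\<close>
      below \<open>b - x 0\<close>.\<close>
    have *: "y - w \<in> D" if "y \<in> D" for y
      using w that by (auto simp: D_def A_def u_def algebra_simps)
    have "b - real n *\<^sub>R w \<in> D" for n
    proof (induction n)
      case (Suc n)
      have "b - real n *\<^sub>R w - w \<in> D" by (rule *) (rule Suc)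
      then show ?case by (simp add: algebra_simps)
    qed (use bD in simp)
    then have "real n *\<^sub>R w \<le> b - x 0" for n
      by (auto simp: D_def algebra_simps)
    then show "w \<le> 0" by (rule archimedean_banach_lattice)
  qed
  have "norm_converges A r u 0"
  proof (rule order_continuousD[OF oc], rule order_convergesI[OF dec])
    fix \<gamma> assume \<gamma>: "\<gamma> \<in> A"
    have "\<bar>u a - 0\<bar> \<le> u \<gamma>" if "a \<in> A" "r \<gamma> a" for a
      using dec that \<gamma> by (auto simp: net_decreases_to_def)
    then show "\<exists>a\<in>A. \<forall>c\<in>A. r a c \<longrightarrow> \<bar>u c - 0\<bar> \<le> u \<gamma>" using \<gamma> by blast
  qed
  have "Cauchy x"
  proof (rule metric_CauchyI)
    fix \<epsilon> :: real assume "\<epsilon> > 0"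
    then have "\<epsilon>/2 > 0" by simp
    then obtain a where a: "a \<in> A" "\<forall>c\<in>A. r a c \<longrightarrow> norm (u c - 0) < \<epsilon>/2"
      using \<open>norm_converges A r u 0\<close> unfolding norm_converges_def by blast
    have near: "norm (snd a - x n) < \<epsilon>/2" if "n \<ge> fst a" for n
      using a(2)[rule_format, of "(n, snd a)"] a(1) that by (auto simp: A_def r_def u_def)
    have "dist (x m) (x n) < \<epsilon>" if "m \<ge> fst a" "n \<ge> fst a" for m n
      using norm_triangle_ineq4[of "snd a - x n" "snd a - x m"] near[OF that(1)] near[OF that(2)]
      by (simp add: dist_norm)
    then show "\<exists>M. \<forall>m\<ge>M. \<forall>n\<ge>M. dist (x m) (x n) < \<epsilon>" by blast
  qed
  then show ?thesis by (simp add: Cauchy_convergent_iff)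
qed

section \<open>Unconditional bases\<close>

lemma span_range_finite_sum:
  fixes y :: "nat \<Rightarrow> 'a::real_vector"
  assumes "x \<in> span (range y)"
  obtains a N where "\<And>k. N \<le> k \<Longrightarrow> a k = 0" "x = (\<Sum>k<N. a k *\<^sub>R y k)"
proof -
  have "\<exists>a N. (\<forall>k\<ge>N. a k = 0) \<and> x = (\<Sum>k<N. a k *\<^sub>R y k)"
    using assms
  proof (induction rule: span_induct_alt)
    case base then show ?case by (intro exI[of _ "\<lambda>_. 0"]) auto
  next
    case (step c x z)
    then obtain j a N where j: "x = y j" and a: "\<forall>k\<ge>N. a k = 0" "z = (\<Sum>k<N. a k *\<^sub>R y k)" by auto
    define M where "M = max N (Suc j)"
    have "z = (\<Sum>k<M. a k *\<^sub>R y k)"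
      unfolding a(2) by (rule sum.mono_neutral_left) (use a(1) in \<open>auto simp: M_def\<close>)
    moreover have "c *\<^sub>R x = (\<Sum>k<M. (if k = j then c else 0) *\<^sub>R y k)"
    proof -
      have "(if k = j then c else 0) *\<^sub>R y k = (if k = j then c *\<^sub>R y j else 0)" for k by simp
      moreover have "j < M" unfolding M_def by simp
      ultimately show ?thesis by (simp add: j)
    qed
    ultimately have "c *\<^sub>R x + z = (\<Sum>k<M. (a k + (if k = j then c else 0)) *\<^sub>R y k)"
      by (simp add: sum.distrib scaleR_left_distrib)
    moreover have "\<forall>k\<ge>M. a k + (if k = j then c else 0) = 0" using a(1) by (auto simp: M_def)
    ultimately show ?case by (intro exI[of _ "\<lambda>k. a k + (if k = j then c else 0)"] exI[of _ M]) blast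
  qed
  then show ?thesis using that by blast
qed

text \<open>Unconditionality as a bound for deleting terms. It is checked on finite sums only, and
  still gives expansions on the whole closed span, their uniqueness, and convergence under
  rearrangement.\<close>

locale suppression_unconditional =
  fixes y :: "nat \<Rightarrow> 'a::banach" and K :: real
  assumes nz: "\<And>k. y k \<noteq> 0"
    and K: "\<And>A N a. A \<subseteq> {..<N} \<Longrightarrow> norm (\<Sum>k\<in>A. a k *\<^sub>R y k) \<le> K * norm (\<Sum>k<N. a k *\<^sub>R y k)"
begin

lemma K_pos: "K > 0"
proof -
  have "norm (y 0) \<le> K * norm (y 0)" using K[of "{0}" 1 "\<lambda>_. 1"] by simp
  moreover have "norm (y 0) > 0" using nz by simp
  ultimately show ?thesis by (smt (verit) mult_nonneg_nonneg mult_less_0_iff zero_less_mult_iff)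
qed

lemma coeff_bound:
  assumes "j < N" shows "\<bar>a j\<bar> * norm (y j) \<le> K * norm (\<Sum>k<N. a k *\<^sub>R y k)"
  using K[of "{j}" N a] assms by simp

lemma block_bound:
  assumes "A \<subseteq> {M..<N}"
  shows "norm (\<Sum>k\<in>A. a k *\<^sub>R y k) \<le> K * norm (\<Sum>k=M..<N. a k *\<^sub>R y k)"
proof -
  let ?b = "\<lambda>k. if M \<le> k then a k else 0"
  have "(\<Sum>k\<in>A. a k *\<^sub>R y k) = (\<Sum>k\<in>A. ?b k *\<^sub>R y k)"
    using assms by (intro sum.cong) auto
  moreover have "(\<Sum>k=M..<N. a k *\<^sub>R y k) = (\<Sum>k<N. ?b k *\<^sub>R y k)"
    by (rule sum.mono_neutral_cong_left) auto
  moreover have "A \<subseteq> {..<N}" using assms by auto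
  ultimately show ?thesis using K[of A N ?b] by simp
qed

lemma sums_unique_coeff:
  assumes "(\<lambda>k. a k *\<^sub>R y k) sums v" "(\<lambda>k. b k *\<^sub>R y k) sums v"
  shows "a = b"
proof
  fix j
  have "(\<lambda>k. (a k - b k) *\<^sub>R y k) sums 0"
    using sums_diff[OF assms] by (simp add: scaleR_left_diff_distrib)
  then have "(\<lambda>n. K * norm (\<Sum>k<n. (a k - b k) *\<^sub>R y k)) \<longlonglongrightarrow> K * norm (0::'a)"
    unfolding sums_def by (intro tendsto_intros)
  moreover have "\<bar>a j - b j\<bar> * norm (y j) \<le> K * norm (\<Sum>k<n. (a k - b k) *\<^sub>R y k)" if "n \<ge> Suc j" for n
    using coeff_bound[of j n "\<lambda>k. a k - b k"] that by simp
  ultimately have "\<bar>a j - b j\<bar> * norm (y j) \<le> K * norm (0::'a)"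
    by (intro LIMSEQ_le_const) auto
  then show "a j = b j" using nz[of j] by (simp add: mult_le_0_iff)
qed

lemma expansion_exists:
  assumes "v \<in> closed_span y" shows "\<exists>a. (\<lambda>k. a k *\<^sub>R y k) sums v"
proof -
  obtain F where F: "\<And>j. F j \<in> span (range y)" "F \<longlonglongrightarrow> v"
    using assms unfolding closed_span_def closure_sequential by auto
  have "\<exists>a N. (\<forall>k\<ge>N. a k = 0) \<and> F j = (\<Sum>k<N. a k *\<^sub>R y k)" for j
    using span_range_finite_sum[OF F(1)[of j]] by metis
  then obtain a N where a: "\<And>j k. N j \<le> k \<Longrightarrow> a j k = 0" "\<And>j. F j = (\<Sum>k<N j. a j k *\<^sub>R y k)"
    by metis
  have Fn: "F j = (\<Sum>k<n. a j k *\<^sub>R y k)" if "N j \<le> n" for j n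
    unfolding a(2) by (rule sum.mono_neutral_left) (use that a(1) in auto)
  \<comment> \<open>Both expansions are padded with zeros to a common length that also covers
    \<open>A\<close>, so that the deletion bound applies to their difference.\<close>
  have diff: "norm (\<Sum>k\<in>A. (a i k - a j k) *\<^sub>R y k) \<le> K * norm (F i - F j)" if fin: "finite A" for A i j
  proof -
    obtain m where "A \<subseteq> {..<m}" using fin finite_nat_bounded by blast
    then have m: "A \<subseteq> {..<max m (max (N i) (N j))}" by (rule order_trans) auto
    have "F i = (\<Sum>k<max m (max (N i) (N j)). a i k *\<^sub>R y k)"
      "F j = (\<Sum>k<max m (max (N i) (N j)). a j k *\<^sub>R y k)" by (rule Fn, simp)+
    then have "F i - F j = (\<Sum>k<max m (max (N i) (N j)). (a i k - a j k) *\<^sub>R y k)"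
      by (simp only: sum_subtractf scaleR_left_diff_distrib)
    then show ?thesis using K[OF m, of "\<lambda>k. a i k - a j k"] by simp
  qed
  have "\<exists>l. (\<lambda>j. a j k) \<longlonglongrightarrow> l" for k
  proof -
    have "Cauchy F" using F(2) by (rule LIMSEQ_imp_Cauchy)
    have "Cauchy (\<lambda>j. a j k)"
    proof (rule metric_CauchyI)
      fix \<epsilon> :: real assume "\<epsilon> > 0"
      then have "\<epsilon> * norm (y k) / K > 0" using nz K_pos by simp
      then obtain M where M: "\<And>i j. i \<ge> M \<Longrightarrow> j \<ge> M \<Longrightarrow> dist (F i) (F j) < \<epsilon> * norm (y k) / K"
        using \<open>Cauchy F\<close> unfolding Cauchy_def by blast
      have "dist (a i k) (a j k) < \<epsilon>" if "i \<ge> M" "j \<ge> M" for i j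
      proof -
        have "\<bar>a i k - a j k\<bar> * norm (y k) \<le> K * norm (F i - F j)" using diff[of "{k}" i j] by simp
        also have "\<dots> < \<epsilon> * norm (y k)" using M[OF that] K_pos by (simp add: dist_norm field_simps)
        finally show ?thesis using nz[of k] by (simp add: dist_real_def)
      qed
      then show "\<exists>M. \<forall>m\<ge>M. \<forall>n\<ge>M. dist (a m k) (a n k) < \<epsilon>" by blast
    qed
    then show ?thesis by (simp add: Cauchy_convergent_iff convergent_def)
  qed
  then obtain l where l: "\<And>k. (\<lambda>j. a j k) \<longlonglongrightarrow> l k" by metis
  \<comment> \<open>The bound does not depend on the length \<open>n\<close>. One \<open>i\<close>
    with \<open>F i\<close> close to \<open>v\<close> therefore controls all long partial sums of
    the limit coefficients.\<close>
  have S: "norm ((\<Sum>k<n. a i k *\<^sub>R y k) - (\<Sum>k<n. l k *\<^sub>R y k)) \<le> K * norm (F i - v)" for i n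
  proof (rule LIMSEQ_le)
    show "(\<lambda>j. norm (\<Sum>k<n. (a i k - a j k) *\<^sub>R y k)) \<longlonglongrightarrow> norm ((\<Sum>k<n. a i k *\<^sub>R y k) - (\<Sum>k<n. l k *\<^sub>R y k))"
      unfolding sum_subtractf[symmetric] scaleR_left_diff_distrib[symmetric] by (intro tendsto_intros l)
    show "(\<lambda>j. K * norm (F i - F j)) \<longlonglongrightarrow> K * norm (F i - v)" by (intro tendsto_intros F(2))
    show "\<exists>N. \<forall>j\<ge>N. norm (\<Sum>k<n. (a i k - a j k) *\<^sub>R y k) \<le> K * norm (F i - F j)"
      by (intro exI allI impI diff) simp
  qed
  have "(\<lambda>n. \<Sum>k<n. l k *\<^sub>R y k) \<longlonglongrightarrow> v"
  proof (rule LIMSEQ_I)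
    fix \<epsilon> :: real assume "\<epsilon> > 0"
    then have "\<epsilon> / (K + 1) > 0" using K_pos by simp
    then obtain i where i: "norm (F i - v) < \<epsilon> / (K + 1)" using LIMSEQ_D[OF F(2)] by blast
    have "norm ((\<Sum>k<n. l k *\<^sub>R y k) - v) < \<epsilon>" if "n \<ge> N i" for n
    proof -
      have "norm ((\<Sum>k<n. l k *\<^sub>R y k) - v) \<le> norm ((\<Sum>k<n. l k *\<^sub>R y k) - F i) + norm (F i - v)"
        using norm_triangle_ineq[of "(\<Sum>k<n. l k *\<^sub>R y k) - F i" "F i - v"] by simp
      also have "norm ((\<Sum>k<n. l k *\<^sub>R y k) - F i) \<le> K * norm (F i - v)"
        using S[where i=i and n=n] Fn[OF that] by (simp add: norm_minus_commute)
      also have "K * norm (F i - v) + norm (F i - v) = (K + 1) * norm (F i - v)" by (simp add: algebra_simps)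
      also have "\<dots> < \<epsilon>" using i K_pos by (simp add: field_simps)
      finally show ?thesis by simp
    qed
    then show "\<exists>M. \<forall>n\<ge>M. norm ((\<Sum>k<n. l k *\<^sub>R y k) - v) < \<epsilon>" by blast
  qed
  then show ?thesis unfolding sums_def by blast
qed

lemma schauder_basic: "schauder_basic y"
  unfolding schauder_basic_def using expansion_exists sums_unique_coeff by blast

text \<open>A finite index set that contains \<open>{..<M}\<close> exceeds it by a subset of a block
  beyond \<open>M\<close>. The deletion bound controls this subset by the whole block, which is
  small. Convergence along finite sets is insensitive to rearrangement.\<close>

lemma sums_imp_has_sum:
  assumes v: "(\<lambda>k. a k *\<^sub>R y k) sums v" shows "((\<lambda>k. a k *\<^sub>R y k) has_sum v) UNIV"
  unfolding has_sum_def tendsto_iff eventually_finite_subsets_at_top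
proof (intro allI impI)
  fix \<epsilon> :: real assume "\<epsilon> > 0"
  define \<eta> where "\<eta> = \<epsilon> / (2 * K + 2)"
  have "(2 * K + 2) * \<eta> = \<epsilon>" using K_pos by (simp add: \<eta>_def)
  then have \<eta>: "\<eta> > 0" "2 * (K * \<eta>) + 2 * \<eta> = \<epsilon>"
    using \<open>\<epsilon> > 0\<close> K_pos by (simp add: \<eta>_def, simp add: algebra_simps)
  obtain M where M: "\<And>n. n \<ge> M \<Longrightarrow> norm ((\<Sum>k<n. a k *\<^sub>R y k) - v) < \<eta>"
    using LIMSEQ_D[OF v[unfolded sums_def] \<eta>(1)] by blast
  have "dist (\<Sum>k\<in>Y. a k *\<^sub>R y k) v < \<epsilon>" if Y: "finite Y" "{..<M} \<subseteq> Y" for Y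
  proof -
    obtain n where n: "Y \<subseteq> {..<n}" using Y(1) finite_nat_bounded by blast
    have "{..<M} \<subseteq> {..<n}" using n Y(2) by (rule order_trans[rotated])
    then have Mn: "M \<le> n" by simp
    have split: "(\<Sum>k\<in>Y. a k *\<^sub>R y k) = (\<Sum>k<M. a k *\<^sub>R y k) + (\<Sum>k\<in>Y - {..<M}. a k *\<^sub>R y k)"
      using sum.subset_diff[OF Y(2) Y(1)] by (simp add: add.commute)
    have "norm (\<Sum>k\<in>Y - {..<M}. a k *\<^sub>R y k) \<le> K * norm (\<Sum>k=M..<n. a k *\<^sub>R y k)"
      by (rule block_bound) (use n in auto)
    also have "(\<Sum>k=M..<n. a k *\<^sub>R y k) = ((\<Sum>k<n. a k *\<^sub>R y k) - v) - ((\<Sum>k<M. a k *\<^sub>R y k) - v)"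
      using sum.atLeastLessThan_concat[of 0 M n "\<lambda>k. a k *\<^sub>R y k"] Mn by (simp add: atLeast0LessThan algebra_simps)
    also have "K * norm \<dots> \<le> K * (\<eta> + \<eta>)"
      using norm_triangle_ineq4[of "(\<Sum>k<n. a k *\<^sub>R y k) - v" "(\<Sum>k<M. a k *\<^sub>R y k) - v"] M[OF Mn] M[of M] K_pos
      by (intro mult_left_mono) auto
    finally have 1: "norm (\<Sum>k\<in>Y - {..<M}. a k *\<^sub>R y k) \<le> 2 * (K * \<eta>)" by (simp add: algebra_simps)
    have "norm ((\<Sum>k\<in>Y. a k *\<^sub>R y k) - v) \<le> norm ((\<Sum>k<M. a k *\<^sub>R y k) - v) + norm (\<Sum>k\<in>Y - {..<M}. a k *\<^sub>R y k)"
      unfolding split using norm_triangle_ineq[of "(\<Sum>k<M. a k *\<^sub>R y k) - v" "(\<Sum>k\<in>Y - {..<M}. a k *\<^sub>R y k)"]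
      by (simp add: algebra_simps)
    then show ?thesis using 1 M[of M] \<eta> by (simp add: dist_norm)
  qed
  then show "\<exists>X. finite X \<and> X \<subseteq> UNIV \<and> (\<forall>Y. finite Y \<and> X \<subseteq> Y \<and> Y \<subseteq> UNIV \<longrightarrow> dist (\<Sum>k\<in>Y. a k *\<^sub>R y k) v < \<epsilon>)"
    by (intro exI[of _ "{..<M}"]) simp
qed

lemma unconditional_basic: "unconditional_basic y"
  unfolding unconditional_basic_def
proof (intro conjI schauder_basic ballI allI impI)
  fix v a and \<pi> :: "nat \<Rightarrow> nat"
  assume v: "(\<lambda>k. a k *\<^sub>R y k) sums v" and \<pi>: "bij \<pi>"
  have "((\<lambda>k. a (\<pi> k) *\<^sub>R y (\<pi> k)) has_sum v) UNIV"
    using sums_imp_has_sum[OF v] has_sum_reindex_bij_betw[OF \<pi>, of "\<lambda>k. a k *\<^sub>R y k"] by simp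
  then show "(\<lambda>k. a (\<pi> k) *\<^sub>R y (\<pi> k)) sums v" by (rule has_sum_imp_sums)
qed

lemma coeff_bounded_of_sums:
  assumes norm1: "\<And>k. norm (y k) = 1" and v: "(\<lambda>k. a k *\<^sub>R y k) sums v"
  obtains \<alpha> where "\<alpha> \<ge> 0" "\<And>k. \<bar>a k\<bar> \<le> \<alpha>"
proof -
  have "Bseq (\<lambda>n. \<Sum>k<n. a k *\<^sub>R y k)"
    using v unfolding sums_def by (meson convergent_def convergent_imp_Bseq)
  then obtain B where B: "\<And>n. norm (\<Sum>k<n. a k *\<^sub>R y k) \<le> B" unfolding Bseq_def by blast
  have "\<bar>a k\<bar> \<le> K * B" for k
  proof -
    have "\<bar>a k\<bar> \<le> K * norm (\<Sum>i<Suc k. a i *\<^sub>R y i)" using coeff_bound[of k "Suc k" a] norm1 by simp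
    also have "\<dots> \<le> K * B" using K_pos by (intro mult_left_mono B) simp
    finally show ?thesis .
  qed
  then show ?thesis using that[of "K * B"] by (meson abs_ge_zero order_trans)
qed

end

section \<open>Positive functionals\<close>

definition sublinear :: "('a::real_vector \<Rightarrow> real) \<Rightarrow> bool" where
  "sublinear p \<longleftrightarrow> (\<forall>x y. p (x + y) \<le> p x + p y) \<and> (\<forall>c\<ge>0. \<forall>x. p (c *\<^sub>R x) = c * p x)"

lemma sublinearI:
  assumes "\<And>x y. p (x + y) \<le> p x + p y" "p 0 = 0" "\<And>c x. c > 0 \<Longrightarrow> p (c *\<^sub>R x) \<le> c * p x"
  shows "sublinear p"
  unfolding sublinear_def
proof (intro conjI allI impI assms(1))
  fix c :: real and x assume "0 \<le> c"
  show "p (c *\<^sub>R x) = c * p x"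
  proof (cases "c = 0")
    case False
    then have c: "c > 0" using \<open>0 \<le> c\<close> by simp
    have "p ((1/c) *\<^sub>R (c *\<^sub>R x)) \<le> (1/c) * p (c *\<^sub>R x)" using c by (intro assms(3)) simp
    then have "c * p x \<le> p (c *\<^sub>R x)" using c by (simp add: field_simps)
    then show ?thesis using assms(3)[OF c, of x] by simp
  qed (simp add: assms(2))
qed

lemma sublinear_add: "sublinear p \<Longrightarrow> p (x + y) \<le> p x + p y"
  by (simp add: sublinear_def)

lemma sublinear_scaleR: "sublinear p \<Longrightarrow> 0 \<le> c \<Longrightarrow> p (c *\<^sub>R x) = c * p x"
  by (simp add: sublinear_def)

lemma sublinear_zero: "sublinear p \<Longrightarrow> p 0 = 0"
  using sublinear_scaleR[of p 0 0] by simp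

lemma sublinear_lower: "sublinear p \<Longrightarrow> - p (- x) \<le> p x"
  using sublinear_add[of p x "-x"] sublinear_zero[of p] by simp

text \<open>Zorn's lemma for the reversed pointwise order. The infimum of a chain is finite because
  \<open>- p (- x)\<close> bounds all members from below, and it is subadditive because two members
  of a chain can be replaced by the smaller one.\<close>

lemma minimal_sublinear:
  assumes p: "sublinear p"
  obtains q where "sublinear q" "\<And>x. q x \<le> p x"
    "\<And>q'. sublinear q' \<Longrightarrow> (\<And>x. q' x \<le> q x) \<Longrightarrow> q' = q"
proof -
  define A where "A = {q. sublinear q \<and> (\<forall>x. q x \<le> p x)}"
  define P :: "('a \<Rightarrow> real) \<Rightarrow> ('a \<Rightarrow> real) \<Rightarrow> bool" where "P q r \<longleftrightarrow> (\<forall>x. r x \<le> q x)" for q r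
  have "\<exists>m\<in>A. \<forall>a\<in>A. P m a \<longrightarrow> a = m"
  proof (rule predicate_Zorn)
    show "partial_order_on A (relation_of P A)"
    proof (rule partial_order_on_relation_ofI)
      show "P a c" if "P a b" "P b c" for a b c
        unfolding P_def
      proof
        fix x show "c x \<le> a x" using that unfolding P_def by (meson order_trans)
      qed
      show "a = b" if "P a b" "P b a" for a b
      proof
        fix x show "a x = b x" using that unfolding P_def by (simp add: order_antisym)
      qed
    qed (simp add: P_def)
    fix C assume C: "C \<in> Chains (relation_of P A)"
    have CA: "C \<subseteq> A" using C by (auto simp: Chains_def relation_of_def)
    have Cl: "P q r \<or> P r q" if "q \<in> C" "r \<in> C" for q r
      using C that by (auto simp: Chains_def relation_of_def)
    show "\<exists>u\<in>A. \<forall>a\<in>C. P a u"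
    proof (cases "C = {}")
      case True then show ?thesis using p by (auto simp: A_def)
    next
      case False
      define u where "u x = (INF q\<in>C. q x)" for x
      have low: "- p (- x) \<le> q x" if "q \<in> C" for q x
      proof -
        have "sublinear q" "q (- x) \<le> p (- x)" using that CA by (auto simp: A_def)
        then show ?thesis using sublinear_lower[of q x] by simp
      qed
      have u: "u x \<le> q x" if "q \<in> C" for q x
        unfolding u_def using that low by (intro cINF_lower) (auto intro!: bdd_belowI2)
      have uI: "b \<le> u x" if "\<And>q. q \<in> C \<Longrightarrow> b \<le> q x" for b x
        unfolding u_def using that False by (intro cINF_greatest) auto
      have sub: "sublinear q" if "q \<in> C" for q using that CA by (auto simp: A_def)
      have "sublinear u"
      proof (rule sublinearI)
        fix x y
        have *: "u (x + y) \<le> q x + r y" if qr: "q \<in> C" "r \<in> C" for q r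
        proof -
          obtain m where m: "m \<in> C" "\<And>x. m x \<le> q x" "\<And>x. m x \<le> r x"
            using Cl[OF qr] qr unfolding P_def by blast
          show ?thesis using u[OF m(1), of "x + y"] sublinear_add[OF sub[OF m(1)], of x y] m(2)[of x] m(3)[of y] by linarith
        qed
        have "u (x + y) - q x \<le> u y" if "q \<in> C" for q
          using *[OF that] by (intro uI) (simp add: algebra_simps)
        then have "u (x + y) - u y \<le> u x" by (intro uI) (simp add: algebra_simps)
        then show "u (x + y) \<le> u x + u y" by simp
      next
        obtain q where "q \<in> C" using False by blast
        then have "u 0 \<le> 0" using u[of q 0] sublinear_zero[OF sub, of q] by simp
        moreover have "0 \<le> u 0" by (rule uI) (simp add: sublinear_zero sub)
        ultimately show "u 0 = 0" by simp
      next
        fix c :: real and x assume c: "c > 0"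
        have "u (c *\<^sub>R x) / c \<le> u x"
        proof (rule uI)
          fix q assume "q \<in> C"
          then show "u (c *\<^sub>R x) / c \<le> q x"
            using u[of q "c *\<^sub>R x"] sublinear_scaleR[OF sub, of q c x] c by (simp add: field_simps)
        qed
        then show "u (c *\<^sub>R x) \<le> c * u x" using c by (simp add: field_simps)
      qed
      moreover obtain q where "q \<in> C" using False by blast
      then have "q x \<le> p x" for x using CA by (auto simp: A_def)
      then have "\<forall>x. u x \<le> p x" using u[OF \<open>q \<in> C\<close>] order_trans by blast
      ultimately show ?thesis using u by (intro bexI[of _ u]) (auto simp: A_def P_def)
    qed
  qed
  then obtain m where m: "m \<in> A" "\<And>a. a \<in> A \<Longrightarrow> P m a \<Longrightarrow> a = m" by blast
  show ?thesis
  proof (rule that[of m])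
    show "q' = m" if "sublinear q'" "\<And>x. q' x \<le> m x" for q'
    proof (rule m(2))
      have "q' x \<le> p x" for x using that(2)[of x] m(1) by (force simp: A_def intro: order_trans)
      then show "q' \<in> A" using that(1) by (simp add: A_def)
    qed (simp add: P_def that(2))
  qed (use m(1) in \<open>auto simp: A_def\<close>)
qed

text \<open>The two required bounds are the cases \<open>t = 0\<close> and \<open>t = 1\<close> of a
  family over \<open>t \<ge> 0\<close>; the infimum over the whole family is positively homogeneous,
  as rescaling \<open>x\<close> only rescales \<open>t\<close>.\<close>

lemma sublinear_shift:
  assumes q: "sublinear q"
  obtains r where "sublinear r" "\<And>x. r x \<le> q x" "\<And>x. r x \<le> q (x + y) - q y"
proof -
  define r where "r x = (INF t\<in>{0..}. q (x + t *\<^sub>R y) - t * q y)" for x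
  have low: "- q (- x) \<le> q (x + t *\<^sub>R y) - t * q y" if "0 \<le> t" for x t
    using sublinear_add[OF q, of "x + t *\<^sub>R y" "- x"] sublinear_scaleR[OF q that, of y] by simp
  have r: "r x \<le> q (x + t *\<^sub>R y) - t * q y" if "0 \<le> t" for x t
    unfolding r_def using that low by (intro cINF_lower) (auto intro!: bdd_belowI2)
  have rI: "b \<le> r x" if "\<And>t. 0 \<le> t \<Longrightarrow> b \<le> q (x + t *\<^sub>R y) - t * q y" for b x
    unfolding r_def using that by (intro cINF_greatest) auto
  have "sublinear r"
  proof (rule sublinearI)
    fix x z
    have *: "r (x + z) \<le> (q (x + s *\<^sub>R y) - s * q y) + (q (z + t *\<^sub>R y) - t * q y)" if "0 \<le> s" "0 \<le> t" for s t
    proof -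
      have "r (x + z) \<le> q ((x + s *\<^sub>R y) + (z + t *\<^sub>R y)) - (s + t) * q y"
        using r[of "s + t" "x + z"] that by (simp add: algebra_simps)
      then show ?thesis using sublinear_add[OF q, of "x + s *\<^sub>R y" "z + t *\<^sub>R y"] by (simp add: algebra_simps)
    qed
    have "r (x + z) - (q (x + s *\<^sub>R y) - s * q y) \<le> r z" if "0 \<le> s" for s
      by (rule rI) (use *[OF that] in \<open>simp add: algebra_simps\<close>)
    then have "r (x + z) - r z \<le> r x" by (intro rI) (simp add: algebra_simps)
    then show "r (x + z) \<le> r x + r z" by simp
  next
    have "0 \<le> r 0" using low[of _ 0] sublinear_zero[OF q] by (intro rI) simp
    then show "r 0 = 0" using r[of 0 0] sublinear_zero[OF q] by simp
  next
    fix c :: real and x assume c: "c > 0"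
    have "r (c *\<^sub>R x) / c \<le> r x"
    proof (rule rI)
      fix t :: real assume t: "0 \<le> t"
      have "r (c *\<^sub>R x) \<le> q (c *\<^sub>R (x + t *\<^sub>R y)) - (c * t) * q y"
        using r[of "c * t" "c *\<^sub>R x"] c t by (simp add: algebra_simps)
      also have "\<dots> = c * (q (x + t *\<^sub>R y) - t * q y)"
        using sublinear_scaleR[OF q, of c "x + t *\<^sub>R y"] c by (simp only: less_imp_le) (simp add: algebra_simps)
      finally show "r (c *\<^sub>R x) / c \<le> q (x + t *\<^sub>R y) - t * q y" using c by (simp add: field_simps)
    qed
    then show "r (c *\<^sub>R x) \<le> c * r x" using c by (simp add: field_simps)
  qed
  then show ?thesis using that r[of 0] r[of 1] by simp
qed

text \<open>Minimal sublinear functionals are linear, since shifting does not decrease them.\<close>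

lemma hahn_banach_sublinear:
  assumes p: "sublinear p"
  obtains f where "linear f" "\<And>x. f x \<le> p x" "f g = p g"
proof -
  \<comment> \<open>Shifting by \<open>g\<close> before minimizing forces
    \<open>q (- g) \<le> - p g\<close>, which becomes \<open>p g \<le> q g\<close> once
    \<open>q\<close> is known to be odd.\<close>
  obtain r where r: "sublinear r" "\<And>x. r x \<le> p x" "\<And>x. r x \<le> p (x + g) - p g"
    using sublinear_shift[OF p] by blast
  obtain q where q: "sublinear q" "\<And>x. q x \<le> r x"
    "\<And>q'. sublinear q' \<Longrightarrow> (\<And>x. q' x \<le> q x) \<Longrightarrow> q' = q"
    using minimal_sublinear[OF r(1)] by blast
  have add: "q (x + y) = q x + q y" for x y
  proof -
    obtain s where s: "sublinear s" "\<And>x. s x \<le> q x" "\<And>x. s x \<le> q (x + y) - q y"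
      using sublinear_shift[OF q(1)] by blast
    then have "s = q" by (intro q(3))
    then have "q x + q y \<le> q (x + y)" using s(3)[of x] by simp
    then show ?thesis using sublinear_add[OF q(1), of x y] by simp
  qed
  have neg: "q (- x) = - q x" for x
    using add[of x "- x"] sublinear_zero[OF q(1)] by simp
  have "linear q"
  proof (rule linearI[OF add])
    fix c x show "q (c *\<^sub>R x) = c *\<^sub>R q x"
    proof (cases "0 \<le> c")
      case False
      then have "q ((- c) *\<^sub>R x) = (- c) * q x" by (intro sublinear_scaleR[OF q(1)]) simp
      then show ?thesis using neg[of "c *\<^sub>R x"] by simp
    qed (simp add: sublinear_scaleR[OF q(1)])
  qed
  moreover have qp: "q x \<le> p x" for x using q(2) r(2) order_trans by blast
  moreover have "q g = p g"
  proof (rule antisym[OF qp])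
    have "q (- g) \<le> p 0 - p g" using q(2)[of "- g"] r(3)[of "- g"] by simp
    then show "p g \<le> q g" using neg[of g] sublinear_zero[OF p] by simp
  qed
  ultimately show ?thesis using that by blast
qed

text \<open>The dominating functional is the norm of the positive part instead of the norm. It
  vanishes at \<open>- x\<close> for \<open>0 \<le> x\<close>, so domination includes
  positivity.\<close>

lemma positive_norming_functional:
  fixes g :: "'a::banach_lattice" assumes g: "0 \<le> g"
  obtains f where "linear f" "\<And>x. 0 \<le> x \<Longrightarrow> 0 \<le> f x" "\<And>x. \<bar>f x\<bar> \<le> norm x" "f g = norm g"
proof -
  define p :: "'a \<Rightarrow> real" where "p x = norm (sup x 0)" for x
  have "sublinear p"
  proof (rule sublinearI)
    fix x y :: 'a
    have "sup (x + y) 0 \<le> sup x 0 + sup y 0"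
      by (simp add: add_mono)
    then have "norm (sup (x + y) 0) \<le> norm (sup x 0 + sup y 0)"
      by (intro norm_le_of_abs_le) simp
    also have "\<dots> \<le> norm (sup x 0) + norm (sup y 0)" by (rule norm_triangle_ineq)
    finally show "p (x + y) \<le> p x + p y" unfolding p_def .
  next
    show "p 0 = 0" by (simp add: p_def)
    fix c :: real and x :: 'a assume c: "c > 0"
    have "sup (c *\<^sub>R x) 0 = c *\<^sub>R sup x 0"
      using abs_scaleR_banach_lattice[of c x] c by (simp add: sup_eq_half_add_abs scaleR_right_distrib)
    then show "p (c *\<^sub>R x) \<le> c * p x" using c by (simp add: p_def)
  qed
  then obtain f where f: "linear f" "\<And>x. f x \<le> p x" "f g = p g" using hahn_banach_sublinear by blast
  have pn: "p x \<le> norm x" for x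
  proof -
    have "\<bar>sup x 0\<bar> \<le> \<bar>x\<bar>" by (simp add: abs_ge_self)
    then show ?thesis unfolding p_def by (rule norm_mono_abs)
  qed
  have neg: "f (- x) = - f x" for x using f(1) by (rule linear_neg)
  show ?thesis
  proof (rule that[OF f(1)])
    show "0 \<le> f x" if "0 \<le> x" for x
      using f(2)[of "- x"] neg[of x] that by (simp add: p_def sup_absorb2)
    show "\<bar>f x\<bar> \<le> norm x" for x
      using f(2)[of x] f(2)[of "-x"] pn[of x] pn[of "-x"] neg[of x] by simp
    show "f g = norm g" using f(3) g by (simp add: p_def sup_absorb1)
  qed
qed

section \<open>A functional controlling the norm on an order interval\<close>

text \<open>The supremum over the window from \<open>n\<close> to \<open>n + k\<close>. Suprema of
  whole tails are obtained as its norm limits in \<open>k\<close>.\<close>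

primrec run_sup :: "(nat \<Rightarrow> 'a::lattice) \<Rightarrow> nat \<Rightarrow> nat \<Rightarrow> 'a" where
  "run_sup g n 0 = g n"
| "run_sup g n (Suc k) = sup (run_sup g n k) (g (n + Suc k))"

lemma run_sup_le: "(\<And>m. n \<le> m \<Longrightarrow> m \<le> n + k \<Longrightarrow> g m \<le> b) \<Longrightarrow> run_sup g n k \<le> b"
  by (induction k) auto

lemma le_run_sup: "j \<le> k \<Longrightarrow> g (n + j) \<le> run_sup g n k"
proof (induction k)
  case (Suc k)
  then show ?case by (cases "j = Suc k") (auto intro: le_supI1)
qed simp

lemma run_sup_le_sum:
  fixes g :: "nat \<Rightarrow> 'a::banach_lattice" assumes "\<And>m. 0 \<le> g m"
  shows "run_sup g n k \<le> (\<Sum>j\<le>k. g (n + j))"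
proof (induction k)
  case (Suc k)
  have "0 \<le> (\<Sum>j\<le>k. g (n + j))" by (intro sum_nonneg assms)
  then show ?case using Suc assms[of "n + Suc k"]
    by (auto intro!: le_supI intro: add_increasing add_increasing2 order_trans)
qed simp

lemma order_continuous_tail_sup:
  fixes g :: "nat \<Rightarrow> 'a::banach_lattice"
  assumes oc: "order_continuous TYPE('a)" and g: "\<And>m. g m \<le> e"
  shows "\<exists>w. \<forall>n. run_sup g n \<longlonglongrightarrow> w n \<and> (\<forall>m\<ge>n. g m \<le> w n) \<and>
    (\<forall>b. (\<forall>m\<ge>n. g m \<le> b) \<longrightarrow> w n \<le> b)"
proof -
  have "convergent (run_sup g n)" for n
  proof (rule order_continuous_convergent[OF oc])
    show "incseq (run_sup g n)" by (rule incseq_SucI) simp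
    show "run_sup g n k \<le> e" for k using g by (intro run_sup_le)
  qed
  then obtain w where w: "\<And>n. run_sup g n \<longlonglongrightarrow> w n" unfolding convergent_def by metis
  have "g m \<le> w n" if "n \<le> m" for n m
    using le_run_sup[of "m - n" _ g n] that by (intro le_of_tendsto_banach_lattice[OF w, of "m - n"]) simp
  moreover have "w n \<le> b" if "\<forall>m\<ge>n. g m \<le> b" for n b
    using that by (intro tendsto_le_banach_lattice[OF w, of 0] run_sup_le) simp
  ultimately show ?thesis using w by blast
qed

locale positive_functional =
  fixes \<phi> :: "'a::banach_lattice \<Rightarrow> real"
  assumes lin: "linear \<phi>" and pos: "\<And>x. 0 \<le> x \<Longrightarrow> 0 \<le> \<phi> x" and le_norm: "\<And>x. \<bar>\<phi> x\<bar> \<le> norm x"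
begin

lemma mono: "x \<le> y \<Longrightarrow> \<phi> x \<le> \<phi> y"
  using pos[of "y - x"] linear_diff[OF lin, of y x] by simp

lemma bounded_linear: "bounded_linear \<phi>"
  using lin le_norm by (intro linear_conv_bounded_linear[THEN iffD1] bounded_linear_intro[where K=1]) (auto simp: linear_add linear_scale)

lemma abs_le: "\<bar>\<phi> x\<bar> \<le> \<phi> \<bar>x\<bar>"
  using mono[OF abs_ge_self[of x]] mono[OF abs_ge_minus_self[of x]] linear_neg[OF lin, of x] by simp

end

lemma positive_functional_average:
  assumes f: "\<And>k::nat. positive_functional (f k)" and c: "\<And>k. 0 \<le> c k" "c sums 1"
  shows "positive_functional (\<lambda>x. \<Sum>k. c k * f k x)"
    and "0 \<le> x \<Longrightarrow> c k * f k x \<le> (\<Sum>k. c k * f k x)"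
proof -
  interpret f: positive_functional "f k" for k by (rule f)
  have le: "\<bar>c k * f k x\<bar> \<le> c k * norm x" for k x
    using c(1)[of k] f.le_norm[of k x] by (simp add: abs_mult mult_left_mono)
  have cs: "(\<lambda>k. c k * norm x) sums norm x" for x :: 'a using sums_mult2[OF c(2), of "norm x"] by simp
  have sm: "summable (\<lambda>k. \<bar>c k * f k x\<bar>)" for x
    by (rule summable_comparison_test'[OF sums_summable[OF cs[of x]], of 0]) (use le in simp)
  have sm': "summable (\<lambda>k. c k * f k x)" for x using sm by (rule summable_rabs_cancel)
  show "positive_functional (\<lambda>x. \<Sum>k. c k * f k x)"
  proof
    show "(\<Sum>k. c k * f k (x + y)) = (\<Sum>k. c k * f k x) + (\<Sum>k. c k * f k y)" for x y
      by (subst suminf_add[OF sm' sm']) (simp add: linear_add[OF f.lin] algebra_simps)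
    show "(\<Sum>k. c k * f k (r *\<^sub>R x)) = r *\<^sub>R (\<Sum>k. c k * f k x)" for r x
      using suminf_mult[OF sm', of r x] by (simp add: linear_scale[OF f.lin] algebra_simps)
    show "0 \<le> (\<Sum>k. c k * f k x)" if "0 \<le> x" for x
      using that c(1) f.pos by (intro suminf_nonneg sm') auto
    show "\<bar>\<Sum>k. c k * f k x\<bar> \<le> norm x" for x
    proof -
      have "\<bar>\<Sum>k. c k * f k x\<bar> \<le> (\<Sum>k. \<bar>c k * f k x\<bar>)" by (rule summable_rabs[OF sm])
      also have "\<dots> \<le> (\<Sum>k. c k * norm x)" by (rule suminf_le[OF le sm sums_summable[OF cs]])
      also have "\<dots> = norm x" by (rule sums_unique[OF cs, symmetric])
      finally show ?thesis .
    qed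
  qed
  show "c k * f k x \<le> (\<Sum>k. c k * f k x)" if "0 \<le> x"
    using sum_le_suminf[OF sm', of "{k}" x] c(1) f.pos[OF that] by simp
qed

text \<open>If every functional fails, there are elements \<open>g n\<close> below \<open>e\<close>
  of norm at least \<epsilon>, with norming functionals \<open>f n\<close>, such that each
  \<open>g\<close> is almost invisible to the earlier functionals. Consecutive tail suprema of
  \<open>g\<close> then stay \<epsilon>/2 apart in norm, although they decrease, are bounded below,
  and so converge in norm.\<close>

lemma functional_controls_norm_level:
  fixes e :: "'a::banach_lattice"
  assumes oc: "order_continuous TYPE('a)" and \<epsilon>: "\<epsilon> > 0"
  obtains \<phi> \<eta> where "positive_functional \<phi>" "\<eta> > 0"
    "\<And>g. 0 \<le> g \<Longrightarrow> g \<le> e \<Longrightarrow> \<phi> g \<le> \<eta> \<Longrightarrow> norm g < \<epsilon>"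
proof (rule ccontr)
  assume "\<not> thesis"
  with that have neg: "\<exists>g. 0 \<le> g \<and> g \<le> e \<and> \<phi> g \<le> \<eta> \<and> \<epsilon> \<le> norm g"
    if "positive_functional \<phi>" "\<eta> > 0" for \<phi> \<eta> using that by (meson not_le_imp_less)
  \<comment> \<open>In a state \<open>(F, g, f)\<close> the first entry accumulates the functionals
    chosen so far. Dividing by their number keeps it below the norm, so that \<open>neg\<close>
    applies to it.\<close>
  define P :: "nat \<Rightarrow> ('a \<Rightarrow> real) \<times> 'a \<times> ('a \<Rightarrow> real) \<Rightarrow> bool" where
    "P n s \<longleftrightarrow> (case s of (F, g, f) \<Rightarrow> positive_functional (\<lambda>x. F x / real (Suc n)) \<and>
       positive_functional f \<and> 0 \<le> g \<and> g \<le> e \<and> \<epsilon> \<le> norm g \<and> f g = norm g)" for n s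
  define Q :: "nat \<Rightarrow> ('a \<Rightarrow> real) \<times> 'a \<times> ('a \<Rightarrow> real) \<Rightarrow> ('a \<Rightarrow> real) \<times> 'a \<times> ('a \<Rightarrow> real) \<Rightarrow> bool" where
    "Q n s s' \<longleftrightarrow> (case s of (F, g, f) \<Rightarrow> case s' of (F', g', f') \<Rightarrow>
       F' = (\<lambda>x. F x + f' x) \<and> F g' \<le> \<epsilon> / 4 * (1/2)^n)" for n s s'
  have norming: "\<exists>f. positive_functional f \<and> f g = norm g" if "0 \<le> g" for g :: 'a
    using positive_norming_functional[OF that] unfolding positive_functional_def by metis
  have "\<exists>s. \<forall>n. P n (s n) \<and> Q n (s n) (s (Suc n))"
  proof (rule dependent_nat_choice)
    have "positive_functional (\<lambda>x::'a. 0)"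
      by unfold_locales auto
    then obtain g where g: "0 \<le> g" "g \<le> e" "\<epsilon> \<le> norm g" using neg[of "\<lambda>_. 0" 1] by auto
    moreover obtain f where "positive_functional f" "f g = norm g" using norming[OF g(1)] by blast
    ultimately have "P 0 (f, g, f)" by (simp add: P_def)
    then show "\<exists>s. P 0 s" by blast
  next
    fix s n assume "P n s"
    obtain F g f where s: "s = (F, g, f)" by (cases s)
    have F: "positive_functional (\<lambda>x. F x / real (Suc n))" using \<open>P n s\<close> by (simp add: P_def s)
    then obtain g' where g': "0 \<le> g'" "g' \<le> e" "F g' / real (Suc n) \<le> \<epsilon> / 4 * (1/2)^n / real (Suc n)" "\<epsilon> \<le> norm g'"
      using neg[OF F, of "\<epsilon> / 4 * (1/2)^n / real (Suc n)"] \<epsilon> by auto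
    have Fg: "F g' \<le> \<epsilon> / 4 * (1/2)^n" using g'(3) unfolding divide_le_cancel by simp
    obtain f' where f': "positive_functional f'" "f' g' = norm g'" using norming[OF g'(1)] by blast
    interpret F: positive_functional "\<lambda>x. F x / real (Suc n)" by (rule F)
    interpret f': positive_functional f' by (rule f')
    have Fadd: "F (x + y) = F x + F y" for x y
      using linear_add[OF F.lin, of x y] by (simp add: add_divide_distrib[symmetric] del: of_nat_Suc)
    have Fscale: "F (r *\<^sub>R x) = r * F x" for r x
      using linear_scale[OF F.lin, of r x] by (simp del: of_nat_Suc)
    have "positive_functional (\<lambda>x. (F x + f' x) / real (Suc (Suc n)))"
    proof
      show "(F (x + y) + f' (x + y)) / real (Suc (Suc n)) = (F x + f' x) / real (Suc (Suc n)) + (F y + f' y) / real (Suc (Suc n))" for x y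
        by (simp add: Fadd linear_add[OF f'.lin] add_divide_distrib[symmetric] algebra_simps del: of_nat_Suc)
      show "(F (r *\<^sub>R x) + f' (r *\<^sub>R x)) / real (Suc (Suc n)) = r *\<^sub>R ((F x + f' x) / real (Suc (Suc n)))" for r x
        by (simp add: Fscale linear_scale[OF f'.lin] algebra_simps del: of_nat_Suc)
      show "0 \<le> (F x + f' x) / real (Suc (Suc n))" if "0 \<le> x" for x
        using F.pos[OF that] f'.pos[OF that] by (simp add: zero_le_divide_iff)
      show "\<bar>(F x + f' x) / real (Suc (Suc n))\<bar> \<le> norm x" for x
      proof -
        have "\<bar>F x\<bar> \<le> real (Suc n) * norm x" using F.le_norm[of x] by (simp add: field_simps del: of_nat_Suc)
        then have "\<bar>F x + f' x\<bar> \<le> real (Suc (Suc n)) * norm x"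
          using f'.le_norm[of x] by (simp add: algebra_simps)
        then show ?thesis by (simp add: field_simps del: of_nat_Suc)
      qed
    qed
    then have "P (Suc n) (\<lambda>x. F x + f' x, g', f')" using g' f' by (simp add: P_def)
    moreover have "Q n s (\<lambda>x. F x + f' x, g', f')" using Fg by (simp add: Q_def s)
    ultimately show "\<exists>s'. P (Suc n) s' \<and> Q n s s'" by blast
  qed
  then obtain s where s: "\<And>n. P n (s n)" "\<And>n. Q n (s n) (s (Suc n))" by blast
  define F where "F n = fst (s n)" for n
  define g where "g n = fst (snd (s n))" for n
  define f where "f n = snd (snd (s n))" for n
  have sn: "s n = (F n, g n, f n)" for n by (simp add: F_def g_def f_def)
  have f: "positive_functional (f n)" and g: "0 \<le> g n" "g n \<le> e" "\<epsilon> \<le> norm (g n)" "f n (g n) = norm (g n)"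
    and F: "positive_functional (\<lambda>x. F n x / real (Suc n))" for n
    using s(1)[of n] unfolding sn P_def by simp_all
  have FSuc: "F (Suc n) = (\<lambda>x. F n x + f (Suc n) x)" "F n (g (Suc n)) \<le> \<epsilon> / 4 * (1/2)^n" for n
    using s(2)[of n] unfolding sn Q_def by simp_all
  interpret f: positive_functional "f n" for n by (rule f)
  have Fpos: "0 \<le> F n x" if "0 \<le> x" for n x
    using positive_functional.pos[OF F[of n] that] by (simp add: zero_le_divide_iff)
  \<comment> \<open>The invariant does not record how \<open>F 0\<close> and \<open>f 0\<close> are
    related, so the domination of \<open>f\<close> by \<open>F\<close> starts at index one. This is
    the source of the shifted indices below.\<close>
  have fF0: "f (Suc n) x \<le> F (Suc n) x" if "0 \<le> x" for n x using Fpos[OF that, of n] by (simp add: FSuc)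
  have fF: "f (Suc n) x \<le> F (Suc n + k) x" if "0 \<le> x" for n k x
  proof (induction k)
    case (Suc k)
    then show ?case using f.pos[OF that, of "Suc (Suc n + k)"] by (simp add: FSuc)
  qed (simp add: fF0[OF that])
  obtain w where "\<forall>n. run_sup g n \<longlonglongrightarrow> w n \<and> (\<forall>m\<ge>n. g m \<le> w n) \<and>
      (\<forall>b. (\<forall>m\<ge>n. g m \<le> b) \<longrightarrow> w n \<le> b)"
    using order_continuous_tail_sup[where g=g, OF oc g(2)] by blast
  then have w: "run_sup g n \<longlonglongrightarrow> w n" "n \<le> m \<Longrightarrow> g m \<le> w n" "(\<forall>m\<ge>n. g m \<le> b) \<Longrightarrow> w n \<le> b" for n m b
    by auto
  have "convergent (\<lambda>n. - w n)"
  proof (rule order_continuous_convergent[OF oc])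
    have "w (Suc n) \<le> w n" for n using w(2)[of n] by (intro w(3)) simp
    then show "incseq (\<lambda>n. - w n)" by (intro incseq_SucI) simp
    show "- w n \<le> 0" for n using order_trans[OF g(1) w(2)[OF order_refl]] by simp
  qed
  then obtain l where l: "(\<lambda>n. - w n) \<longlonglongrightarrow> l" unfolding convergent_def by blast
  have "(\<lambda>n. - w (Suc n) - (- w n)) \<longlonglongrightarrow> l - l" by (intro tendsto_diff l LIMSEQ_Suc)
  then have "(\<lambda>n. norm (- w (Suc n) - (- w n))) \<longlonglongrightarrow> 0" by (simp add: tendsto_norm_zero)
  then have ev: "\<forall>\<^sub>F n in sequentially. norm (- w (Suc n) - (- w n)) < \<epsilon>/2"
    using \<epsilon> by (intro order_tendstoD(2)) auto
  \<comment> \<open>On a window the supremum is at most the sum. The values of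
    \<open>f (Suc n)\<close> on the later \<open>g\<close> are dominated by a geometric series with
    first term \<epsilon>/4 and sum \<epsilon>/2.\<close>
  have fw: "f (Suc n) (w (Suc (Suc n))) \<le> \<epsilon>/2" for n
  proof (rule LIMSEQ_le_const2)
    show "(\<lambda>k. f (Suc n) (run_sup g (Suc (Suc n)) k)) \<longlonglongrightarrow> f (Suc n) (w (Suc (Suc n)))"
      by (rule bounded_linear.tendsto[OF f.bounded_linear w(1)])
    have "f (Suc n) (run_sup g (Suc (Suc n)) k) \<le> \<epsilon>/2" for k
    proof -
      have "f (Suc n) (run_sup g (Suc (Suc n)) k) \<le> f (Suc n) (\<Sum>j\<le>k. g (Suc (Suc n) + j))"
        by (intro f.mono run_sup_le_sum g)
      also have "\<dots> = (\<Sum>j\<le>k. f (Suc n) (g (Suc (Suc n + j))))" by (simp add: linear_sum[OF f.lin])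
      also have "\<dots> \<le> (\<Sum>j\<le>k. \<epsilon> / 4 * (1/2)^j)"
      proof (rule sum_mono)
        fix j
        have "f (Suc n) (g (Suc (Suc n + j))) \<le> F (Suc n + j) (g (Suc (Suc n + j)))" by (rule fF) (rule g)
        also have "\<dots> \<le> \<epsilon> / 4 * (1/2)^(Suc n + j)" by (rule FSuc)
        also have "\<dots> \<le> \<epsilon> / 4 * (1/2)^j" using \<epsilon> by (intro mult_left_mono power_decreasing) auto
        finally show "f (Suc n) (g (Suc (Suc n + j))) \<le> \<epsilon> / 4 * (1/2)^j" .
      qed
      also have "\<dots> = \<epsilon> / 4 * (\<Sum>j\<le>k. (1/2)^j)" by (simp add: sum_distrib_left)
      also have "(\<Sum>j\<le>k. (1/2)^j) \<le> (2::real)"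
        by (subst sum_gp0) (simp add: field_simps)
      finally show ?thesis using \<epsilon> by simp
    qed
    then show "\<exists>N. \<forall>k\<ge>N. f (Suc n) (run_sup g (Suc (Suc n)) k) \<le> \<epsilon>/2" by blast
  qed
  have "\<epsilon>/2 \<le> norm (- w (Suc (Suc n)) - (- w (Suc n)))" for n
  proof -
    have "\<epsilon> \<le> f (Suc n) (w (Suc n))" using g(3,4)[of "Suc n"] f.mono[OF w(2)[of "Suc n" "Suc n"], of "Suc n"] by simp
    then have "\<epsilon>/2 \<le> f (Suc n) (w (Suc n) - w (Suc (Suc n)))" using fw[of n] by (simp add: linear_diff[OF f.lin])
    also have "\<dots> \<le> norm (w (Suc n) - w (Suc (Suc n)))" using f.le_norm abs_le_D1 by blast
    finally show ?thesis by (simp add: algebra_simps)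
  qed
  then show False using ev unfolding eventually_sequentially by (meson le_SucI not_le_imp_less order_refl not_less)
qed

text \<open>The functionals for the levels \<open>inverse (real (Suc k))\<close> are averaged with
  weights \<open>(1/2)^Suc k\<close>. If the average is below the weight times the
  \<open>k\<close>-th threshold, the \<open>k\<close>-th functional is below its threshold, so one
  functional serves all levels.\<close>

lemma functional_controls_norm:
  fixes e :: "'a::banach_lattice"
  assumes oc: "order_continuous TYPE('a)"
  obtains \<phi> where "positive_functional \<phi>"
    "\<And>\<epsilon>. \<epsilon> > 0 \<Longrightarrow> \<exists>\<eta>>0. \<forall>g. 0 \<le> g \<longrightarrow> g \<le> e \<longrightarrow> \<phi> g \<le> \<eta> \<longrightarrow> norm g < \<epsilon>"
proof -
  have "\<exists>f \<eta>. positive_functional f \<and> \<eta> > 0 \<and> (\<forall>g. 0 \<le> g \<longrightarrow> g \<le> e \<longrightarrow> f g \<le> \<eta> \<longrightarrow> norm g < inverse (real (Suc k)))" for k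
    using functional_controls_norm_level[OF oc, of "inverse (real (Suc k))" e] by (metis inverse_positive_iff_positive of_nat_0_less_iff zero_less_Suc)
  then obtain f \<eta> where f: "\<And>k. positive_functional (f k)" "\<And>k. \<eta> k > 0"
    "\<And>k g. 0 \<le> g \<Longrightarrow> g \<le> e \<Longrightarrow> f k g \<le> \<eta> k \<Longrightarrow> norm g < inverse (real (Suc k))" by metis
  show ?thesis
  proof (rule that[OF positive_functional_average(1)[OF f(1) _ power_half_series]])
    fix \<epsilon> :: real assume "\<epsilon> > 0"
    then obtain k where k: "inverse (real (Suc k)) < \<epsilon>" using reals_Archimedean by blast
    show "\<exists>\<eta>>0. \<forall>g. 0 \<le> g \<longrightarrow> g \<le> e \<longrightarrow> (\<Sum>k. (1/2)^Suc k * f k g) \<le> \<eta> \<longrightarrow> norm g < \<epsilon>"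
    proof (intro exI[of _ "(1/2)^Suc k * \<eta> k"] conjI allI impI)
      fix g assume g: "0 \<le> g" "g \<le> e" "(\<Sum>k. (1/2)^Suc k * f k g) \<le> (1/2)^Suc k * \<eta> k"
      have "(1/2)^Suc k * f k g \<le> (\<Sum>k. (1/2)^Suc k * f k g)"
        by (rule positive_functional_average(2)[OF f(1) _ power_half_series g(1)]) simp
      then have "(1/2)^Suc k * f k g \<le> (1/2)^Suc k * \<eta> k" using g(3) by (rule order_trans)
      then have "f k g \<le> \<eta> k" by simp
      then show "norm g < \<epsilon>" using f(3)[OF g(1,2)] k by (meson less_trans)
    qed (use f(2) in simp)
  qed simp
qed

section \<open>Burkholder's weak type inequality\<close>

text \<open>Burkholder's function for the weak type bound; \<open>x\<close> is the value of the
  martingale and \<open>y\<close> that of its transform. The two branches agree on the boundary of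
  the diamond, where \<open>y\<^sup>2 - x\<^sup>2 = \<bar>y\<bar> - \<bar>x\<bar>\<close>.\<close>

definition burk :: "real \<Rightarrow> real \<Rightarrow> real" where
  "burk x y = (if \<bar>x\<bar> + \<bar>y\<bar> < 1 then y\<^sup>2 - x\<^sup>2 else 1 - 2 * \<bar>x\<bar>)"

text \<open>Together with \<open>burk_y\<close> these are the partial derivatives where they exist.
  At \<open>x = 0\<close> outside the diamond the kink of \<open>1 - 2 * \<bar>x\<bar>\<close>
  receives the slope \<open>sgn 0 = 0\<close>.\<close>

definition burk_x :: "real \<Rightarrow> real \<Rightarrow> real" where
  "burk_x x y = (if \<bar>x\<bar> + \<bar>y\<bar> < 1 then - 2 * x else - 2 * sgn x)"

definition burk_y :: "real \<Rightarrow> real \<Rightarrow> real" where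
  "burk_y x y = (if \<bar>x\<bar> + \<bar>y\<bar> < 1 then 2 * y else 0)"

lemma burk_majorant: "(if \<bar>y\<bar> \<ge> 1 then 1 else 0) - 2 * \<bar>x\<bar> \<le> burk x y"
proof (cases "\<bar>x\<bar> + \<bar>y\<bar> < 1")
  case True
  then have "\<bar>x\<bar> * \<bar>x\<bar> \<le> \<bar>x\<bar> * 1" by (intro mult_left_mono) auto
  then have "x\<^sup>2 \<le> 2 * \<bar>x\<bar>" by (simp add: power2_eq_square)
  then have "- 2 * \<bar>x\<bar> \<le> y\<^sup>2 - x\<^sup>2" using zero_le_power2[of y] by linarith
  moreover have "\<not> 1 \<le> \<bar>y\<bar>" using True by linarith
  ultimately show ?thesis using True unfolding burk_def by simp
qed (auto simp: burk_def)

text \<open>Completing squares turns the right-hand side into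
  \<open>(y + k)\<^sup>2 - (x + h)\<^sup>2\<close> plus the nonnegative term
  \<open>h\<^sup>2 - k\<^sup>2\<close>. This suffices while
  \<open>\<bar>x + h\<bar> \<le> 1\<close>; longer jumps need a separate factorization.\<close>

lemma burk_jump_outside:
  fixes x y h k :: real
  assumes "0 \<le> x" "x + \<bar>y\<bar> < 1" "\<bar>k\<bar> \<le> \<bar>h\<bar>" "1 \<le> \<bar>x + h\<bar> + \<bar>y + k\<bar>"
  shows "1 - 2 * \<bar>x + h\<bar> \<le> y\<^sup>2 - x\<^sup>2 - 2 * x * h + 2 * y * k"
proof -
  define Y where "Y = \<bar>y\<bar>"
  have sq: "y\<^sup>2 - x\<^sup>2 - 2 * x * h + 2 * y * k = (y + k)\<^sup>2 - (x + h)\<^sup>2 + h\<^sup>2 - k\<^sup>2"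
    by (simp add: power2_eq_square algebra_simps)
  have kh: "k\<^sup>2 \<le> h\<^sup>2" using assms(3) by (rule abs_le_square_iff[THEN iffD1])
  have yk: "- (Y * \<bar>h\<bar>) \<le> y * k"
  proof -
    have "\<bar>y * k\<bar> \<le> Y * \<bar>h\<bar>" unfolding Y_def abs_mult using assms(3) by (intro mult_left_mono) auto
    then show ?thesis by linarith
  qed
  have yy: "y\<^sup>2 = Y\<^sup>2" by (simp add: Y_def)
  consider "\<bar>x + h\<bar> \<le> 1" | "x + h > 1" | "x + h < -1" by linarith
  then show ?thesis
  proof cases
    case 1
    then have "(1 - \<bar>x + h\<bar>)\<^sup>2 \<le> \<bar>y + k\<bar>\<^sup>2" using assms(4) by (intro power_mono) auto
    then have "1 - 2 * \<bar>x + h\<bar> + (x + h)\<^sup>2 \<le> (y + k)\<^sup>2" by (simp add: power2_eq_square algebra_simps)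
    then show ?thesis unfolding sq using kh by linarith
  next
    case 2
    have h: "h > 1 - x" "h \<ge> 0" using 2 assms(1,2) by linarith+
    \<comment> \<open>Both factors are nonnegative since \<open>Y < 1 - x < h\<close>. Expanded, the
      product is the claim with \<open>y * k\<close> replaced by the lower bound
      \<open>- (Y * h)\<close>, after \<open>k\<close> has been eliminated.\<close>
    have "0 \<le> (1 - x - Y) * (2 * h - (1 - x) - Y)"
      using h assms by (intro mult_nonneg_nonneg) (auto simp: Y_def)
    then have "1 - 2 * (x + h) \<le> Y\<^sup>2 - x\<^sup>2 - 2 * x * h - 2 * (Y * h)"
      by (simp add: power2_eq_square algebra_simps)
    then show ?thesis using yk h yy 2 by simp
  next
    case 3
    have h: "- h > 1 + x" "h \<le> 0" using 3 assms(1,2) by linarith+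
    have "0 \<le> (1 + x - Y) * (2 * (- h) - (1 + x) - Y)"
      using h assms by (intro mult_nonneg_nonneg) (auto simp: Y_def)
    then have "1 + 2 * (x + h) \<le> Y\<^sup>2 - x\<^sup>2 - 2 * x * h + 2 * (Y * h)"
      by (simp add: power2_eq_square algebra_simps)
    then show ?thesis using yk h yy 3 by simp
  qed
qed

lemma burk_minus: "burk (- x) y = burk x y" "burk_x (- x) y = - burk_x x y" "burk_y (- x) y = burk_y x y"
  by (auto simp: burk_def burk_x_def burk_y_def sgn_minus)

text \<open>Along increments of slope at most one, \<open>burk\<close> lies below its tangent. This
  is the core of Burkholder's method: for a martingale and its transform the tangent terms integrate
  to zero, so the mean of \<open>burk\<close> cannot increase.\<close>

lemma burk_step_nonneg:
  assumes x: "0 \<le> x" and kh: "\<bar>k\<bar> \<le> \<bar>h\<bar>"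
  shows "burk (x + h) (y + k) \<le> burk x y + burk_x x y * h + burk_y x y * k"
proof (cases "\<bar>x\<bar> + \<bar>y\<bar> < 1")
  case True
  show ?thesis
  proof (cases "\<bar>x + h\<bar> + \<bar>y + k\<bar> < 1")
    case in2: True
    have "k\<^sup>2 \<le> h\<^sup>2" using kh by (rule abs_le_square_iff[THEN iffD1])
    then show ?thesis using True in2 by (simp add: burk_def burk_x_def burk_y_def power2_eq_square algebra_simps)
  next
    case False
    then show ?thesis using burk_jump_outside[of x y k h] True x kh
      by (simp add: burk_def burk_x_def burk_y_def)
  qed
next
  case out: False
  \<comment> \<open>Starting outside with \<open>x > 0\<close>, the tangent is
    \<open>1 - 2 * x\<close>. The function stays below it on both branches, so entering the diamond
    costs nothing.\<close>
  have key: "burk (x + h) (y + k) \<le> 1 - 2 * (x + h)" 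
  proof (cases "\<bar>x + h\<bar> + \<bar>y + k\<bar> < 1")
    case True
    then have "\<bar>y + k\<bar>\<^sup>2 \<le> (1 - (x + h))\<^sup>2" by (intro power_mono) auto
    then show ?thesis using True by (simp add: burk_def power2_eq_square algebra_simps)
  qed (use abs_ge_self[of "x + h"] in \<open>simp add: burk_def\<close>)
  \<comment> \<open>For a start at the kink \<open>x = 0\<close> the chosen tangent is the constant
    \<open>1\<close>.\<close>
  have key0: "burk (x + h) (y + k) \<le> 1"
  proof (cases "\<bar>x + h\<bar> + \<bar>y + k\<bar> < 1")
    case True
    then have "\<bar>y + k\<bar>\<^sup>2 \<le> 1\<^sup>2" by (intro power_mono) auto
    moreover have "0 \<le> (x + h)\<^sup>2" by simp
    ultimately have "(y + k)\<^sup>2 - (x + h)\<^sup>2 \<le> 1" unfolding power2_abs one_power2 by linarith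
    then show ?thesis using True by (simp add: burk_def)
  qed (auto simp: burk_def)
  show ?thesis
  proof (cases "x = 0")
    case True
    then show ?thesis using key0 out by (simp add: burk_def burk_x_def burk_y_def)
  next
    case False
    then have "burk x y = 1 - 2 * x" "burk_x x y = - 2" "burk_y x y = 0"
      using x out by (auto simp: burk_def burk_x_def burk_y_def)
    then show ?thesis using key by simp
  qed
qed

lemma burk_step:
  assumes kh: "\<bar>k\<bar> \<le> \<bar>h\<bar>"
  shows "burk (x + h) (y + k) \<le> burk x y + burk_x x y * h + burk_y x y * k"
proof (cases "0 \<le> x")
  case False
  then have "burk (- x + (- h)) (y + k) \<le> burk (- x) y + burk_x (- x) y * (- h) + burk_y (- x) y * k"
    using kh by (intro burk_step_nonneg) auto
  then show ?thesis using burk_minus(1)[of "x + h" "y + k"] by (simp add: burk_minus)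
qed (use burk_step_nonneg assms in blast)

text \<open>
  The relation \<open>R k\<close> identifies the points that agree up to time \<open>k\<close>, so \<open>\<theta>\<close> is predictable.
\<close>

lemma martingale_transform_weak_type:
  fixes d \<theta> :: "nat \<Rightarrow> 'i \<Rightarrow> real"
  assumes fin: "finite I" and \<mu>: "\<And>i. i \<in> I \<Longrightarrow> 0 \<le> \<mu> i"
    and \<theta>: "\<And>k i. \<bar>\<theta> k i\<bar> \<le> 1"
    and orth: "\<And>k h. k < N \<Longrightarrow> (\<And>i j. R k i j \<Longrightarrow> h i = h j) \<Longrightarrow> (\<Sum>i\<in>I. \<mu> i * d k i * h i) = 0"
    and adapted: "\<And>k l i j. R k i j \<Longrightarrow> l < k \<Longrightarrow> d l i = d l j"
    and predictable: "\<And>k l i j. R k i j \<Longrightarrow> l \<le> k \<Longrightarrow> \<theta> l i = \<theta> l j"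
  shows "(\<Sum>i | i \<in> I \<and> 1 \<le> \<bar>\<Sum>k<N. \<theta> k i * d k i\<bar>. \<mu> i) \<le> 2 * (\<Sum>i\<in>I. \<mu> i * \<bar>\<Sum>k<N. d k i\<bar>)"
proof -
  define f where "f n i = (\<Sum>k<n. d k i)" for n i
  define g where "g n i = (\<Sum>k<n. \<theta> k i * d k i)" for n i
  have fR: "f k i = f k j" if "R k i j" for k i j
    unfolding f_def using adapted[OF that] by (intro sum.cong) auto
  have gR: "g k i = g k j" if "R k i j" for k i j
    unfolding g_def using adapted[OF that] predictable[OF that] by (intro sum.cong) auto
  have "(\<Sum>i\<in>I. \<mu> i * burk (f n i) (g n i)) \<le> 0" if "n \<le> N" for n
    using that
  proof (induction n)
    case 0 then show ?case by (simp add: f_def g_def burk_def)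
  next
    case (Suc n)
    \<comment> \<open>The coefficient of \<open>d n\<close> in the tangent term. It is constant on
      the classes of \<open>R n\<close>, so \<open>orth\<close> annihilates the whole first-order
      term.\<close>
    let ?h = "\<lambda>i. burk_x (f n i) (g n i) + burk_y (f n i) (g n i) * \<theta> n i"
    have "(\<Sum>i\<in>I. \<mu> i * burk (f (Suc n) i) (g (Suc n) i))
        \<le> (\<Sum>i\<in>I. \<mu> i * burk (f n i) (g n i) + \<mu> i * d n i * ?h i)"
    proof (rule sum_mono)
      fix i assume i: "i \<in> I"
      have "\<bar>\<theta> n i * d n i\<bar> \<le> \<bar>d n i\<bar>"
        using mult_right_mono[OF \<theta>[of n i], of "\<bar>d n i\<bar>"] by (simp add: abs_mult)
      then have "burk (f n i + d n i) (g n i + \<theta> n i * d n i)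
          \<le> burk (f n i) (g n i) + burk_x (f n i) (g n i) * d n i + burk_y (f n i) (g n i) * (\<theta> n i * d n i)"
        by (rule burk_step)
      then have "\<mu> i * burk (f n i + d n i) (g n i + \<theta> n i * d n i)
          \<le> \<mu> i * (burk (f n i) (g n i) + burk_x (f n i) (g n i) * d n i + burk_y (f n i) (g n i) * (\<theta> n i * d n i))"
        using \<mu>[OF i] by (rule mult_left_mono)
      then show "\<mu> i * burk (f (Suc n) i) (g (Suc n) i) \<le> \<mu> i * burk (f n i) (g n i) + \<mu> i * d n i * ?h i"
        by (simp add: f_def g_def algebra_simps)
    qed
    also have "\<dots> = (\<Sum>i\<in>I. \<mu> i * burk (f n i) (g n i)) + (\<Sum>i\<in>I. \<mu> i * d n i * ?h i)"
      by (rule sum.distrib)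
    also have "(\<Sum>i\<in>I. \<mu> i * d n i * ?h i) = 0"
    proof (rule orth)
      show "n < N" using Suc.prems by simp
      show "?h i = ?h j" if "R n i j" for i j using fR[OF that] gR[OF that] predictable[OF that order_refl] by simp
    qed
    finally show ?case using Suc by simp
  qed
  then have U: "(\<Sum>i\<in>I. \<mu> i * burk (f N i) (g N i)) \<le> 0" by simp
  have "(\<Sum>i | i \<in> I \<and> 1 \<le> \<bar>g N i\<bar>. \<mu> i) = (\<Sum>i\<in>I. \<mu> i * (if 1 \<le> \<bar>g N i\<bar> then 1 else 0))"
    using fin by (simp add: sum.inter_filter if_distrib cong: if_cong)
  also have "\<dots> \<le> (\<Sum>i\<in>I. \<mu> i * burk (f N i) (g N i) + 2 * (\<mu> i * \<bar>f N i\<bar>))"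
  proof (rule sum_mono)
    fix i assume i: "i \<in> I"
    have "\<mu> i * (if 1 \<le> \<bar>g N i\<bar> then 1 else 0) \<le> \<mu> i * (burk (f N i) (g N i) + 2 * \<bar>f N i\<bar>)"
      using burk_majorant[of "g N i" "f N i"] by (intro mult_left_mono \<mu>[OF i]) linarith
    then show "\<mu> i * (if 1 \<le> \<bar>g N i\<bar> then 1 else 0) \<le> \<mu> i * burk (f N i) (g N i) + 2 * (\<mu> i * \<bar>f N i\<bar>)"
      by (simp add: algebra_simps)
  qed
  also have "\<dots> = (\<Sum>i\<in>I. \<mu> i * burk (f N i) (g N i)) + 2 * (\<Sum>i\<in>I. \<mu> i * \<bar>f N i\<bar>)"
    by (simp add: sum.distrib sum_distrib_left)
  finally show ?thesis using U unfolding f_def g_def by linarith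
qed

text \<open>Split at the level \<open>c\<close>: below it the integrand is at most \<open>c\<close>,
  above it at most \<open>t\<close>, and the weak type inequality for \<open>d / c\<close> bounds
  the weight of the second event. \<open>H\<close> stays free because it is the transform itself for
  multipliers, but a maximal function for a stopped martingale.\<close>

lemma martingale_transform_truncated_mean:
  fixes d \<theta> :: "nat \<Rightarrow> 'i \<Rightarrow> real"
  assumes fin: "finite I" and \<mu>: "\<And>i. i \<in> I \<Longrightarrow> 0 \<le> \<mu> i"
    and \<theta>: "\<And>k i. \<bar>\<theta> k i\<bar> \<le> 1"
    and orth: "\<And>k h. k < N \<Longrightarrow> (\<And>i j. R k i j \<Longrightarrow> h i = h j) \<Longrightarrow> (\<Sum>i\<in>I. \<mu> i * d k i * h i) = 0"
    and adapted: "\<And>k l i j. R k i j \<Longrightarrow> l < k \<Longrightarrow> d l i = d l j"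
    and predictable: "\<And>k l i j. R k i j \<Longrightarrow> l \<le> k \<Longrightarrow> \<theta> l i = \<theta> l j"
    and c: "c > 0" and t: "t \<ge> 0"
    and H: "\<And>i. i \<in> I \<Longrightarrow> c \<le> H i \<Longrightarrow> c \<le> \<bar>\<Sum>k<N. \<theta> k i * d k i\<bar>"
  shows "(\<Sum>i\<in>I. \<mu> i * min (H i) t) \<le> c * (\<Sum>i\<in>I. \<mu> i) + 2 * t / c * (\<Sum>i\<in>I. \<mu> i * \<bar>\<Sum>k<N. d k i\<bar>)"
proof -
  let ?A = "{i. i \<in> I \<and> 1 \<le> \<bar>\<Sum>k<N. \<theta> k i * (d k i / c)\<bar>}"
  have "(\<Sum>i\<in>?A. \<mu> i) \<le> 2 * (\<Sum>i\<in>I. \<mu> i * \<bar>\<Sum>k<N. d k i / c\<bar>)"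
  proof (rule martingale_transform_weak_type[where R=R, OF fin \<mu> \<theta>])
    show "(\<Sum>i\<in>I. \<mu> i * (d k i / c) * h i) = 0" if "k < N" "\<And>i j. R k i j \<Longrightarrow> h i = h j" for k h
      using orth[OF that] by (simp add: sum_divide_distrib[symmetric])
    show "d l i / c = d l j / c" if "R k i j" "l < k" for k l i j using adapted[OF that] by simp
  qed (use predictable in auto)
  also have "\<dots> = 2 / c * (\<Sum>i\<in>I. \<mu> i * \<bar>\<Sum>k<N. d k i\<bar>)"
    using c by (simp add: sum_divide_distrib[symmetric] abs_divide)
  finally have A: "t * (\<Sum>i\<in>?A. \<mu> i) \<le> t * (2 / c * (\<Sum>i\<in>I. \<mu> i * \<bar>\<Sum>k<N. d k i\<bar>))"
    using t by (rule mult_left_mono)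
  have "(\<Sum>i\<in>I. \<mu> i * min (H i) t) \<le> (\<Sum>i\<in>I. c * \<mu> i + t * (if i \<in> ?A then \<mu> i else 0))"
  proof (rule sum_mono)
    fix i assume i: "i \<in> I"
    have "min (H i) t \<le> c + t * (if i \<in> ?A then 1 else 0)"
    proof (cases "c \<le> H i")
      case True
      then have "1 \<le> \<bar>\<Sum>k<N. \<theta> k i * d k i\<bar> / c" using H[OF i] c by simp
      also have "\<dots> = \<bar>\<Sum>k<N. \<theta> k i * (d k i / c)\<bar>"
        using c by (simp add: sum_divide_distrib[symmetric] abs_divide)
      finally show ?thesis using i c by simp
    qed (use t in auto)
    then have "\<mu> i * min (H i) t \<le> \<mu> i * (c + t * (if i \<in> ?A then 1 else 0))"
      using \<mu>[OF i] by (rule mult_left_mono)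
    also have "\<dots> = c * \<mu> i + t * (if i \<in> ?A then \<mu> i else 0)" by (simp add: algebra_simps)
    finally show "\<mu> i * min (H i) t \<le> c * \<mu> i + t * (if i \<in> ?A then \<mu> i else 0)" .
  qed
  also have "\<dots> = c * (\<Sum>i\<in>I. \<mu> i) + t * (\<Sum>i\<in>?A. \<mu> i)"
  proof -
    have "(\<Sum>i\<in>I. if i \<in> ?A then \<mu> i else 0) = (\<Sum>i\<in>?A. \<mu> i)"
      using fin by (intro sum.mono_neutral_cong_right) auto
    then show ?thesis by (simp only: sum.distrib sum_distrib_left[symmetric])
  qed
  finally show ?thesis using A by (simp add: algebra_simps)
qed

lemma martingale_maximal_truncated_mean:
  fixes d :: "nat \<Rightarrow> 'i \<Rightarrow> real"
  assumes fin: "finite I" and \<mu>: "\<And>i. i \<in> I \<Longrightarrow> 0 \<le> \<mu> i"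
    and orth: "\<And>k h. k < N \<Longrightarrow> (\<And>i j. R k i j \<Longrightarrow> h i = h j) \<Longrightarrow> (\<Sum>i\<in>I. \<mu> i * d k i * h i) = 0"
    and adapted: "\<And>k l i j. R k i j \<Longrightarrow> l < k \<Longrightarrow> d l i = d l j"
    and c: "c > 0" and t: "t \<ge> 0"
    and H: "\<And>i. i \<in> I \<Longrightarrow> c \<le> H i \<Longrightarrow> \<exists>n\<le>N. c \<le> \<bar>\<Sum>k<n. d k i\<bar>"
  shows "(\<Sum>i\<in>I. \<mu> i * min (H i) t) \<le> c * (\<Sum>i\<in>I. \<mu> i) + 2 * t / c * (\<Sum>i\<in>I. \<mu> i * \<bar>\<Sum>k<N. d k i\<bar>)"
proof -
  \<comment> \<open>Stop as soon as a partial sum reaches modulus \<open>c\<close>. Whether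
    \<open>d k\<close> is kept depends on the terms before it only, and after stopping the transform
    retains a value of modulus at least \<open>c\<close>.\<close>
  define \<theta> :: "nat \<Rightarrow> 'i \<Rightarrow> real" where
    "\<theta> k i = (if \<exists>n\<le>k. c \<le> \<bar>\<Sum>l<n. d l i\<bar> then 0 else 1)" for k i
  have stop: "if \<exists>n\<le>m. c \<le> \<bar>\<Sum>l<n. d l i\<bar> then c \<le> \<bar>\<Sum>k<m. \<theta> k i * d k i\<bar>
      else (\<Sum>k<m. \<theta> k i * d k i) = (\<Sum>k<m. d k i)" for m i
  proof (induction m)
    case (Suc m)
    show ?case
    proof (cases "\<exists>n\<le>m. c \<le> \<bar>\<Sum>l<n. d l i\<bar>")
      case True
      then have "\<theta> m i = 0" by (simp add: \<theta>_def)
      moreover have "\<exists>n\<le>Suc m. c \<le> \<bar>\<Sum>l<n. d l i\<bar>" using True le_Suc_eq by blast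
      ultimately show ?thesis using Suc True by simp
    next
      case False
      then have "\<theta> m i = 1" by (simp add: \<theta>_def)
      then have eq: "(\<Sum>k<Suc m. \<theta> k i * d k i) = (\<Sum>k<Suc m. d k i)" using Suc False by simp
      moreover have "(\<exists>n\<le>Suc m. c \<le> \<bar>\<Sum>l<n. d l i\<bar>) \<longleftrightarrow> c \<le> \<bar>\<Sum>l<Suc m. d l i\<bar>"
        using False le_Suc_eq by blast
      ultimately show ?thesis by presburger
    qed
  qed simp
  show ?thesis
  proof (rule martingale_transform_truncated_mean[where \<theta>=\<theta> and R=R, OF fin \<mu> _ orth adapted _ c t])
    show "\<theta> l i = \<theta> l j" if "R k i j" "l \<le> k" for k l i j
    proof -
      have "(\<Sum>l<n. d l i) = (\<Sum>l<n. d l j)" if "n \<le> l" for n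
        using adapted[OF \<open>R k i j\<close>] that \<open>l \<le> k\<close> by (intro sum.cong) auto
      then show ?thesis unfolding \<theta>_def by (metis (no_types, lifting))
    qed
    show "c \<le> \<bar>\<Sum>k<N. \<theta> k i * d k i\<bar>" if "i \<in> I" "c \<le> H i" for i
      using stop[of N i] H[OF that] by presburger
  qed (auto simp: \<theta>_def)
qed

section \<open>Components of an order unit\<close>

text \<open>With \<open>e\<close> in the role of the constant one, components play the role of
  indicator functions.\<close>

definition component :: "'a::banach_lattice \<Rightarrow> 'a \<Rightarrow> bool" where
  "component e p \<longleftrightarrow> 0 \<le> p \<and> p \<le> e \<and> inf p (e - p) = 0"

lemma le_scaleR_of_disjoint:
  fixes z p q :: "'a::banach_lattice"
  assumes "0 \<le> z" "z \<le> m *\<^sub>R (p + q)" "0 \<le> p" "0 \<le> q" "0 \<le> m" "inf z q = 0"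
  shows "z \<le> m *\<^sub>R p"
proof -
  have "z = inf (m *\<^sub>R p + m *\<^sub>R q) z" using assms(2) by (simp add: inf_absorb2 scaleR_right_distrib)
  also have "\<dots> \<le> inf (m *\<^sub>R p) z + inf (m *\<^sub>R q) z"
    using assms by (intro inf_add_le scaleR_nonneg_nonneg)
  also have "inf (m *\<^sub>R q) z = 0"
    using inf_scaleR_eq_0[of z q 1 m] assms by (simp add: inf.commute)
  finally show ?thesis by (simp add: le_inf_iff)
qed

text \<open>\<open>p\<close> is the part of \<open>e\<close> in the band generated by the positive
  part of \<open>x\<close>, so \<open>2 *\<^sub>R p - e\<close> acts as the sign of
  \<open>x\<close>. On each side \<open>x\<close> has a constant sign and modulus at most
  \<open>m\<close>; moving it by \<open>m/2\<close> towards zero leaves modulus at most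
  \<open>m/2\<close>.\<close>

lemma exists_component_half:
  fixes x e :: "'a::banach_lattice"
  assumes oc: "order_continuous TYPE('a)" and e: "0 \<le> e" and x: "\<bar>x\<bar> \<le> m *\<^sub>R e" and m: "0 \<le> m"
  shows "\<exists>p. component e p \<and> \<bar>x - (m/2) *\<^sub>R (2 *\<^sub>R p - e)\<bar> \<le> (m/2) *\<^sub>R e"
proof -
  define z where "z = pprt x"
  define z' where "z' = - nprt x"
  have z: "0 \<le> z" "0 \<le> z'" "x = z - z'" "\<bar>x\<bar> = z + z'"
    using prts[of x] abs_prts[of x] by (simp_all add: z_def z'_def)
  have zz': "inf z z' = 0"
    unfolding inf_eq_half_diff_abs z(3)[symmetric] z(4) by simp
  define g where "g n = inf (real n *\<^sub>R z) e" for n :: nat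
  have "incseq g"
    unfolding g_def by (intro incseq_SucI inf_mono scaleR_right_mono z) auto
  then obtain p where p: "g \<longlonglongrightarrow> p"
    using order_continuous_convergent[OF oc, of g e] unfolding convergent_def g_def by auto
  have gp: "g n \<le> p" for n
    by (rule le_of_tendsto_banach_lattice[OF p, of n]) (use \<open>incseq g\<close> in \<open>simp add: incseqD\<close>)
  have pe: "p \<le> e" by (rule tendsto_le_banach_lattice[OF p, of 0]) (simp add: g_def)
  have p0: "0 \<le> p" using gp[of 0] e by (simp add: g_def inf_absorb1)
  \<comment> \<open>Doubling \<open>g n\<close> and truncating gives at most
    \<open>g (2 * n)\<close>, so the limit \<open>p\<close> is stable under doubling and truncation.
    This is equivalent to the disjointness of \<open>p\<close> and \<open>e - p\<close>.\<close>
  have "inf (2 *\<^sub>R p) e \<le> p"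
  proof (rule tendsto_le_banach_lattice)
    show "(\<lambda>n. inf (2 *\<^sub>R g n) e) \<longlonglongrightarrow> inf (2 *\<^sub>R p) e"
      by (intro tendsto_inf_banach_lattice tendsto_scaleR tendsto_const p)
    fix n
    have "inf (2 *\<^sub>R g n) e = inf (inf (2 *\<^sub>R real n *\<^sub>R z) (2 *\<^sub>R e)) e"
      unfolding g_def by (subst inf_scaleR) auto
    also have "\<dots> \<le> g (2 * n)" unfolding g_def by (auto intro: le_infI1)
    also have "\<dots> \<le> p" by (rule gp)
    finally show "inf (2 *\<^sub>R g n) e \<le> p" .
  qed
  moreover have "inf (2 *\<^sub>R p) e = p + inf p (e - p)"
    by (simp add: add_inf_distrib_left scaleR_2)
  ultimately have pc: "inf p (e - p) = 0" using p0 pe by (intro antisym) auto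
  have "inf z (e - p) \<le> inf p (e - p)"
  proof (rule inf_greatest)
    have "inf z (e - p) \<le> g 1" using p0 by (auto simp: g_def intro: le_infI2 order_trans[of _ "e - p"])
    then show "inf z (e - p) \<le> p" using gp order_trans by blast
  qed simp
  then have zp: "inf z (e - p) = 0" using z(1) pe pc by (intro antisym) auto
  have "inf z' p \<le> 0"
  proof (rule tendsto_le_banach_lattice)
    show "(\<lambda>n. inf z' (g n)) \<longlonglongrightarrow> inf z' p" by (intro tendsto_inf_banach_lattice tendsto_const p)
    fix n
    have "inf (1 *\<^sub>R z') (real n *\<^sub>R z) = 0"
      using zz' z by (intro inf_scaleR_eq_0) (auto simp: inf.commute)
    moreover have "inf z' (g n) \<le> inf z' (real n *\<^sub>R z)" unfolding g_def by (intro inf_mono) auto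
    ultimately show "inf z' (g n) \<le> 0" by simp
  qed
  then have zp': "inf z' p = 0" using z(2) p0 by (intro antisym) auto
  have zle: "z \<le> m *\<^sub>R e" "z' \<le> m *\<^sub>R e"
    using x z by (auto intro: order_trans[of _ "z + z'"])
  have 1: "z \<le> m *\<^sub>R p"
    by (rule le_scaleR_of_disjoint[of z m p "e - p"]) (use z zle p0 pe m zp in auto)
  have 2: "z' \<le> m *\<^sub>R (e - p)"
    by (rule le_scaleR_of_disjoint[of z' m "e - p" p]) (use z zle p0 pe m zp' in auto)
  have half: "\<bar>y - (m/2) *\<^sub>R q\<bar> \<le> (m/2) *\<^sub>R q" if "0 \<le> y" "y \<le> m *\<^sub>R q" for y q :: 'a
  proof (rule abs_leI)
    have "m *\<^sub>R q = (m/2) *\<^sub>R q + (m/2) *\<^sub>R q" by (simp add: scaleR_left_distrib[symmetric])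
    then show "y - (m/2) *\<^sub>R q \<le> (m/2) *\<^sub>R q" using that by (simp add: diff_le_eq)
    show "- (y - (m/2) *\<^sub>R q) \<le> (m/2) *\<^sub>R q" using that by simp
  qed
  have "x - (m/2) *\<^sub>R (2 *\<^sub>R p - e) = (z - (m/2) *\<^sub>R p) - (z' - (m/2) *\<^sub>R (e - p))"
  proof -
    have "m *\<^sub>R p = (m/2) *\<^sub>R p + (m/2) *\<^sub>R p" by (simp add: scaleR_left_distrib[symmetric])
    then show ?thesis by (simp add: z(3) scaleR_right_diff_distrib)
  qed
  also have "\<bar>\<dots>\<bar> \<le> \<bar>z - (m/2) *\<^sub>R p\<bar> + \<bar>z' - (m/2) *\<^sub>R (e - p)\<bar>" by (rule abs_triangle_ineq4)
  also have "\<dots> \<le> (m/2) *\<^sub>R p + (m/2) *\<^sub>R (e - p)" by (intro add_mono half 1 2 z)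
  also have "\<dots> = (m/2) *\<^sub>R e" by (simp add: scaleR_right_diff_distrib)
  finally show ?thesis using p0 pe pc unfolding component_def by blast
qed

text \<open>Iterated halving yields a binary expansion with signs \<open>2 *\<^sub>R q j - e\<close>
  as digits. It does the work of Freudenthal's spectral theorem, with countably many components and
  an error measured in multiples of \<open>e\<close>.\<close>

lemma dyadic_component_expansion:
  fixes x e :: "'a::banach_lattice"
  assumes oc: "order_continuous TYPE('a)" and e: "0 \<le> e" and x: "\<bar>x\<bar> \<le> m *\<^sub>R e" and m: "0 \<le> m"
  shows "\<exists>q c. (\<forall>j. component e (q j)) \<and>
    (\<forall>i. \<bar>x - (\<Sum>j<i. c j *\<^sub>R (2 *\<^sub>R q j - e))\<bar> \<le> (m / 2 ^ i) *\<^sub>R e)"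
proof -
  \<comment> \<open>A state is the current remainder with a component that halves it. The clause for
    \<open>i = 0\<close> pins the initial remainder to \<open>x\<close>.\<close>
  define P :: "nat \<Rightarrow> 'a \<times> 'a \<Rightarrow> bool" where
    "P i s \<longleftrightarrow> (i = 0 \<longrightarrow> fst s = x) \<and> component e (snd s) \<and> \<bar>fst s\<bar> \<le> (m / 2 ^ i) *\<^sub>R e \<and>
       \<bar>fst s - (m / 2 ^ Suc i) *\<^sub>R (2 *\<^sub>R snd s - e)\<bar> \<le> (m / 2 ^ Suc i) *\<^sub>R e" for i s
  define Q :: "nat \<Rightarrow> 'a \<times> 'a \<Rightarrow> 'a \<times> 'a \<Rightarrow> bool" where
    "Q i s s' \<longleftrightarrow> fst s' = fst s - (m / 2 ^ Suc i) *\<^sub>R (2 *\<^sub>R snd s - e)" for i s s'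
  have ex: "\<exists>q. P i (r, q)" if r: "\<bar>r\<bar> \<le> (m / 2 ^ i) *\<^sub>R e" and 0: "i = 0 \<longrightarrow> r = x" for i r
  proof -
    have "0 \<le> m / 2 ^ i" using m by simp
    from exists_component_half[OF oc e r this] obtain p
      where "component e p" "\<bar>r - (m / 2 ^ i / 2) *\<^sub>R (2 *\<^sub>R p - e)\<bar> \<le> (m / 2 ^ i / 2) *\<^sub>R e" by blast
    moreover have "m / 2 ^ i / 2 = m / 2 ^ Suc i" by simp
    ultimately have "P i (r, p)" using r 0 unfolding P_def by (metis fst_conv snd_conv)
    then show ?thesis ..
  qed
  have "\<exists>s. \<forall>n. P n (s n) \<and> Q n (s n) (s (Suc n))"
  proof (rule dependent_nat_choice)
    show "\<exists>s. P 0 s" using ex[of x 0] x by auto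
    fix s n assume "P n s"
    then have "\<bar>fst s - (m / 2 ^ Suc n) *\<^sub>R (2 *\<^sub>R snd s - e)\<bar> \<le> (m / 2 ^ Suc n) *\<^sub>R e"
      unfolding P_def by blast
    from ex[OF this] show "\<exists>s'. P (Suc n) s' \<and> Q n s s'" unfolding Q_def by auto
  qed
  then obtain s where s: "\<And>n. P n (s n)" "\<And>n. Q n (s n) (s (Suc n))" by blast
  have "fst (s i) = x - (\<Sum>j<i. (m / 2 ^ Suc j) *\<^sub>R (2 *\<^sub>R snd (s j) - e))" for i
  proof (induction i)
    case 0 then show ?case using s(1)[of 0] by (simp add: P_def)
  next
    case (Suc i) then show ?case using s(2)[of i] unfolding Q_def by (simp only: sum.lessThan_Suc diff_diff_add)
  qed
  then have "\<bar>x - (\<Sum>j<i. (m / 2 ^ Suc j) *\<^sub>R (2 *\<^sub>R snd (s j) - e))\<bar> \<le> (m / 2 ^ i) *\<^sub>R e" for i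
    using s(1)[of i] unfolding P_def by metis
  moreover have "component e (snd (s j))" for j using s(1)[of j] unfolding P_def by blast
  ultimately show ?thesis
    by (intro exI[of _ "\<lambda>j. snd (s j)"] exI[of _ "\<lambda>j. m / 2 ^ Suc j"]) blast
qed

lemma sum_Pow_lessThan_Suc:
  fixes f :: "nat set \<Rightarrow> 'a::comm_monoid_add"
  shows "(\<Sum>A\<in>Pow {..<Suc n}. f A) = (\<Sum>A\<in>Pow {..<n}. f A + f (insert n A))"
proof -
  have "Pow {..<Suc n} = Pow {..<n} \<union> insert n ` Pow {..<n}"
    by (simp add: lessThan_Suc Pow_insert)
  moreover have "Pow {..<n} \<inter> insert n ` Pow {..<n} = {}" by auto
  moreover have "inj_on (insert n) (Pow {..<n})"
    by (rule inj_onI) (metis Diff_insert_absorb PowD lessThan_iff less_irrefl subsetD)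
  ultimately show ?thesis by (simp add: sum.union_disjoint sum.reindex sum.distrib)
qed

text \<open>A set \<open>A\<close> encodes a cell: its \<open>k\<close>-th bit tells whether the
  cell lies in the \<open>k\<close>-th component or in the complement. Dependence on the first
  \<open>n\<close> bits is measurability for the algebra generated by the first \<open>n\<close>
  components. As \<open>G\<close> is total on sets, functions of different levels combine without
  conversion.\<close>

definition level_measurable :: "nat \<Rightarrow> (nat set \<Rightarrow> 'b) \<Rightarrow> bool" where
  "level_measurable n G \<longleftrightarrow> (\<forall>A. G (A \<inter> {..<n}) = G A)"

lemma level_measurableD: "level_measurable n G \<Longrightarrow> G (A \<inter> {..<n}) = G A"
  by (simp add: level_measurable_def)

lemma level_measurable_mono:
  assumes G: "level_measurable n G" and nm: "n \<le> m" shows "level_measurable m G"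
  unfolding level_measurable_def
proof
  fix A
  have "A \<inter> {..<m} \<inter> {..<n} = A \<inter> {..<n}" using nm by auto
  then show "G (A \<inter> {..<m}) = G A"
    using level_measurableD[OF G, of "A \<inter> {..<m}"] level_measurableD[OF G, of A] by simp
qed

lemma level_measurable_cong:
  assumes "level_measurable n G" "A \<inter> {..<n} = B \<inter> {..<n}" shows "G A = G B"
  using level_measurableD[OF assms(1), of A] level_measurableD[OF assms(1), of B] assms(2) by simp

section \<open>Simple elements over the finite algebras generated by components\<close>

locale component_sequence =
  fixes e :: "'a::banach_lattice" and p :: "nat \<Rightarrow> 'a"
  assumes e: "0 \<le> e" and p: "\<And>n. component e (p n)"
begin

text \<open>Atoms may be \<open>0\<close>, so a simple element does not determine its coefficients;
  statements are therefore made in terms of coefficient functions.\<close>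

primrec atom :: "nat \<Rightarrow> nat set \<Rightarrow> 'a" where
  "atom 0 A = e"
| "atom (Suc n) A = inf (atom n A) (if n \<in> A then p n else e - p n)"

lemma p_bounds: "0 \<le> p n" "p n \<le> e" "inf (p n) (e - p n) = 0" "inf (e - p n) (p n) = 0"
  using p[of n] by (auto simp: component_def inf.commute)

lemma atom_bounds: "0 \<le> atom n A" "atom n A \<le> e"
  using e p_bounds by (induction n) (auto intro: le_infI1)

lemma atom_cong: "A \<inter> {..<n} = B \<inter> {..<n} \<Longrightarrow> atom n A = atom n B"
proof (induction n)
  case (Suc n)
  have cut: "C \<inter> {..<n} = (C \<inter> {..<Suc n}) \<inter> {..<n}" "n \<in> C \<longleftrightarrow> n \<in> C \<inter> {..<Suc n}" for C by auto
  have "A \<inter> {..<n} = B \<inter> {..<n}" using cut(1)[of A] cut(1)[of B] Suc.prems by argo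
  moreover have "n \<in> A \<longleftrightarrow> n \<in> B" using cut(2)[of A] cut(2)[of B] Suc.prems by argo
  ultimately show ?case using Suc.IH by simp
qed simp

lemma atom_split:
  assumes "A \<subseteq> {..<n}" shows "atom (Suc n) A + atom (Suc n) (insert n A) = atom n A"
proof -
  have "atom n (insert n A) = atom n A" by (rule atom_cong) auto
  moreover have "n \<notin> A" using assms by auto
  moreover have "inf (e - p n + p n) (atom n A) = inf (e - p n) (atom n A) + inf (p n) (atom n A)"
    by (rule inf_add_of_disjoint) (auto simp: p_bounds atom_bounds)
  moreover have "inf (e - p n + p n) (atom n A) = atom n A"
    using atom_bounds(2)[of n A] by (simp add: inf_absorb2)
  ultimately show ?thesis by (simp only: atom.simps if_False insertI1 if_True inf.commute[of _ "atom n A"])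
qed

lemma atom_disjoint: "A \<inter> {..<n} \<noteq> B \<inter> {..<n} \<Longrightarrow> inf (atom n A) (atom n B) = 0"
proof (induction n)
  case (Suc n)
  show ?case
  proof (cases "A \<inter> {..<n} = B \<inter> {..<n}")
    case False
    show ?thesis
      by (rule inf_eq_0_mono[OF Suc.IH[OF False] atom_bounds(1) _ atom_bounds(1)]) auto
  next
    case True
    then have "n \<in> A \<longleftrightarrow> n \<notin> B" using Suc.prems by (auto simp: lessThan_Suc)
    then show ?thesis
      using inf_eq_0_mono[OF p_bounds(3)[of n] atom_bounds(1)[of "Suc n" A] _ atom_bounds(1)[of "Suc n" B]]
        inf_eq_0_mono[OF p_bounds(4)[of n] atom_bounds(1)[of "Suc n" A] _ atom_bounds(1)[of "Suc n" B]]
      by auto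
  qed
qed simp

definition simple :: "nat \<Rightarrow> (nat set \<Rightarrow> real) \<Rightarrow> 'a" where
  "simple n G = (\<Sum>A\<in>Pow {..<n}. G A *\<^sub>R atom n A)"

lemma simple_add: "simple n (\<lambda>A. G A + H A) = simple n G + simple n H"
  by (simp add: simple_def scaleR_left_distrib sum.distrib)

lemma simple_scaleR: "simple n (\<lambda>A. c * G A) = c *\<^sub>R simple n G"
  by (simp add: simple_def scaleR_sum_right)

lemma simple_diff: "simple n (\<lambda>A. G A - H A) = simple n G - simple n H"
  by (simp add: simple_def scaleR_left_diff_distrib sum_subtractf)

lemma simple_sum: "simple n (\<lambda>A. \<Sum>i\<in>I. G i A) = (\<Sum>i\<in>I. simple n (G i))"
  unfolding simple_def scaleR_sum_left by (rule sum.swap)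

lemma simple_mono: "(\<And>A. A \<subseteq> {..<n} \<Longrightarrow> G A \<le> H A) \<Longrightarrow> simple n G \<le> simple n H"
  unfolding simple_def by (intro sum_mono scaleR_right_mono atom_bounds) auto

text \<open>Atoms of one level are pairwise disjoint, so the modulus, and through it
  \<open>inf\<close>, acts coefficientwise.\<close>

lemma abs_simple: "\<bar>simple n G\<bar> = simple n (\<lambda>A. \<bar>G A\<bar>)"
proof -
  have "\<bar>simple n G\<bar> = (\<Sum>A\<in>Pow {..<n}. \<bar>G A *\<^sub>R atom n A\<bar>)"
    unfolding simple_def
  proof (rule abs_sum_of_disjoint)
    fix A B assume AB: "A \<in> Pow {..<n}" "B \<in> Pow {..<n}" "A \<noteq> B"
    then have "A \<inter> {..<n} = A" "B \<inter> {..<n} = B" by auto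
    then have "inf (atom n A) (atom n B) = 0" using AB(3) by (intro atom_disjoint) auto
    then show "inf \<bar>G A *\<^sub>R atom n A\<bar> \<bar>G B *\<^sub>R atom n B\<bar> = 0"
      using atom_bounds(1)[of n] by (simp add: abs_scaleR_banach_lattice inf_scaleR_eq_0)
  qed simp
  then show ?thesis unfolding simple_def abs_scaleR_banach_lattice
    by (simp add: atom_bounds)
qed

lemma simple_Suc:
  assumes G: "level_measurable n G" shows "simple (Suc n) G = simple n G"
  unfolding simple_def sum_Pow_lessThan_Suc
proof (rule sum.cong[OF refl])
  fix A assume "A \<in> Pow {..<n}"
  then have A: "A \<subseteq> {..<n}" by simp
  have "G (insert n A) = G A" by (rule level_measurable_cong[OF G]) auto
  then have "G A *\<^sub>R atom (Suc n) A + G (insert n A) *\<^sub>R atom (Suc n) (insert n A)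
    = G A *\<^sub>R (atom (Suc n) A + atom (Suc n) (insert n A))" by (simp only: scaleR_right_distrib)
  then show "G A *\<^sub>R atom (Suc n) A + G (insert n A) *\<^sub>R atom (Suc n) (insert n A) = G A *\<^sub>R atom n A"
    by (simp only: atom_split[OF A])
qed

lemma simple_lift:
  assumes "level_measurable n G" "n \<le> m" shows "simple m G = simple n G"
  using assms(2)
proof (induction m rule: dec_induct)
  case (step m)
  then show ?case using simple_Suc[OF level_measurable_mono[OF assms(1) step(1)]] by simp
qed simp

lemma simple_const: "simple n (\<lambda>_. c) = c *\<^sub>R e"
proof -
  have "simple n (\<lambda>_. c) = simple 0 (\<lambda>_. c)" by (rule simple_lift) (auto simp: level_measurable_def)
  then show ?thesis by (simp add: simple_def)
qed

lemma inf_simple: "inf (simple n G) (simple n H) = simple n (\<lambda>A. min (G A) (H A))"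
proof -
  have "min (G A) (H A) = (1/2) * (G A + H A - \<bar>G A - H A\<bar>)" for A
    by (simp add: min_def abs_if)
  then have "simple n (\<lambda>A. min (G A) (H A)) = simple n (\<lambda>A. (1/2) * (G A + H A - \<bar>G A - H A\<bar>))" by presburger
  also have "\<dots> = (1/2) *\<^sub>R (simple n G + simple n H - \<bar>simple n G - simple n H\<bar>)"
    by (simp only: simple_scaleR simple_add simple_diff abs_simple[symmetric])
  finally show ?thesis unfolding inf_eq_half_diff_abs by simp
qed

lemma simple_indicator_atom:
  assumes "n \<le> m" "A \<subseteq> {..<n}"
  shows "simple m (\<lambda>B. of_bool (B \<inter> {..<n} = A)) = atom n A"
proof -
  have "simple m (\<lambda>B. of_bool (B \<inter> {..<n} = A)) = simple n (\<lambda>B. of_bool (B \<inter> {..<n} = A))"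
    by (rule simple_lift) (auto simp: level_measurable_def assms)
  also have "\<dots> = (\<Sum>B\<in>Pow {..<n}. if B = A then atom n B else 0)"
    unfolding simple_def
  proof (rule sum.cong[OF refl])
    fix B assume "B \<in> Pow {..<n}"
    then have "B \<inter> {..<n} = B" by auto
    then show "of_bool (B \<inter> {..<n} = A) *\<^sub>R atom n B = (if B = A then atom n B else 0)" by simp
  qed
  also have "\<dots> = atom n A" using assms by simp
  finally show ?thesis .
qed

lemma component_atom:
  assumes "A \<subseteq> {..<n}" shows "component e (atom n A)"
proof -
  have e_eq: "e = (\<Sum>B\<in>Pow {..<n}. atom n B)" using simple_const[of n 1] by (simp add: simple_def)
  have "(\<Sum>B\<in>Pow {..<n}. atom n B) = atom n A + (\<Sum>B\<in>Pow {..<n} - {A}. atom n B)"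
    by (rule sum.remove) (use assms in auto)
  then have rest: "e - atom n A = (\<Sum>B\<in>Pow {..<n} - {A}. atom n B)" using e_eq by (metis add_diff_cancel_left')
  have "inf (\<Sum>B\<in>Pow {..<n} - {A}. atom n B) (atom n A) = 0"
  proof (rule inf_sum_eq_0)
    fix B assume "B \<in> Pow {..<n} - {A}"
    then have "B \<inter> {..<n} = B" "A \<inter> {..<n} = A" "B \<noteq> A" using assms by auto
    then show "inf (atom n B) (atom n A) = 0" by (intro atom_disjoint) simp
  qed (auto simp: atom_bounds)
  then show ?thesis unfolding component_def rest by (simp add: atom_bounds inf.commute)
qed

lemma simple_indicator_p: "simple (Suc k) (\<lambda>A. of_bool (k \<in> A)) = p k"
proof -
  \<comment> \<open>\<open>x\<close> and \<open>y\<close> collect the parts of the atoms inside and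
    outside \<open>p k\<close>. They add up to \<open>e\<close> and dominate \<open>p k\<close> and
    \<open>e - p k\<close>, which forces equality in both cases.\<close>
  define x where "x = (\<Sum>A\<in>Pow {..<k}. inf (atom k A) (p k))"
  define y where "y = (\<Sum>A\<in>Pow {..<k}. inf (atom k A) (e - p k))"
  have e_eq: "(\<Sum>A\<in>Pow {..<k}. atom k A) = e" using simple_const[of k 1] by (simp add: simple_def)
  have at: "atom k (insert k A) = atom k A" for A by (rule atom_cong) auto
  have "simple (Suc k) (\<lambda>A. of_bool (k \<in> A)) = x"
    unfolding simple_def sum_Pow_lessThan_Suc x_def
    by (rule sum.cong) (auto simp: at)
  moreover have "x + y = e"
  proof -
    have "inf (atom k A) (p k) + inf (atom k A) (e - p k) = atom k A" for A
      using inf_add_of_disjoint[of "p k" "e - p k" "atom k A"] atom_bounds[of k A] p_bounds[of k]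
      by (simp add: inf.commute inf_absorb1 inf_absorb2)
    then show ?thesis by (simp add: x_def y_def sum.distrib[symmetric] e_eq)
  qed
  moreover have "p k \<le> x"
    using inf_sum_le[of "Pow {..<k}" "atom k" "p k"] p_bounds[of k] atom_bounds
    by (simp add: x_def e_eq inf_absorb2)
  moreover have "e - p k \<le> y"
    using inf_sum_le[of "Pow {..<k}" "atom k" "e - p k"] p_bounds[of k] atom_bounds
    by (simp add: y_def e_eq inf_absorb2)
  then have "e \<le> y + p k" by (simp add: diff_le_eq)
  then have "y + x \<le> y + p k" using \<open>x + y = e\<close> by (simp only: add.commute[of x y])
  then have "x \<le> p k" by simp
  with \<open>p k \<le> x\<close> \<open>simple (Suc k) _ = x\<close> show ?thesis by simp
qed

text \<open>The uniform closure of the simple elements in the order unit norm of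
  \<open>e\<close>.\<close>

definition approximable :: "'a set" where
  "approximable = {x. \<forall>\<epsilon>>0. \<exists>n G. level_measurable n G \<and> \<bar>x - simple n G\<bar> \<le> \<epsilon> *\<^sub>R e}"

lemma approximable_add:
  assumes "x \<in> approximable" "y \<in> approximable" shows "x + y \<in> approximable"
  unfolding approximable_def
proof (intro CollectI allI impI)
  fix \<epsilon> :: real assume "\<epsilon> > 0"
  then have "\<epsilon>/2 > 0" by simp
  obtain n G where G: "level_measurable n G" "\<bar>x - simple n G\<bar> \<le> (\<epsilon>/2) *\<^sub>R e"
    using assms(1) \<open>\<epsilon>/2 > 0\<close> unfolding approximable_def by blast
  obtain m H where H: "level_measurable m H" "\<bar>y - simple m H\<bar> \<le> (\<epsilon>/2) *\<^sub>R e"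
    using assms(2) \<open>\<epsilon>/2 > 0\<close> unfolding approximable_def by blast
  let ?l = "max n m"
  have l: "level_measurable ?l G" "level_measurable ?l H"
    using level_measurable_mono[OF G(1)] level_measurable_mono[OF H(1)] by auto
  have "simple ?l (\<lambda>A. G A + H A) = simple n G + simple m H"
    using simple_lift[OF G(1), of ?l] simple_lift[OF H(1), of ?l] by (simp add: simple_add)
  then have "x + y - simple ?l (\<lambda>A. G A + H A) = (x - simple n G) + (y - simple m H)" by simp
  then have "\<bar>x + y - simple ?l (\<lambda>A. G A + H A)\<bar> \<le> \<bar>x - simple n G\<bar> + \<bar>y - simple m H\<bar>"
    by (simp only: abs_triangle_ineq)
  also have "\<dots> \<le> (\<epsilon>/2) *\<^sub>R e + (\<epsilon>/2) *\<^sub>R e" by (rule add_mono[OF G(2) H(2)])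
  also have "\<dots> = \<epsilon> *\<^sub>R e" by (simp add: scaleR_left_distrib[symmetric])
  finally have "\<bar>x + y - simple ?l (\<lambda>A. G A + H A)\<bar> \<le> \<epsilon> *\<^sub>R e" .
  moreover have "level_measurable ?l (\<lambda>A. G A + H A)" using l by (simp add: level_measurable_def)
  ultimately show "\<exists>n G. level_measurable n G \<and> \<bar>x + y - simple n G\<bar> \<le> \<epsilon> *\<^sub>R e" by (intro exI conjI)
qed

lemma approximable_scaleR:
  assumes "x \<in> approximable" shows "c *\<^sub>R x \<in> approximable"
  unfolding approximable_def
proof (intro CollectI allI impI)
  fix \<epsilon> :: real assume "\<epsilon> > 0"
  then have "\<epsilon> / (\<bar>c\<bar> + 1) > 0" by simp
  then obtain n G where G: "level_measurable n G" "\<bar>x - simple n G\<bar> \<le> (\<epsilon> / (\<bar>c\<bar> + 1)) *\<^sub>R e"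
    using assms unfolding approximable_def by blast
  have "\<bar>c *\<^sub>R x - simple n (\<lambda>A. c * G A)\<bar> = \<bar>c\<bar> *\<^sub>R \<bar>x - simple n G\<bar>"
    by (simp only: simple_scaleR scaleR_right_diff_distrib[symmetric] abs_scaleR_banach_lattice)
  also have "\<dots> \<le> \<bar>c\<bar> *\<^sub>R ((\<epsilon> / (\<bar>c\<bar> + 1)) *\<^sub>R e)" using G(2) by (rule scaleR_left_mono) simp
  also have "\<dots> = (\<bar>c\<bar> * (\<epsilon> / (\<bar>c\<bar> + 1))) *\<^sub>R e" by simp
  also have "\<dots> \<le> \<epsilon> *\<^sub>R e"
  proof (rule scaleR_right_mono[OF _ e])
    show "\<bar>c\<bar> * (\<epsilon> / (\<bar>c\<bar> + 1)) \<le> \<epsilon>" using \<open>\<epsilon> > 0\<close> by (simp add: field_simps)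
  qed
  finally have "\<bar>c *\<^sub>R x - simple n (\<lambda>A. c * G A)\<bar> \<le> \<epsilon> *\<^sub>R e" .
  moreover have "level_measurable n (\<lambda>A. c * G A)" using G(1) by (simp add: level_measurable_def)
  ultimately show "\<exists>n G. level_measurable n G \<and> \<bar>c *\<^sub>R x - simple n G\<bar> \<le> \<epsilon> *\<^sub>R e" by (intro exI conjI)
qed

lemma approximable_simple: "level_measurable n G \<Longrightarrow> simple n G \<in> approximable"
  unfolding approximable_def using e
  by (intro CollectI allI impI exI[of _ n] exI[of _ G]) (simp add: scaleR_nonneg_nonneg)

lemma subspace_approximable: "subspace approximable"
proof (rule subspaceI)
  have "simple 0 (\<lambda>_. 0) \<in> approximable" by (rule approximable_simple) (simp add: level_measurable_def)
  then show "0 \<in> approximable" by (simp add: simple_const)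
qed (auto intro: approximable_add approximable_scaleR)

lemma two_p_minus_e_approximable: "2 *\<^sub>R p k - e \<in> approximable"
proof -
  have "p k \<in> approximable"
    by (subst simple_indicator_p[symmetric]) (rule approximable_simple, auto simp: level_measurable_def)
  moreover have "e \<in> approximable"
    using approximable_simple[of 0 "\<lambda>_. 1"] by (simp add: simple_const level_measurable_def)
  ultimately show ?thesis using subspace_approximable by (simp add: subspace_diff subspace_scale)
qed

lemma approximable_limit:
  assumes "\<And>\<epsilon>. \<epsilon> > 0 \<Longrightarrow> \<exists>y\<in>approximable. \<bar>x - y\<bar> \<le> \<epsilon> *\<^sub>R e"
  shows "x \<in> approximable"
  unfolding approximable_def
proof (intro CollectI allI impI)
  fix \<epsilon> :: real assume "\<epsilon> > 0"
  then have "\<epsilon>/2 > 0" by simp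
  then obtain y where y: "y \<in> approximable" "\<bar>x - y\<bar> \<le> (\<epsilon>/2) *\<^sub>R e" using assms by blast
  then obtain n G where G: "level_measurable n G" "\<bar>y - simple n G\<bar> \<le> (\<epsilon>/2) *\<^sub>R e"
    using \<open>\<epsilon>/2 > 0\<close> unfolding approximable_def by blast
  have "\<bar>x - simple n G\<bar> \<le> \<bar>x - y\<bar> + \<bar>y - simple n G\<bar>"
    using abs_triangle_ineq[of "x - y" "y - simple n G"] by simp
  also have "\<dots> \<le> (\<epsilon>/2) *\<^sub>R e + (\<epsilon>/2) *\<^sub>R e" by (intro add_mono y G)
  also have "\<dots> = \<epsilon> *\<^sub>R e" by (simp add: scaleR_left_distrib[symmetric])
  finally show "\<exists>n G. level_measurable n G \<and> \<bar>x - simple n G\<bar> \<le> \<epsilon> *\<^sub>R e" using G(1) by blast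
qed

end

text \<open>A pairing function merges the components from the binary expansions of all
  \<open>t j\<close> into one sequence. Approximable elements form a subspace closed under uniform
  limits, so they include the span.\<close>

lemma exists_component_sequence:
  fixes e :: "'a::banach_lattice" and t :: "nat \<Rightarrow> 'a"
  assumes oc: "order_continuous TYPE('a)" and e: "0 \<le> e"
    and t: "\<And>j. \<exists>m\<ge>0. \<bar>t j\<bar> \<le> m *\<^sub>R e"
  obtains p where "component_sequence e p" "span (range t) \<subseteq> component_sequence.approximable e p"
proof -
  obtain m where m: "\<And>j. 0 \<le> m j \<and> \<bar>t j\<bar> \<le> m j *\<^sub>R e" using t by metis
  have "\<forall>j. \<exists>qc. (\<forall>i. component e (fst qc i)) \<and>
      (\<forall>i. \<bar>t j - (\<Sum>k<i. snd qc k *\<^sub>R (2 *\<^sub>R fst qc k - e))\<bar> \<le> (m j / 2 ^ i) *\<^sub>R e)"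
    using dyadic_component_expansion[OF oc e conjunct2[OF m] conjunct1[OF m]] by simp
  from choice[OF this] obtain qc where qc':
    "\<forall>j. (\<forall>i. component e (fst (qc j) i)) \<and>
      (\<forall>i. \<bar>t j - (\<Sum>k<i. snd (qc j) k *\<^sub>R (2 *\<^sub>R fst (qc j) k - e))\<bar> \<le> (m j / 2 ^ i) *\<^sub>R e)" ..
  define q where "q j = fst (qc j)" for j
  define c where "c j = snd (qc j)" for j
  have qc: "component e (q j i)"
    "\<bar>t j - (\<Sum>k<i. c j k *\<^sub>R (2 *\<^sub>R q j k - e))\<bar> \<le> (m j / 2 ^ i) *\<^sub>R e" for j i
    using qc' unfolding q_def c_def by blast+
  define p where "p n = q (fst (prod_decode n)) (snd (prod_decode n))" for n
  interpret component_sequence e p by unfold_locales (auto simp: e p_def qc)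
  have q: "2 *\<^sub>R q j k - e \<in> approximable" for j k
    using two_p_minus_e_approximable[of "prod_encode (j, k)"] by (simp add: p_def)
  have "t j \<in> approximable" for j
  proof (rule approximable_limit)
    fix \<epsilon> :: real assume \<epsilon>: "\<epsilon> > 0"
    have "(\<lambda>i. m j * (1/2) ^ i) \<longlonglongrightarrow> m j * 0" by (intro tendsto_mult tendsto_const LIMSEQ_power_zero) simp
    then have "\<forall>\<^sub>F i in sequentially. m j * (1/2) ^ i < \<epsilon>" using \<epsilon> by (intro order_tendstoD(2)[of _ "0::real"]) auto
    then obtain i where "m j * (1/2) ^ i < \<epsilon>" by (auto simp: eventually_sequentially)
    then have "(m j / 2 ^ i) *\<^sub>R e \<le> \<epsilon> *\<^sub>R e"
      by (intro scaleR_right_mono[OF _ e]) (simp add: power_one_over)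
    moreover have "(\<Sum>k<i. c j k *\<^sub>R (2 *\<^sub>R q j k - e)) \<in> approximable"
      by (intro subspace_sum subspace_approximable approximable_scaleR q)
    ultimately show "\<exists>y\<in>approximable. \<bar>t j - y\<bar> \<le> \<epsilon> *\<^sub>R e" using qc(2)[of j i] order_trans by blast
  qed
  then have "span (range t) \<subseteq> approximable" by (intro span_minimal subspace_approximable) auto
  then show ?thesis using that component_sequence_axioms by blast
qed

section \<open>Integrals over components\<close>

locale component_functional = component_sequence e p + positive_functional \<phi>
  for e :: "'a::banach_lattice" and p :: "nat \<Rightarrow> 'a" and \<phi> :: "'a \<Rightarrow> real"
begin

lemma phi_simple: "\<phi> (simple n G) = (\<Sum>A\<in>Pow {..<n}. \<phi> (atom n A) * G A)"
  by (simp add: simple_def linear_sum[OF lin] linear_scale[OF lin] mult.commute)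

lemma phi_atom_nonneg: "0 \<le> \<phi> (atom n A)"
  by (intro pos atom_bounds)

text \<open>\<open>u\<close> is the projection of \<open>x\<close> onto the band of
  \<open>q\<close>, expressed by two order bounds within the ideal of \<open>e\<close> instead of a
  projection operator.\<close>

definition band_part :: "'a \<Rightarrow> 'a \<Rightarrow> 'a \<Rightarrow> bool" where
  "band_part q x u \<longleftrightarrow> (\<exists>K\<ge>0. \<bar>u\<bar> \<le> K *\<^sub>R q \<and> \<bar>x - u\<bar> \<le> K *\<^sub>R (e - q))"

lemma band_part_exists:
  assumes q: "component e q" and x: "\<bar>x\<bar> \<le> m *\<^sub>R e" and m: "0 \<le> m"
  shows "\<exists>u. band_part q x u"
proof -
  have q': "0 \<le> q" "0 \<le> e - q" "inf q (e - q) = 0" using q by (auto simp: component_def)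
  have mq: "0 \<le> m *\<^sub>R q" "0 \<le> m *\<^sub>R (e - q)" using q' m by (simp_all add: scaleR_nonneg_nonneg)
  have split: "inf (m *\<^sub>R q) z + inf (m *\<^sub>R (e - q)) z = z" if z: "0 \<le> z" "z \<le> m *\<^sub>R e" for z
  proof -
    have "inf (m *\<^sub>R q) (m *\<^sub>R (e - q)) = 0" using q' m by (intro inf_scaleR_eq_0)
    then have "inf (m *\<^sub>R q + m *\<^sub>R (e - q)) z = inf (m *\<^sub>R q) z + inf (m *\<^sub>R (e - q)) z"
      using mq z by (intro inf_add_of_disjoint)
    moreover have "m *\<^sub>R q + m *\<^sub>R (e - q) = m *\<^sub>R e" by (simp add: scaleR_right_diff_distrib)
    ultimately show ?thesis using z by (simp add: inf_absorb2)
  qed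
  define z where "z = pprt x"
  define z' where "z' = - nprt x"
  have z: "0 \<le> z" "0 \<le> z'" "x = z - z'" "\<bar>x\<bar> = z + z'"
    using prts[of x] abs_prts[of x] by (simp_all add: z_def z'_def)
  have zle: "z \<le> m *\<^sub>R e" "z' \<le> m *\<^sub>R e"
    using order_trans[OF _ x, of z] order_trans[OF _ x, of z'] z by simp_all
  define u where "u = inf (m *\<^sub>R q) z - inf (m *\<^sub>R q) z'"
  have "x - u = inf (m *\<^sub>R (e - q)) z - inf (m *\<^sub>R (e - q)) z'"
  proof -
    have "x - u = (inf (m *\<^sub>R q) z + inf (m *\<^sub>R (e - q)) z) - (inf (m *\<^sub>R q) z' + inf (m *\<^sub>R (e - q)) z')
        - (inf (m *\<^sub>R q) z - inf (m *\<^sub>R q) z')"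
      unfolding split[OF z(1) zle(1)] split[OF z(2) zle(2)] u_def z(3)[symmetric] by (rule refl)
    then show ?thesis by simp
  qed
  moreover have "\<bar>inf (m *\<^sub>R (e - q)) z - inf (m *\<^sub>R (e - q)) z'\<bar> \<le> m *\<^sub>R (e - q)"
    by (rule abs_diff_le_of_nonneg) (use mq z in auto)
  moreover have "\<bar>u\<bar> \<le> m *\<^sub>R q" unfolding u_def by (rule abs_diff_le_of_nonneg) (use mq z in auto)
  ultimately have "band_part q x u" unfolding band_part_def using m by metis
  then show ?thesis ..
qed

text \<open>\<open>u\<close> and \<open>x - u\<close> are disjoint, so
  \<open>\<bar>u\<bar> \<le> \<bar>x\<bar>\<close>, and \<open>u\<close> is also disjoint from
  \<open>e - q\<close>. The case \<epsilon> = 0 gives uniqueness of the band part.\<close>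

lemma band_part_bound:
  assumes q: "component e q" and x: "\<bar>x\<bar> \<le> \<epsilon> *\<^sub>R e" and \<epsilon>: "0 \<le> \<epsilon>" and u: "band_part q x u"
  shows "\<bar>u\<bar> \<le> \<epsilon> *\<^sub>R q"
proof -
  obtain K where K: "0 \<le> K" "\<bar>u\<bar> \<le> K *\<^sub>R q" "\<bar>x - u\<bar> \<le> K *\<^sub>R (e - q)"
    using u unfolding band_part_def by blast
  have q': "0 \<le> q" "0 \<le> e - q" "inf q (e - q) = 0" using q by (auto simp: component_def)
  have d: "inf (K *\<^sub>R q) (K *\<^sub>R (e - q)) = 0" "inf (K *\<^sub>R q) (1 *\<^sub>R (e - q)) = 0"
    by (rule inf_scaleR_eq_0; use q' K in simp)+
  have "inf \<bar>u\<bar> \<bar>x - u\<bar> = 0" by (rule inf_eq_0_mono[OF d(1)]) (use K in auto)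
  then have "\<bar>u + (x - u)\<bar> = \<bar>u\<bar> + \<bar>x - u\<bar>" by (rule abs_add_of_disjoint)
  then have "\<bar>x\<bar> = \<bar>u\<bar> + \<bar>x - u\<bar>" by simp
  then have "\<bar>u\<bar> \<le> \<bar>x\<bar>" by simp
  then have "\<bar>u\<bar> \<le> \<epsilon> *\<^sub>R (q + (e - q))" using x order_trans by (metis add.commute diff_add_cancel)
  moreover have "inf \<bar>u\<bar> (e - q) = 0" by (rule inf_eq_0_mono[OF d(2)]) (use K q' in auto)
  ultimately show ?thesis by (intro le_scaleR_of_disjoint[of "\<bar>u\<bar>" \<epsilon> q "e - q"]) (use q' \<epsilon> in auto)
qed

lemma band_part_add:
  assumes q: "component e q" and "band_part q x u" "band_part q y v" shows "band_part q (x + y) (u + v)"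
proof -
  obtain K where K: "0 \<le> K" "\<bar>u\<bar> \<le> K *\<^sub>R q" "\<bar>x - u\<bar> \<le> K *\<^sub>R (e - q)"
    using assms(2) unfolding band_part_def by blast
  obtain L where L: "0 \<le> L" "\<bar>v\<bar> \<le> L *\<^sub>R q" "\<bar>y - v\<bar> \<le> L *\<^sub>R (e - q)"
    using assms(3) unfolding band_part_def by blast
  have "\<bar>u + v\<bar> \<le> (K + L) *\<^sub>R q"
    unfolding scaleR_left_distrib by (rule order_trans[OF abs_triangle_ineq add_mono[OF K(2) L(2)]])
  moreover have "\<bar>(x - u) + (y - v)\<bar> \<le> (K + L) *\<^sub>R (e - q)"
    unfolding scaleR_left_distrib by (rule order_trans[OF abs_triangle_ineq add_mono[OF K(3) L(3)]])
  moreover have "(x - u) + (y - v) = (x + y) - (u + v)" by simp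
  ultimately show ?thesis using K(1) L(1) unfolding band_part_def
    by (intro exI[of _ "K + L"]) simp
qed

lemma band_part_scaleR:
  assumes "band_part q x u" shows "band_part q (c *\<^sub>R x) (c *\<^sub>R u)"
proof -
  obtain K where K: "0 \<le> K" "\<bar>u\<bar> \<le> K *\<^sub>R q" "\<bar>x - u\<bar> \<le> K *\<^sub>R (e - q)"
    using assms unfolding band_part_def by blast
  have "\<bar>c *\<^sub>R u\<bar> \<le> (\<bar>c\<bar> * K) *\<^sub>R q"
    unfolding abs_scaleR_banach_lattice scaleR_scaleR[symmetric] by (rule scaleR_left_mono[OF K(2)]) simp
  moreover have "\<bar>c *\<^sub>R x - c *\<^sub>R u\<bar> \<le> (\<bar>c\<bar> * K) *\<^sub>R (e - q)"
    unfolding scaleR_right_diff_distrib[symmetric] abs_scaleR_banach_lattice[of c] scaleR_scaleR[symmetric]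
    by (rule scaleR_left_mono[OF _ abs_ge_zero]) (use K(3) in \<open>simp add: scaleR_right_diff_distrib\<close>)
  ultimately show ?thesis using K(1) unfolding band_part_def
    by (intro exI[of _ "\<bar>c\<bar> * K"]) simp
qed

definition integral_on :: "'a \<Rightarrow> 'a \<Rightarrow> real" where
  "integral_on q x = \<phi> (SOME u. band_part q x u)"

lemma integral_on_eq:
  assumes q: "component e q" and u: "band_part q x u"
  shows "integral_on q x = \<phi> u"
proof -
  let ?v = "SOME u. band_part q x u"
  have v: "band_part q x ?v" using u by (rule someI)
  \<comment> \<open>The difference of two band parts of \<open>x\<close> is a band part of
    \<open>0\<close>, hence vanishes by the bound with \<epsilon> = 0.\<close>
  have "band_part q (x + (-1) *\<^sub>R x) (u + (-1) *\<^sub>R ?v)"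
    by (intro band_part_add q u band_part_scaleR v)
  then have "\<bar>u - ?v\<bar> \<le> 0 *\<^sub>R q"
    by (intro band_part_bound[OF q, of 0 0]) simp_all
  then show ?thesis by (simp add: integral_on_def)
qed

lemma integral_on_add:
  assumes q: "component e q" and x: "\<exists>m\<ge>0. \<bar>x\<bar> \<le> m *\<^sub>R e" and y: "\<exists>m\<ge>0. \<bar>y\<bar> \<le> m *\<^sub>R e"
  shows "integral_on q (x + y) = integral_on q x + integral_on q y"
proof -
  obtain u v where uv: "band_part q x u" "band_part q y v"
    using band_part_exists[OF q] x y by metis
  show ?thesis
    unfolding integral_on_eq[OF q uv(1)] integral_on_eq[OF q uv(2)] integral_on_eq[OF q band_part_add[OF q uv]]
    by (rule linear_add[OF lin])
qed

lemma integral_on_scaleR: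
  assumes q: "component e q" and x: "\<exists>m\<ge>0. \<bar>x\<bar> \<le> m *\<^sub>R e"
  shows "integral_on q (c *\<^sub>R x) = c * integral_on q x"
proof -
  obtain u where u: "band_part q x u" using band_part_exists[OF q] x by metis
  show ?thesis
    unfolding integral_on_eq[OF q u] integral_on_eq[OF q band_part_scaleR[OF u]]
    using linear_scale[OF lin] by simp
qed

lemma band_part_simple:
  assumes nm: "n \<le> m" and A: "A \<subseteq> {..<n}"
  shows "band_part (atom n A) (simple m G) (simple m (\<lambda>B. of_bool (B \<inter> {..<n} = A) * G B))"
proof -
  define K where "K = (\<Sum>B\<in>Pow {..<m}. \<bar>G B\<bar>)"
  have K0: "0 \<le> K" unfolding K_def by (intro sum_nonneg) simp
  have K: "\<bar>G B\<bar> \<le> K" if "B \<subseteq> {..<m}" for B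
    unfolding K_def by (rule member_le_sum) (use that in auto)
  let ?I = "\<lambda>B. of_bool (B \<inter> {..<n} = A) :: real"
  have I: "simple m ?I = atom n A" by (rule simple_indicator_atom[OF nm A])
  have "\<bar>simple m (\<lambda>B. ?I B * G B)\<bar> \<le> simple m (\<lambda>B. K * ?I B)"
    unfolding abs_simple by (rule simple_mono) (auto simp: K)
  moreover have "simple m G - simple m (\<lambda>B. ?I B * G B) = simple m (\<lambda>B. G B - ?I B * G B)"
    by (simp add: simple_diff)
  moreover have "\<bar>simple m (\<lambda>B. G B - ?I B * G B)\<bar> \<le> simple m (\<lambda>B. K * (1 - ?I B))"
    unfolding abs_simple by (rule simple_mono) (auto simp: K)
  moreover have "simple m (\<lambda>B. K * (1 - ?I B)) = K *\<^sub>R (e - atom n A)"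
    by (simp only: simple_scaleR simple_diff I simple_const scaleR_one)
  ultimately show ?thesis unfolding band_part_def simple_scaleR I using K0
    by (intro exI[of _ K]) simp
qed

lemma integral_on_simple:
  assumes nm: "n \<le> m" and A: "A \<subseteq> {..<n}"
  shows "integral_on (atom n A) (simple m G) = (\<Sum>B\<in>{B\<in>Pow {..<m}. B \<inter> {..<n} = A}. \<phi> (atom m B) * G B)"
proof -
  have "integral_on (atom n A) (simple m G) = (\<Sum>B\<in>Pow {..<m}. \<phi> (atom m B) * (of_bool (B \<inter> {..<n} = A) * G B))"
    unfolding integral_on_eq[OF component_atom[OF A] band_part_simple[OF nm A]] phi_simple by (rule refl)
  also have "\<dots> = (\<Sum>B\<in>{B\<in>Pow {..<m}. B \<inter> {..<n} = A}. \<phi> (atom m B) * G B)"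
    by (rule sum.mono_neutral_cong_right) auto
  finally show ?thesis .
qed

lemma integral_on_bound:
  assumes q: "component e q" and x: "\<bar>x\<bar> \<le> \<epsilon> *\<^sub>R e" and \<epsilon>: "0 \<le> \<epsilon>"
  shows "\<bar>integral_on q x\<bar> \<le> \<epsilon> * \<phi> q"
proof -
  obtain u where u: "band_part q x u" using band_part_exists[OF q x \<epsilon>] by blast
  have "\<bar>\<phi> u\<bar> \<le> \<phi> \<bar>u\<bar>" by (rule abs_le)
  also have "\<dots> \<le> \<phi> (\<epsilon> *\<^sub>R q)" by (rule mono[OF band_part_bound[OF q x \<epsilon> u]])
  also have "\<dots> = \<epsilon> * \<phi> q" using linear_scale[OF lin] by simp
  finally show ?thesis unfolding integral_on_eq[OF q u] .
qed

end

section \<open>Common kernels of finitely many functionals\<close>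

lemma infinite_dimensional_kernel:
  fixes W :: "'a::real_vector set" and f :: "'a \<Rightarrow> real"
  assumes W: "subspace W" "infinite_dimensional W"
    and add: "\<And>x y. x \<in> W \<Longrightarrow> y \<in> W \<Longrightarrow> f (x + y) = f x + f y"
    and scale: "\<And>c x. x \<in> W \<Longrightarrow> f (c *\<^sub>R x) = c * f x"
  shows "subspace {x \<in> W. f x = 0} \<and> infinite_dimensional {x \<in> W. f x = 0}"
proof
  have f0: "f 0 = 0" using scale[of 0 0] subspace_0[OF W(1)] by simp
  show "subspace {x \<in> W. f x = 0}"
    by (rule subspaceI) (use W(1) add scale f0 in \<open>auto simp: subspace_0 subspace_add subspace_scale\<close>)
  show "infinite_dimensional {x \<in> W. f x = 0}"
    unfolding infinite_dimensional_def
  proof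
    assume "\<exists>B. finite B \<and> {x \<in> W. f x = 0} \<subseteq> span B"
    then obtain B where B: "finite B" "{x \<in> W. f x = 0} \<subseteq> span B" by blast
    have "\<exists>B. finite B \<and> W \<subseteq> span B"
    proof (cases "\<exists>w\<in>W. f w \<noteq> 0")
      case False
      then have "W \<subseteq> span B" using B(2) by auto
      then show ?thesis using B(1) by blast
    next
      case True
      then obtain w where w: "w \<in> W" "f w \<noteq> 0" by blast
      have "x \<in> span (insert w B)" if x: "x \<in> W" for x
      proof -
        let ?c = "- (f x / f w)"
        have "f (x + ?c *\<^sub>R w) = f x + ?c * f w"
          by (simp only: add[OF x subspace_scale[OF W(1) w(1)]] scale[OF w(1)])
        then have "f (x + ?c *\<^sub>R w) = 0" using w(2) by simp
        moreover have "x + ?c *\<^sub>R w \<in> W" by (intro subspace_add[OF W(1)] subspace_scale[OF W(1)] x w)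
        ultimately have "x + ?c *\<^sub>R w \<in> span B" using B(2) by blast
        then have "x + ?c *\<^sub>R w \<in> span (insert w B)" using span_mono[of B "insert w B"] by blast
        moreover have "(- ?c) *\<^sub>R w \<in> span (insert w B)" by (intro span_scale span_base) simp
        ultimately have "(x + ?c *\<^sub>R w) + (- ?c) *\<^sub>R w \<in> span (insert w B)" by (rule span_add)
        then show ?thesis by simp
      qed
      then have "W \<subseteq> span (insert w B)" by blast
      then show ?thesis using B(1) by (intro exI[of _ "insert w B"]) simp
    qed
    then show False using W(2) unfolding infinite_dimensional_def by blast
  qed
qed

text \<open>Each functional lowers the dimension by at most one. Linearity is required on
  \<open>W\<close> only, since \<open>integral_on\<close> is linear merely on elements dominated by
  multiples of \<open>e\<close>.\<close>

lemma infinite_dimensional_finite_kernel: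
  fixes W :: "'a::real_vector set" and f :: "'i \<Rightarrow> 'a \<Rightarrow> real"
  assumes F: "finite F" and W: "subspace W" "infinite_dimensional W"
    and add: "\<And>i x y. i \<in> F \<Longrightarrow> x \<in> W \<Longrightarrow> y \<in> W \<Longrightarrow> f i (x + y) = f i x + f i y"
    and scale: "\<And>i c x. i \<in> F \<Longrightarrow> x \<in> W \<Longrightarrow> f i (c *\<^sub>R x) = c * f i x"
  shows "\<exists>x\<in>W. x \<noteq> 0 \<and> (\<forall>i\<in>F. f i x = 0)"
proof -
  have "subspace {x \<in> W. \<forall>i\<in>F. f i x = 0} \<and> infinite_dimensional {x \<in> W. \<forall>i\<in>F. f i x = 0}"
    using F add scale
  proof (induction F rule: finite_induct)
    case (insert i F)
    let ?U = "{x \<in> W. \<forall>i\<in>F. f i x = 0}"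
    have U: "subspace ?U" "infinite_dimensional ?U" using insert by auto
    have "{x \<in> W. \<forall>i\<in>insert i F. f i x = 0} = {x \<in> ?U. f i x = 0}" by auto
    then show ?case using infinite_dimensional_kernel[OF U, of "f i"] insert.prems by simp
  qed (use W in simp)
  then have "\<not> {x \<in> W. \<forall>i\<in>F. f i x = 0} \<subseteq> span {}" unfolding infinite_dimensional_def by blast
  then show ?thesis by auto
qed

section \<open>Martingale difference approximations\<close>

context component_functional
begin

text \<open>Vanishing integrals over the atoms of level \<open>n\<close> are finitely many linear
  conditions, so some unit vector \<open>y\<close> of \<open>V\<close> meets them all. A simple
  approximation meets them up to \<epsilon>/2 relative to the weight of the atom; subtracting its
  conditional means repairs this at a further cost of \<epsilon>/2.\<close>

lemma mean_zero_step:
  assumes V: "subspace V" "infinite_dimensional V" "V \<subseteq> approximable"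
    and bounded: "\<And>x. x \<in> V \<Longrightarrow> \<exists>m\<ge>0. \<bar>x\<bar> \<le> m *\<^sub>R e" and \<epsilon>: "\<epsilon> > 0"
  shows "\<exists>y m G. y \<in> V \<and> norm y = 1 \<and> n \<le> m \<and> level_measurable m G \<and> \<bar>y - simple m G\<bar> \<le> \<epsilon> *\<^sub>R e \<and>
    (\<forall>A\<in>Pow {..<n}. (\<Sum>B\<in>{B\<in>Pow {..<m}. B \<inter> {..<n} = A}. \<phi> (atom m B) * G B) = 0)"
proof -
  have ca: "component e (atom n A)" if "A \<in> Pow {..<n}" for A using that by (intro component_atom) simp
  have "\<exists>x\<in>V. x \<noteq> 0 \<and> (\<forall>A\<in>Pow {..<n}. integral_on (atom n A) x = 0)"
    by (rule infinite_dimensional_finite_kernel)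
      (simp_all add: V integral_on_add integral_on_scaleR ca bounded)
  then obtain x where x: "x \<in> V" "x \<noteq> 0" "\<And>A. A \<in> Pow {..<n} \<Longrightarrow> integral_on (atom n A) x = 0" by blast
  define y where "y = (1 / norm x) *\<^sub>R x"
  have y: "y \<in> V" "norm y = 1" using x V(1) by (simp_all add: y_def subspace_scale)
  have y0: "integral_on (atom n A) y = 0" if "A \<in> Pow {..<n}" for A
    unfolding y_def integral_on_scaleR[OF ca[OF that] bounded[OF x(1)]] x(3)[OF that] by simp
  have \<epsilon>2: "\<epsilon>/2 > 0" using \<epsilon> by simp
  obtain m0 H where H: "level_measurable m0 H" "\<bar>y - simple m0 H\<bar> \<le> (\<epsilon>/2) *\<^sub>R e"
    using y(1) V(3) \<epsilon>2 unfolding approximable_def by blast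
  define m where "m = max n m0"
  have nm: "n \<le> m" by (simp add: m_def)
  have Hm: "level_measurable m H" by (rule level_measurable_mono[OF H(1)]) (simp add: m_def)
  have sm: "simple m H = simple m0 H" by (rule simple_lift[OF H(1)]) (simp add: m_def)
  define s where "s = simple m H"
  have ys: "\<bar>y - s\<bar> \<le> (\<epsilon>/2) *\<^sub>R e" using H(2) by (simp add: s_def sm)
  obtain M where M: "M \<ge> 0" "\<bar>y\<bar> \<le> M *\<^sub>R e" using bounded[OF y(1)] by blast
  have "\<bar>s\<bar> \<le> \<bar>y\<bar> + \<bar>y - s\<bar>" using abs_triangle_ineq4[of y "y - s"] by simp
  also have "\<dots> \<le> M *\<^sub>R e + (\<epsilon>/2) *\<^sub>R e" by (rule add_mono[OF M(2) ys])
  finally have s_bd: "\<bar>s\<bar> \<le> (M + \<epsilon>/2) *\<^sub>R e" by (simp add: scaleR_left_distrib)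
  define S where "S A = {B\<in>Pow {..<m}. B \<inter> {..<n} = A}" for A
  define I where "I A = (\<Sum>B\<in>S A. \<phi> (atom m B) * H B)" for A
  have I_bd: "\<bar>I A\<bar> \<le> (\<epsilon>/2) * \<phi> (atom n A)" if A: "A \<in> Pow {..<n}" for A
  proof -
    have "integral_on (atom n A) ((y - s) + s) = integral_on (atom n A) (y - s) + integral_on (atom n A) s"
      using integral_on_add[OF ca[OF A]] ys s_bd M(1) \<epsilon> by (metis add_nonneg_nonneg less_imp_le \<epsilon>2)
    moreover have "integral_on (atom n A) s = I A"
      unfolding s_def I_def S_def using A by (intro integral_on_simple nm) simp
    ultimately have "I A = - integral_on (atom n A) (y - s)" using y0[OF A] by simp
    then show ?thesis using integral_on_bound[OF ca[OF A] ys] \<epsilon> by simp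
  qed
  \<comment> \<open>The conditional mean of \<open>H\<close> on the atom. If the atom has weight
    zero, the quotient is \<open>0\<close> by convention, and this is correct because
    \<open>I_bd\<close> then gives \<open>I A = 0\<close>.\<close>
  define c where "c A = I A / \<phi> (atom n A)" for A
  have c_bd: "\<bar>c A\<bar> \<le> \<epsilon>/2" if A: "A \<in> Pow {..<n}" for A
  proof (cases "\<phi> (atom n A) = 0")
    case False
    then have "\<phi> (atom n A) > 0" using phi_atom_nonneg[of n A] by simp
    then show ?thesis using I_bd[OF A] by (simp add: c_def field_simps)
  qed (use \<epsilon> in \<open>simp add: c_def\<close>)
  define G where "G B = H B - c (B \<inter> {..<n})" for B
  have G: "level_measurable m G"
    unfolding level_measurable_def
  proof
    fix A
    have "A \<inter> {..<m} \<inter> {..<n} = A \<inter> {..<n}" using nm by auto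
    then show "G (A \<inter> {..<m}) = G A" using level_measurableD[OF Hm, of A] by (simp add: G_def)
  qed
  have "simple m G = s - simple m (\<lambda>B. c (B \<inter> {..<n}))"
    by (simp add: G_def[abs_def] simple_diff s_def)
  then have "y - simple m G = (y - s) + simple m (\<lambda>B. c (B \<inter> {..<n}))" by simp
  then have "\<bar>y - simple m G\<bar> \<le> \<bar>y - s\<bar> + \<bar>simple m (\<lambda>B. c (B \<inter> {..<n}))\<bar>"
    by (simp only: abs_triangle_ineq)
  also have "\<dots> \<le> (\<epsilon>/2) *\<^sub>R e + (\<epsilon>/2) *\<^sub>R e"
  proof (rule add_mono[OF ys])
    have "\<bar>simple m (\<lambda>B. c (B \<inter> {..<n}))\<bar> \<le> simple m (\<lambda>B. \<epsilon>/2)"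
      unfolding abs_simple by (rule simple_mono) (rule c_bd, simp)
    then show "\<bar>simple m (\<lambda>B. c (B \<inter> {..<n}))\<bar> \<le> (\<epsilon>/2) *\<^sub>R e" by (simp only: simple_const)
  qed
  also have "\<dots> = \<epsilon> *\<^sub>R e" by (simp add: scaleR_left_distrib[symmetric])
  finally have yG: "\<bar>y - simple m G\<bar> \<le> \<epsilon> *\<^sub>R e" .
  have zero: "(\<Sum>B\<in>S A. \<phi> (atom m B) * G B) = 0" if A: "A \<in> Pow {..<n}" for A
  proof -
    have "\<phi> (atom n A) = (\<Sum>B\<in>Pow {..<m}. \<phi> (atom m B) * of_bool (B \<inter> {..<n} = A))"
      using simple_indicator_atom[OF nm, of A] A phi_simple[of m "\<lambda>B. of_bool (B \<inter> {..<n} = A)"] by simp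
    also have "\<dots> = (\<Sum>B\<in>S A. \<phi> (atom m B))"
      unfolding S_def by (rule sum.mono_neutral_cong_right) auto
    finally have a: "\<phi> (atom n A) = (\<Sum>B\<in>S A. \<phi> (atom m B))" .
    have "(\<Sum>B\<in>S A. \<phi> (atom m B) * G B) = (\<Sum>B\<in>S A. \<phi> (atom m B) * H B - c A * \<phi> (atom m B))"
      by (rule sum.cong) (auto simp: S_def G_def algebra_simps)
    also have "\<dots> = I A - c A * \<phi> (atom n A)"
      by (simp add: sum_subtractf I_def a sum_distrib_left)
    also have "\<dots> = 0" using I_bd[OF A] by (cases "\<phi> (atom n A) = 0") (auto simp: c_def)
    finally show ?thesis .
  qed
  show ?thesis
    using y nm G yG zero unfolding S_def by (intro exI[of _ y] exI[of _ m] exI[of _ G]) blast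
qed

end

text \<open>A martingale difference sequence for the filtration whose \<open>k\<close>-th algebra is
  generated by the first \<open>n k\<close> components. Conditional expectation appears only as a
  sum over the finer cells inside a given cell.\<close>

locale mean_zero_sequence = component_functional e p \<phi>
  for e :: "'a::banach_lattice" and p :: "nat \<Rightarrow> 'a" and \<phi> :: "'a \<Rightarrow> real" +
  fixes n :: "nat \<Rightarrow> nat" and G :: "nat \<Rightarrow> nat set \<Rightarrow> real"
  assumes n0: "n 0 = 0" and n_step: "\<And>k. n k \<le> n (Suc k)"
    and meas: "\<And>k. level_measurable (n (Suc k)) (G k)"
    and mean_zero: "\<And>k A. A \<in> Pow {..<n k} \<Longrightarrow>
      (\<Sum>B\<in>{B\<in>Pow {..<n (Suc k)}. B \<inter> {..<n k} = A}. \<phi> (atom (n (Suc k)) B) * G k B) = 0"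
begin

definition d :: "nat \<Rightarrow> 'a" where "d k = simple (n (Suc k)) (G k)"

lemma n_mono: "k \<le> l \<Longrightarrow> n k \<le> n l"
  using n_step by (rule lift_Suc_mono_le)

lemma d_lift: "k < N \<Longrightarrow> simple (n N) (G k) = d k"
  unfolding d_def by (rule simple_lift[OF meas n_mono]) simp

lemma sum_d: "m \<le> N \<Longrightarrow> (\<Sum>k<m. c k *\<^sub>R d k) = simple (n N) (\<lambda>A. \<Sum>k<m. c k * G k A)"
  by (simp add: simple_sum simple_scaleR d_lift)

lemma orthogonal:
  assumes k: "k < N" and h: "level_measurable (n k) h"
  shows "(\<Sum>A\<in>Pow {..<n N}. \<phi> (atom (n N) A) * (a k * G k A) * h A) = 0"
proof -
  let ?m = "n (Suc k)"
  have "level_measurable ?m h" by (rule level_measurable_mono[OF h n_step])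
  then have Gh: "level_measurable ?m (\<lambda>A. G k A * h A)"
    using meas[of k] by (simp add: level_measurable_def)
  have "(\<Sum>A\<in>Pow {..<n N}. \<phi> (atom (n N) A) * (a k * G k A) * h A)
      = a k * (\<Sum>A\<in>Pow {..<n N}. \<phi> (atom (n N) A) * (G k A * h A))"
    unfolding sum_distrib_left by (rule sum.cong) (auto simp: algebra_simps)
  also have "(\<Sum>A\<in>Pow {..<n N}. \<phi> (atom (n N) A) * (G k A * h A)) = \<phi> (simple (n N) (\<lambda>A. G k A * h A))"
    by (rule phi_simple[symmetric])
  also have "simple (n N) (\<lambda>A. G k A * h A) = simple ?m (\<lambda>A. G k A * h A)"
    by (rule simple_lift[OF Gh n_mono]) (use k in simp)
  also have "\<phi> \<dots> = (\<Sum>B\<in>Pow {..<?m}. \<phi> (atom ?m B) * (G k B * h B))" by (rule phi_simple)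
  \<comment> \<open>Group the finer cells by the cell of level \<open>n k\<close> containing them.
    On each group \<open>h\<close> is constant and \<open>G k\<close> has mean zero.\<close>
  also have "\<dots> = (\<Sum>A\<in>Pow {..<n k}. \<Sum>B\<in>{B\<in>Pow {..<?m}. B \<inter> {..<n k} = A}. \<phi> (atom ?m B) * (G k B * h B))"
    by (rule sum.group[symmetric]) auto
  also have "\<dots> = (\<Sum>A\<in>Pow {..<n k}. h A * (\<Sum>B\<in>{B\<in>Pow {..<?m}. B \<inter> {..<n k} = A}. \<phi> (atom ?m B) * G k B))"
    unfolding sum_distrib_left
  proof (intro sum.cong refl)
    fix A B assume "B \<in> {B\<in>Pow {..<?m}. B \<inter> {..<n k} = A}"
    then have "h B = h A" using level_measurableD[OF h, of B] by auto
    then show "\<phi> (atom ?m B) * (G k B * h B) = h A * (\<phi> (atom ?m B) * G k B)" by simp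
  qed
  also have "\<dots> = 0" using mean_zero[of _ k] by (intro sum.neutral) simp
  finally show ?thesis by simp
qed

text \<open>Translation to the discrete setting: the points are the cells of level
  \<open>n N\<close>, weighted by \<open>\<phi>\<close> of their atoms, and agreement up to time
  \<open>k\<close> means equality of the first \<open>n k\<close> bits.\<close>

lemma martingale_hyps:
  fixes a :: "nat \<Rightarrow> real"
  shows "\<And>k h. k < N \<Longrightarrow> (\<And>A B. A \<inter> {..<n k} = B \<inter> {..<n k} \<Longrightarrow> h A = h B) \<Longrightarrow>
      (\<Sum>A\<in>Pow {..<n N}. \<phi> (atom (n N) A) * (a k * G k A) * h A) = 0"
    and "\<And>k l A B. A \<inter> {..<n k} = B \<inter> {..<n k} \<Longrightarrow> l < k \<Longrightarrow> a l * G l A = a l * G l B"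
proof -
  fix k :: nat and h :: "nat set \<Rightarrow> real"
  assume k: "k < N" and h: "\<And>A B. A \<inter> {..<n k} = B \<inter> {..<n k} \<Longrightarrow> h A = h B"
  have "level_measurable (n k) h" unfolding level_measurable_def by (intro allI h) auto
  then show "(\<Sum>A\<in>Pow {..<n N}. \<phi> (atom (n N) A) * (a k * G k A) * h A) = 0" by (rule orthogonal[OF k])
next
  fix k l :: nat and A B assume AB: "A \<inter> {..<n k} = B \<inter> {..<n k}" and l: "l < k"
  have "level_measurable (n k) (G l)" by (rule level_measurable_mono[OF meas n_mono]) (use l in simp)
  then show "a l * G l A = a l * G l B" using level_measurable_cong[OF _ AB] by metis
qed

lemma phi_e: "(\<Sum>A\<in>Pow {..<m}. \<phi> (atom m A)) = \<phi> e"
  using phi_simple[of m "\<lambda>_. 1"] by (simp add: simple_const)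

text \<open>The weak type bound controls truncated means only, hence the truncation at
  \<open>t *\<^sub>R e\<close>. Later \<open>t\<close> is the norm of a vector of \<open>V\<close>
  and \<open>c\<close> is proportional to it.\<close>

lemma multiplier_estimate:
  assumes \<theta>: "\<And>k. \<bar>\<theta> k\<bar> \<le> (1::real)" and c: "c > 0" and t: "t \<ge> 0"
  shows "\<phi> (inf \<bar>\<Sum>k<N. (\<theta> k * a k) *\<^sub>R d k\<bar> (t *\<^sub>R e))
    \<le> c * \<phi> e + 2 * t / c * \<phi> \<bar>\<Sum>k<N. a k *\<^sub>R d k\<bar>"
proof -
  let ?H = "\<lambda>A. \<bar>\<Sum>k<N. \<theta> k * (a k * G k A)\<bar>"
  have "\<bar>\<Sum>k<N. (\<theta> k * a k) *\<^sub>R d k\<bar> = simple (n N) ?H"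
    by (simp add: sum_d[OF order_refl] abs_simple mult.assoc)
  then have "inf \<bar>\<Sum>k<N. (\<theta> k * a k) *\<^sub>R d k\<bar> (t *\<^sub>R e) = simple (n N) (\<lambda>A. min (?H A) t)"
    by (simp only: inf_simple simple_const[symmetric, of t "n N"])
  then have "\<phi> (inf \<bar>\<Sum>k<N. (\<theta> k * a k) *\<^sub>R d k\<bar> (t *\<^sub>R e)) = (\<Sum>A\<in>Pow {..<n N}. \<phi> (atom (n N) A) * min (?H A) t)"
    by (simp only: phi_simple)
  also have "\<dots> \<le> c * (\<Sum>A\<in>Pow {..<n N}. \<phi> (atom (n N) A))
      + 2 * t / c * (\<Sum>A\<in>Pow {..<n N}. \<phi> (atom (n N) A) * \<bar>\<Sum>k<N. a k * G k A\<bar>)"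
  proof (rule martingale_transform_truncated_mean[where R="\<lambda>k A B. A \<inter> {..<n k} = B \<inter> {..<n k}" and \<theta>="\<lambda>k A. \<theta> k"
        and d="\<lambda>k A. a k * G k A" and N=N])
    show "(\<Sum>A\<in>Pow {..<n N}. \<phi> (atom (n N) A) * (a k * G k A) * h A) = 0"
      if "k < N" "\<And>A B. A \<inter> {..<n k} = B \<inter> {..<n k} \<Longrightarrow> h A = h B" for k h
      using that by (rule martingale_hyps(1))
    show "a l * G l A = a l * G l B" if "A \<inter> {..<n k} = B \<inter> {..<n k}" "l < k" for k l A B
      using that by (rule martingale_hyps(2))
  qed (use \<theta> c t phi_atom_nonneg in auto)
  also have "(\<Sum>A\<in>Pow {..<n N}. \<phi> (atom (n N) A) * \<bar>\<Sum>k<N. a k * G k A\<bar>) = \<phi> \<bar>\<Sum>k<N. a k *\<^sub>R d k\<bar>"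
    by (simp only: sum_d[OF order_refl] abs_simple phi_simple)
  finally show ?thesis by (simp only: phi_e)
qed

lemma maximal_estimate:
  assumes c: "c > 0"
  shows "\<exists>h. (\<forall>m\<le>N. \<bar>\<Sum>k<m. a k *\<^sub>R d k\<bar> \<le> h) \<and> \<phi> (inf h e) \<le> c * \<phi> e + 2 / c * \<phi> \<bar>\<Sum>k<N. a k *\<^sub>R d k\<bar>"
proof -
  \<comment> \<open>The maximum is taken on coefficients, where it is a maximum of finitely many
    reals; the empty partial sum is included.\<close>
  define H where "H A = Max ((\<lambda>m. \<bar>\<Sum>k<m. a k * G k A\<bar>) ` {..N})" for A
  have H: "\<exists>m\<le>N. H A = \<bar>\<Sum>k<m. a k * G k A\<bar>" for A
  proof -
    have "H A \<in> (\<lambda>m. \<bar>\<Sum>k<m. a k * G k A\<bar>) ` {..N}"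
      unfolding H_def by (rule Max_in) auto
    then show ?thesis by auto
  qed
  have le: "\<bar>\<Sum>k<m. a k * G k A\<bar> \<le> H A" if "m \<le> N" for m A
    unfolding H_def using that by (intro Max_ge) auto
  have bnd: "\<bar>\<Sum>k<m. a k *\<^sub>R d k\<bar> \<le> simple (n N) H" if "m \<le> N" for m
    unfolding sum_d[OF that] abs_simple by (rule simple_mono) (rule le[OF that])
  have "inf (simple (n N) H) e = simple (n N) (\<lambda>A. min (H A) 1)"
    using simple_const[of "n N" 1] inf_simple[of "n N" H "\<lambda>_. 1"] by simp
  then have "\<phi> (inf (simple (n N) H) e) = (\<Sum>A\<in>Pow {..<n N}. \<phi> (atom (n N) A) * min (H A) 1)"
    by (simp only: phi_simple)
  also have "\<dots> \<le> c * (\<Sum>A\<in>Pow {..<n N}. \<phi> (atom (n N) A))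
      + 2 * 1 / c * (\<Sum>A\<in>Pow {..<n N}. \<phi> (atom (n N) A) * \<bar>\<Sum>k<N. a k * G k A\<bar>)"
  proof (rule martingale_maximal_truncated_mean[where R="\<lambda>k A B. A \<inter> {..<n k} = B \<inter> {..<n k}"
        and d="\<lambda>k A. a k * G k A" and N=N])
    show "(\<Sum>A\<in>Pow {..<n N}. \<phi> (atom (n N) A) * (a k * G k A) * h A) = 0"
      if "k < N" "\<And>A B. A \<inter> {..<n k} = B \<inter> {..<n k} \<Longrightarrow> h A = h B" for k h
      using that by (rule martingale_hyps(1))
    show "a l * G l A = a l * G l B" if "A \<inter> {..<n k} = B \<inter> {..<n k}" "l < k" for k l A B
      using that by (rule martingale_hyps(2))
    show "\<exists>m\<le>N. c \<le> \<bar>\<Sum>k<m. a k * G k A\<bar>" if "c \<le> H A" for A using H[of A] that by metis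
  qed (use c phi_atom_nonneg in auto)
  also have "(\<Sum>A\<in>Pow {..<n N}. \<phi> (atom (n N) A) * \<bar>\<Sum>k<N. a k * G k A\<bar>) = \<phi> \<bar>\<Sum>k<N. a k *\<^sub>R d k\<bar>"
    by (simp only: sum_d[OF order_refl] abs_simple phi_simple)
  finally have "\<phi> (inf (simple (n N) H) e) \<le> c * \<phi> e + 2 / c * \<phi> \<bar>\<Sum>k<N. a k *\<^sub>R d k\<bar>"
    by (simp only: phi_e mult_1_right)
  then show ?thesis using bnd by (intro exI[of _ "simple (n N) H"]) simp
qed

end

section \<open>A criterion for unbounded order convergence\<close>

text \<open>The truncated deviations are dominated by their tail suprema \<open>w\<close>, and the
  question is whether these have infimum \<open>0\<close>. By \<open>max\<close> a positive lower
  bound is disjoint from \<open>e\<close>; by \<open>band\<close> it is then disjoint from all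
  deviations, hence from \<open>w 0\<close>, which lies above it. So one test element
  \<open>e\<close> replaces all truncations \<open>u\<close>.\<close>

lemma uo_converges_of_maximal:
  fixes z :: "nat \<Rightarrow> 'a::banach_lattice"
  assumes oc: "order_continuous TYPE('a)" and e: "0 \<le> e"
    and max: "\<And>\<epsilon>. \<epsilon> > 0 \<Longrightarrow> \<exists>N. \<forall>M\<ge>N. \<exists>h. (\<forall>m. N \<le> m \<longrightarrow> m \<le> M \<longrightarrow> \<bar>z m - v\<bar> \<le> h) \<and> norm (inf h e) \<le> \<epsilon>"
    and band: "\<And>w m. 0 \<le> w \<Longrightarrow> inf w e = 0 \<Longrightarrow> inf w \<bar>z m - v\<bar> = 0"
  shows "uo_converges UNIV (\<le>) z v"
  unfolding uo_converges_def
proof (intro allI impI)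
  fix u :: 'a assume u: "0 \<le> u"
  define g where "g m = inf \<bar>z m - v\<bar> u" for m
  have g: "0 \<le> g m" "g m \<le> u" for m using u by (auto simp: g_def)
  obtain w where "\<forall>n. run_sup g n \<longlonglongrightarrow> w n \<and> (\<forall>m\<ge>n. g m \<le> w n) \<and>
      (\<forall>b. (\<forall>m\<ge>n. g m \<le> b) \<longrightarrow> w n \<le> b)"
    using order_continuous_tail_sup[where g=g, OF oc g(2)] by blast
  then have w: "run_sup g n \<longlonglongrightarrow> w n" "n \<le> m \<Longrightarrow> g m \<le> w n" "(\<forall>m\<ge>n. g m \<le> b) \<Longrightarrow> w n \<le> b" for n m b
    by auto
  have w0: "0 \<le> w n" for n using order_trans[OF g(1) w(2)[OF order_refl]] .
  have dec: "net_decreases_to UNIV (\<le>) w 0"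
    unfolding net_decreases_to_def directed_set_def
  proof (intro conjI ballI allI impI)
    show "\<exists>c\<in>UNIV. a \<le> c \<and> b \<le> c" for a b :: nat by (intro bexI[of _ "max a b"]) auto
    show "w b \<le> w a" if "a \<le> b" for a b using w(2)[of a] that by (intro w(3)) simp
    fix x assume x: "\<forall>n\<in>UNIV. x \<le> w n"
    define x' where "x' = sup x 0"
    have x': "0 \<le> x'" "x' \<le> w n" for n using x w0 by (auto simp: x'_def)
    \<comment> \<open>On every window after \<open>N\<close> the supremum is below some
      \<open>h\<close> with small truncation; the bound passes to the tail supremum
      \<open>w N\<close>, which dominates \<open>x'\<close>.\<close>
    have "norm (inf x' e) \<le> \<epsilon>" if \<epsilon>: "\<epsilon> > 0" for \<epsilon>
    proof -
      obtain N where N: "\<And>M. M \<ge> N \<Longrightarrow> \<exists>h. (\<forall>m. N \<le> m \<longrightarrow> m \<le> M \<longrightarrow> \<bar>z m - v\<bar> \<le> h) \<and> norm (inf h e) \<le> \<epsilon>"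
        using max[OF \<epsilon>] by blast
      have "norm (inf (run_sup g N k) e) \<le> \<epsilon>" for k
      proof -
        obtain h where h: "\<And>m. N \<le> m \<Longrightarrow> m \<le> N + k \<Longrightarrow> \<bar>z m - v\<bar> \<le> h" "norm (inf h e) \<le> \<epsilon>"
          using N[of "N + k"] by auto
        have "run_sup g N k \<le> h" by (rule run_sup_le) (use h(1) in \<open>auto simp: g_def intro: le_infI1\<close>)
        moreover have "0 \<le> run_sup g N k" using order_trans[OF g(1) le_run_sup[of 0 k g N]] by simp
        ultimately have "\<bar>inf (run_sup g N k) e\<bar> \<le> inf h e"
          using e by (simp add: le_infI1)
        then show ?thesis using norm_le_of_abs_le h(2) order_trans by blast
      qed
      moreover have "(\<lambda>k. norm (inf (run_sup g N k) e)) \<longlonglongrightarrow> norm (inf (w N) e)"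
        by (intro tendsto_norm tendsto_inf_banach_lattice w tendsto_const)
      ultimately have "norm (inf (w N) e) \<le> \<epsilon>" by (intro LIMSEQ_le_const2) auto
      moreover have "norm (inf x' e) \<le> norm (inf (w N) e)"
      proof (rule norm_le_of_abs_le)
        have "inf x' e \<le> inf (w N) e" by (rule inf_mono[OF x'(2) order_refl])
        then show "\<bar>inf x' e\<bar> \<le> inf (w N) e" using x'(1) e by simp
      qed
      ultimately show ?thesis by simp
    qed
    then have "norm (inf x' e) \<le> 0" by (rule field_le_epsilon[of _ 0, simplified])
    then have xe: "inf x' e = 0" by simp
    \<comment> \<open>Disjointness from each deviation passes to finite suprema, since these lie
      below the sums, and then to their norm limit.\<close>
    have "inf (w 0) x' \<le> 0"
    proof (rule tendsto_le_banach_lattice)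
      show "(\<lambda>k. inf (run_sup g 0 k) x') \<longlonglongrightarrow> inf (w 0) x'"
        by (intro tendsto_inf_banach_lattice w tendsto_const)
      fix k
      have "inf (run_sup g 0 k) x' \<le> inf (\<Sum>j\<le>k. g (0 + j)) x'"
        by (intro inf_mono run_sup_le_sum g order_refl)
      also have "\<dots> = 0"
      proof (rule inf_sum_eq_0)
        show "inf (g (0 + j)) x' = 0" for j
          by (rule inf_eq_0_mono[of "\<bar>z j - v\<bar>" x'])
            (use band[OF x'(1) xe, of j] x'(1) g in \<open>auto simp: inf.commute g_def\<close>)
      qed (use g x' in auto)
      finally show "inf (run_sup g 0 k) x' \<le> 0" .
    qed
    moreover have "inf (w 0) x' = x'" using x'(2) by (rule inf_absorb2)
    moreover have "x \<le> x'" by (simp add: x'_def)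
    ultimately show "x \<le> 0" by (metis order_trans)
  qed (use w0 in auto)
  show "order_converges UNIV (\<le>) (\<lambda>m. inf \<bar>z m - v\<bar> u) 0"
  proof (rule order_convergesI[OF dec])
    fix k :: nat
    have "\<bar>g m - 0\<bar> \<le> w k" if "k \<le> m" for m using w(2)[OF that] g(1)[of m] by simp
    then show "\<exists>m\<^sub>0\<in>UNIV. \<forall>m\<in>UNIV. m\<^sub>0 \<le> m \<longrightarrow> \<bar>inf \<bar>z m - v\<bar> u - 0\<bar> \<le> w k"
      unfolding g_def by blast
  qed
qed

section \<open>Almost disjoint sequences\<close>

lemma nonneg_series_bounds:
  fixes f :: "nat \<Rightarrow> 'a::banach_lattice"
  assumes f: "summable f" "\<And>k. 0 \<le> f k"
  shows "f k \<le> suminf f" "0 \<le> suminf f"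
proof -
  have lim: "(\<lambda>n. sum f {..<n}) \<longlonglongrightarrow> suminf f" by (rule summable_LIMSEQ[OF f(1)])
  show "f k \<le> suminf f"
  proof (rule le_of_tendsto_banach_lattice[OF lim])
    show "f k \<le> sum f {..<n}" if "Suc k \<le> n" for n
      using sum_mono2[of "{..<n}" "{k}" f] that f(2) by simp
  qed
  show "0 \<le> suminf f"
    by (rule le_of_tendsto_banach_lattice[OF lim, of 0]) (intro sum_nonneg f(2))
qed

text \<open>The tails of the series of moduli dominate the deviations. They decrease and tend to
  \<open>0\<close> in norm, hence have infimum \<open>0\<close>.\<close>

lemma uo_converges_of_abs_summable:
  fixes b :: "nat \<Rightarrow> 'a::banach_lattice"
  assumes b: "b sums v" and abs: "summable (\<lambda>k. \<bar>b k\<bar>)"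
  shows "uo_converges UNIV (\<le>) (\<lambda>n. \<Sum>k\<le>n. b k) v"
  unfolding uo_converges_def
proof (intro allI impI)
  fix u :: 'a assume u: "0 \<le> u"
  define T where "T n = (\<Sum>k<n. \<bar>b k\<bar>)" for n
  define W where "W = (\<Sum>k. \<bar>b k\<bar>)"
  have T: "T \<longlonglongrightarrow> W" unfolding T_def W_def by (rule summable_LIMSEQ[OF abs])
  have S: "(\<lambda>n. \<Sum>k<n. b k) \<longlonglongrightarrow> v" using b by (simp add: sums_def)
  have Tmono: "T m \<le> T n" if "m \<le> n" for m n
    unfolding T_def by (rule sum_mono2) (use that in auto)
  have TW: "T m \<le> W" for m by (rule le_of_tendsto_banach_lattice[OF T Tmono])
  have tail: "\<bar>v - (\<Sum>k<m. b k)\<bar> \<le> W - T m" for m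
  proof -
    have "0 \<le> W - T m - \<bar>v - (\<Sum>k<m. b k)\<bar>"
    proof (rule le_of_tendsto_banach_lattice)
      show "(\<lambda>n. T n - T m - \<bar>(\<Sum>k<n. b k) - (\<Sum>k<m. b k)\<bar>) \<longlonglongrightarrow> W - T m - \<bar>v - (\<Sum>k<m. b k)\<bar>"
        by (intro tendsto_diff tendsto_abs_banach_lattice T S tendsto_const)
      fix n assume mn: "m \<le> n"
      have "(\<Sum>k<n. b k) - (\<Sum>k<m. b k) = (\<Sum>k\<in>{..<n} - {..<m}. b k)"
        by (rule sum_diff[symmetric]) (use mn in auto)
      moreover have "T n - T m = (\<Sum>k\<in>{..<n} - {..<m}. \<bar>b k\<bar>)"
        unfolding T_def by (rule sum_diff[symmetric]) (use mn in auto)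
      ultimately show "0 \<le> T n - T m - \<bar>(\<Sum>k<n. b k) - (\<Sum>k<m. b k)\<bar>" by (simp add: sum_abs)
    qed
    then show ?thesis by simp
  qed
  define w where "w m = W - T m" for m
  have dec: "net_decreases_to UNIV (\<le>) w 0"
    unfolding net_decreases_to_def directed_set_def
  proof (intro conjI ballI allI impI)
    show "\<exists>c\<in>UNIV. a \<le> c \<and> b \<le> c" for a b :: nat by (intro bexI[of _ "max a b"]) auto
    show "w n \<le> w m" if "m \<le> n" for m n using Tmono[OF that] by (simp add: w_def)
    show "0 \<le> w m" for m using TW[of m] by (simp add: w_def)
    fix x assume x: "\<forall>m\<in>UNIV. x \<le> w m"
    have "(\<lambda>m. W - T m) \<longlonglongrightarrow> W - W" by (intro tendsto_diff T tendsto_const)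
    then have "w \<longlonglongrightarrow> 0" unfolding w_def by simp
    then show "x \<le> 0" by (rule le_of_tendsto_banach_lattice[where N=0]) (use x in simp)
  qed auto
  show "order_converges UNIV (\<le>) (\<lambda>m. inf \<bar>(\<Sum>k\<le>m. b k) - v\<bar> u) 0"
  proof (rule order_convergesI[OF dec])
    fix k :: nat
    have "\<bar>inf \<bar>(\<Sum>j\<le>m. b j) - v\<bar> u - 0\<bar> \<le> w k" if "k \<le> m" for m
    proof -
      have "\<bar>inf \<bar>(\<Sum>j\<le>m. b j) - v\<bar> u - 0\<bar> \<le> \<bar>v - (\<Sum>j<Suc m. b j)\<bar>"
        using u by (simp only: lessThan_Suc_atMost abs_minus_commute[of v]) simp
      also have "\<dots> \<le> W - T (Suc m)" by (rule tail)
      also have "\<dots> \<le> w k" unfolding w_def using Tmono[of k "Suc m"] that by simp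
      finally show ?thesis .
    qed
    then show "\<exists>m\<^sub>0\<in>UNIV. \<forall>m\<in>UNIV. m\<^sub>0 \<le> m \<longrightarrow> \<bar>inf \<bar>(\<Sum>j\<le>m. b j) - v\<bar> u - 0\<bar> \<le> w k" by blast
  qed
qed

text \<open>Cutting the truncations by \<open>s k\<close> off both parts of \<open>x k\<close>
  leaves modulus at most \<open>\<bar>x k\<bar> - inf \<bar>x k\<bar> \<bar>x j\<bar>\<close> for
  every other \<open>j\<close>. For a pair \<open>j\<close>, \<open>k\<close> these two bounds are
  disjoint, because a common infimum has been subtracted.\<close>

lemma disjointify:
  fixes x s :: "nat \<Rightarrow> 'a::banach_lattice"
  assumes s: "\<And>k. 0 \<le> s k" "\<And>j k. j \<noteq> k \<Longrightarrow> inf \<bar>x k\<bar> \<bar>x j\<bar> \<le> s k"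
  obtains d where "\<And>j k. j \<noteq> k \<Longrightarrow> inf \<bar>d k\<bar> \<bar>d j\<bar> = 0" "\<And>k. \<bar>x k - d k\<bar> \<le> s k"
proof
  define P where "P k = pprt (x k)" for k
  define Q where "Q k = - nprt (x k)" for k
  have PQ: "0 \<le> P k" "0 \<le> Q k" "x k = P k - Q k" "\<bar>x k\<bar> = P k + Q k" for k
    using prts[of "x k"] abs_prts[of "x k"] by (simp_all add: P_def Q_def)
  have disj: "inf (P k) (Q k) = 0" for k
    unfolding inf_eq_half_diff_abs PQ(3)[symmetric] PQ(4) by simp
  define d where "d k = (P k - inf (P k) (s k)) - (Q k - inf (Q k) (s k))" for k
  have dle: "\<bar>d k\<bar> \<le> \<bar>x k\<bar> - inf \<bar>x k\<bar> \<bar>x j\<bar>" if "j \<noteq> k" for j k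
  proof -
    have "\<bar>d k\<bar> \<le> \<bar>P k - inf (P k) (s k)\<bar> + \<bar>Q k - inf (Q k) (s k)\<bar>"
      unfolding d_def by (rule abs_triangle_ineq4)
    also have "\<dots> = (P k - inf (P k) (s k)) + (Q k - inf (Q k) (s k))"
      by (subst (1 2) abs_of_nonneg) (simp_all only: diff_ge_0_iff_ge inf_le1)
    also have "\<dots> = (P k + Q k) - (inf (P k) (s k) + inf (Q k) (s k))" by (rule add_diff_add[symmetric])
    also have "inf (P k) (s k) + inf (Q k) (s k) = inf (P k + Q k) (s k)"
      by (rule inf_add_of_disjoint[symmetric]) (use PQ s disj in auto)
    also have "(P k + Q k) - inf (P k + Q k) (s k) = \<bar>x k\<bar> - inf \<bar>x k\<bar> (s k)" unfolding PQ(4) ..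
    also have "\<dots> \<le> \<bar>x k\<bar> - inf \<bar>x k\<bar> \<bar>x j\<bar>"
      using s(2)[OF that] by (intro diff_left_mono) simp
    finally show ?thesis .
  qed
  show "inf \<bar>d k\<bar> \<bar>d j\<bar> = 0" if jk: "j \<noteq> k" for j k
  proof (rule inf_eq_0_mono)
    let ?i = "inf \<bar>x k\<bar> \<bar>x j\<bar>"
    have "inf (\<bar>x k\<bar> - ?i) (\<bar>x j\<bar> - ?i) = ?i + (- ?i)"
      by (simp only: add_inf_distrib_right diff_conv_add_uminus)
    then show "inf (\<bar>x k\<bar> - ?i) (\<bar>x j\<bar> - ?i) = 0" by (simp only: right_minus)
    show "\<bar>d k\<bar> \<le> \<bar>x k\<bar> - ?i" by (rule dle[OF jk])
    show "\<bar>d j\<bar> \<le> \<bar>x j\<bar> - ?i" using dle[of k j] jk by (simp add: inf.commute)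
  qed auto
  show "\<bar>x k - d k\<bar> \<le> s k" for k
  proof -
    have "x k - d k = inf (P k) (s k) - inf (Q k) (s k)" by (simp add: d_def PQ(3))
    moreover have "0 \<le> inf (P k) (s k)" "0 \<le> inf (Q k) (s k)" using PQ s by auto
    then have "\<bar>inf (P k) (s k) - inf (Q k) (s k)\<bar> \<le> s k"
      by (intro abs_diff_le_of_nonneg) auto
    ultimately show ?thesis by simp
  qed
qed

lemma geometric_tail_le:
  "(\<Sum>k<N. if M \<le> k then (1/2::real) ^ Suc k else 0) \<le> (1/2) ^ M"
proof (cases "M \<le> N")
  case True
  then have "(\<Sum>k<N. if M \<le> k then (1/2::real) ^ Suc k else 0) = (1/2) ^ M - (1/2) ^ N"
  proof (induction N rule: dec_induct)
    case base
    have "(\<Sum>k<M. if M \<le> k then (1/2::real) ^ Suc k else 0) = 0" by (intro sum.neutral) auto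
    then show ?case by simp
  qed simp
  then show ?thesis by simp
next
  case False
  then have "(\<Sum>k<N. if M \<le> k then (1/2::real) ^ Suc k else 0) = 0" by (intro sum.neutral) auto
  then show ?thesis by simp
qed

lemma perturbation_norm_le:
  fixes x d :: "nat \<Rightarrow> 'a::real_normed_vector"
  assumes xd: "\<And>k. norm (x k - d k) \<le> \<epsilon> k" and A: "finite A" and a: "\<And>k. k \<in> A \<Longrightarrow> \<bar>a k\<bar> \<le> \<alpha>" and \<alpha>: "0 \<le> \<alpha>"
  shows "norm ((\<Sum>k\<in>A. a k *\<^sub>R x k) - (\<Sum>k\<in>A. a k *\<^sub>R d k)) \<le> \<alpha> * (\<Sum>k\<in>A. \<epsilon> k)"
proof -
  have "(\<Sum>k\<in>A. a k *\<^sub>R x k) - (\<Sum>k\<in>A. a k *\<^sub>R d k) = (\<Sum>k\<in>A. a k *\<^sub>R (x k - d k))"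
    by (simp add: sum_subtractf scaleR_right_diff_distrib)
  also have "norm \<dots> \<le> (\<Sum>k\<in>A. norm (a k *\<^sub>R (x k - d k)))" by (rule norm_sum)
  also have "\<dots> \<le> (\<Sum>k\<in>A. \<alpha> * \<epsilon> k)"
    by (rule sum_mono) (use a xd \<alpha> in \<open>simp add: mult_mono\<close>)
  finally show ?thesis by (simp add: sum_distrib_left)
qed

text \<open>For the disjoint \<open>d k\<close>, deleting terms does not increase norms, and taking
  moduli of the terms does not change them. The perturbation has total size \<open>1/4\<close>,
  small enough for both facts to carry over to \<open>x\<close>, with constant
  \<open>2\<close>.\<close>

lemma almost_disjoint_unconditional_uo_bibasic:
  fixes x d :: "nat \<Rightarrow> 'a::banach_lattice"
  assumes norm1: "\<And>k. norm (x k) = 1"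
    and disj: "\<And>j k. j \<noteq> k \<Longrightarrow> inf \<bar>d k\<bar> \<bar>d j\<bar> = 0"
    and xd: "\<And>k. norm (x k - d k) \<le> 1/4 * (1/2) ^ Suc k"
  shows "unconditional_uo_bibasic x"
proof -
  define \<epsilon> where "\<epsilon> k = 1/4 * (1/2::real) ^ Suc k" for k
  have \<epsilon>s: "\<epsilon> sums (1/4)"
    unfolding \<epsilon>_def using sums_mult[OF power_half_series, of "1/4"] by simp
  have \<epsilon>0: "0 \<le> \<epsilon> k" for k by (simp add: \<epsilon>_def)
  have \<epsilon>_sum: "sum \<epsilon> A \<le> 1/4" if "finite A" for A
    using sum_le_suminf[OF sums_summable[OF \<epsilon>s] that] \<epsilon>0 sums_unique[OF \<epsilon>s] by simp
  have xd': "norm (x k - d k) \<le> \<epsilon> k" for k using xd by (simp add: \<epsilon>_def)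
  have pert: "norm ((\<Sum>k\<in>A. a k *\<^sub>R x k) - (\<Sum>k\<in>A. a k *\<^sub>R d k)) \<le> \<alpha> / 4"
    if A: "finite A" and a: "\<And>k. k \<in> A \<Longrightarrow> \<bar>a k\<bar> \<le> \<alpha>" and \<alpha>: "0 \<le> \<alpha>" for A a \<alpha>
  proof -
    have "norm ((\<Sum>k\<in>A. a k *\<^sub>R x k) - (\<Sum>k\<in>A. a k *\<^sub>R d k)) \<le> \<alpha> * sum \<epsilon> A"
      using perturbation_norm_le[of x d \<epsilon> A a \<alpha>] xd' A a \<alpha> by blast
    also have "\<dots> \<le> \<alpha> * (1/4)" by (rule mult_left_mono[OF \<epsilon>_sum[OF A] \<alpha>])
    finally show ?thesis by simp
  qed
  have abs_d: "\<bar>\<Sum>k\<in>A. a k *\<^sub>R d k\<bar> = (\<Sum>k\<in>A. \<bar>a k\<bar> *\<^sub>R \<bar>d k\<bar>)" if "finite A" for A and a :: "nat \<Rightarrow> real"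
  proof -
    have "\<bar>\<Sum>k\<in>A. a k *\<^sub>R d k\<bar> = (\<Sum>k\<in>A. \<bar>a k *\<^sub>R d k\<bar>)"
      by (rule abs_sum_of_disjoint[OF that])
        (simp add: abs_scaleR_banach_lattice inf_scaleR_eq_0 disj)
    then show ?thesis by (simp add: abs_scaleR_banach_lattice)
  qed
  have d_mono: "norm (\<Sum>k\<in>A. a k *\<^sub>R d k) \<le> norm (\<Sum>k\<in>B. a k *\<^sub>R d k)" if "A \<subseteq> B" "finite B" for A B and a :: "nat \<Rightarrow> real"
  proof -
    have "finite A" using that by (rule finite_subset)
    have "(\<Sum>k\<in>A. \<bar>a k\<bar> *\<^sub>R \<bar>d k\<bar>) \<le> (\<Sum>k\<in>B. \<bar>a k\<bar> *\<^sub>R \<bar>d k\<bar>)"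
      by (rule sum_mono2) (use that in \<open>auto simp: scaleR_nonneg_nonneg\<close>)
    then show ?thesis unfolding abs_d[OF \<open>finite A\<close>, symmetric] abs_d[OF that(2), symmetric]
      by (rule norm_mono_abs)
  qed
  have bound: "norm (\<Sum>k\<in>A. a k *\<^sub>R x k) \<le> norm (\<Sum>k<N. a k *\<^sub>R x k) + \<alpha> / 2"
    if A: "A \<subseteq> {..<N}" and a: "\<And>k. k < N \<Longrightarrow> \<bar>a k\<bar> \<le> \<alpha>" and \<alpha>: "0 \<le> \<alpha>" for A N a \<alpha>
  proof -
    have fA: "finite A" using A by (rule finite_subset) simp
    have aA: "\<bar>a k\<bar> \<le> \<alpha>" if "k \<in> A" for k using a A that by blast
    have "norm (\<Sum>k\<in>A. a k *\<^sub>R x k) \<le> norm (\<Sum>k\<in>A. a k *\<^sub>R d k) + \<alpha> / 4"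
      using pert[of A a \<alpha>, OF fA aA \<alpha>] norm_triangle_ineq2[of "\<Sum>k\<in>A. a k *\<^sub>R x k" "\<Sum>k\<in>A. a k *\<^sub>R d k"] by simp
    moreover have "norm (\<Sum>k<N. a k *\<^sub>R d k) \<le> norm (\<Sum>k<N. a k *\<^sub>R x k) + \<alpha> / 4"
      using pert[of "{..<N}" a \<alpha>] a \<alpha> norm_triangle_ineq3[of "\<Sum>k<N. a k *\<^sub>R x k" "\<Sum>k<N. a k *\<^sub>R d k"] by simp
    ultimately show ?thesis using d_mono[OF A, of a] by simp
  qed
  have su: "suppression_unconditional x 2"
  proof
    show "x k \<noteq> 0" for k using norm1[of k] by auto
    fix A :: "nat set" and N and a :: "nat \<Rightarrow> real" assume A: "A \<subseteq> {..<N}"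
    show "norm (\<Sum>k\<in>A. a k *\<^sub>R x k) \<le> 2 * norm (\<Sum>k<N. a k *\<^sub>R x k)"
    proof (cases "N = 0")
      case False
      define \<alpha> where "\<alpha> = Max ((\<lambda>k. \<bar>a k\<bar>) ` {..<N})"
      have "\<alpha> \<in> (\<lambda>k. \<bar>a k\<bar>) ` {..<N}" unfolding \<alpha>_def using False by (intro Max_in) auto
      then obtain j where j: "j < N" "\<alpha> = \<bar>a j\<bar>" by auto
      have le: "\<bar>a k\<bar> \<le> \<alpha>" if "k < N" for k unfolding \<alpha>_def using that by (intro Max_ge) auto
      \<comment> \<open>Testing on the index of the largest coefficient gives
        \<open>\<alpha>\<close> at most twice the norm of the full sum, so the additive error
        \<open>\<alpha> / 2\<close> costs one more copy of that norm.\<close>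
      have "\<alpha> \<le> norm (\<Sum>k<N. a k *\<^sub>R x k) + \<alpha> / 2"
        using bound[of "{j}" N a \<alpha>] j le norm1 by simp
      moreover have "norm (\<Sum>k\<in>A. a k *\<^sub>R x k) \<le> norm (\<Sum>k<N. a k *\<^sub>R x k) + \<alpha> / 2"
        using bound[OF A le] j by simp
      ultimately show ?thesis by simp
    qed (use A in simp)
  qed
  then interpret suppression_unconditional x 2 .
  have "uo_converges UNIV (\<le>) (\<lambda>n. \<Sum>k\<le>n. a k *\<^sub>R x k) v" if v: "(\<lambda>k. a k *\<^sub>R x k) sums v" for a v
  proof (rule uo_converges_of_abs_summable[OF v])
    obtain \<alpha> where \<alpha>: "\<alpha> \<ge> 0" "\<And>k. \<bar>a k\<bar> \<le> \<alpha>" using coeff_bounded_of_sums[OF norm1 v] by blast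
    \<comment> \<open>A block of moduli is compared with the block of moduli of the
      \<open>d k\<close>, which has the norm of the plain block of the \<open>d k\<close>, and this
      with the block of the \<open>x k\<close>. Each comparison and the last block contribute less
      than \<open>r / 3\<close>.\<close>
    show "summable (\<lambda>k. \<bar>a k *\<^sub>R x k\<bar>)"
      unfolding summable_Cauchy
    proof (intro allI impI)
      fix r :: real assume r: "r > 0"
      have "summable (\<lambda>k. a k *\<^sub>R x k)" using v by (rule sums_summable)
      then obtain N1 where N1: "\<And>m n. m \<ge> N1 \<Longrightarrow> norm (\<Sum>k=m..<n. a k *\<^sub>R x k) < r/3"
        unfolding summable_Cauchy using r by (metis divide_pos_pos zero_less_numeral)
      have "r / (3 * (\<alpha> + 1)) > 0" using r \<alpha>(1) by simp
      then obtain N2 where N2: "\<And>m n. m \<ge> N2 \<Longrightarrow> norm (\<Sum>k=m..<n. \<epsilon> k) < r / (3 * (\<alpha> + 1))"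
        using sums_summable[OF \<epsilon>s] unfolding summable_Cauchy by metis
      have "norm (\<Sum>k=m..<n. \<bar>a k *\<^sub>R x k\<bar>) < r" if m: "m \<ge> max N1 N2" for m n
      proof -
        let ?e = "\<alpha> * (\<Sum>k=m..<n. \<epsilon> k)"
        have "(\<alpha> + 1) * (\<Sum>k=m..<n. \<epsilon> k) < r / 3"
        proof -
          have "(\<Sum>k=m..<n. \<epsilon> k) < r / (3 * (\<alpha> + 1))" using N2[of m n] m by simp
          then show ?thesis using \<alpha>(1) by (simp add: field_simps)
        qed
        moreover have "0 \<le> (\<Sum>k=m..<n. \<epsilon> k)" by (intro sum_nonneg \<epsilon>0)
        ultimately have e: "?e < r / 3" by (simp add: algebra_simps)
        have p: "norm ((\<Sum>k=m..<n. c k *\<^sub>R x' k) - (\<Sum>k=m..<n. c k *\<^sub>R d' k)) \<le> ?e"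
          if "\<And>k. norm (x' k - d' k) \<le> \<epsilon> k" "\<And>k. \<bar>c k\<bar> \<le> \<alpha>" for x' d' :: "nat \<Rightarrow> 'a" and c
          by (rule perturbation_norm_le) (use that \<alpha>(1) in auto)
        have "norm (\<bar>x k\<bar> - \<bar>d k\<bar>) \<le> \<epsilon> k" for k
          using norm_mono_abs[OF abs_triangle_ineq3[of "x k" "d k"]] xd'[of k] by simp
        then have "norm ((\<Sum>k=m..<n. \<bar>a k\<bar> *\<^sub>R \<bar>x k\<bar>) - (\<Sum>k=m..<n. \<bar>a k\<bar> *\<^sub>R \<bar>d k\<bar>)) \<le> ?e"
          using p[of "\<lambda>k. \<bar>x k\<bar>" "\<lambda>k. \<bar>d k\<bar>" "\<lambda>k. \<bar>a k\<bar>"] \<alpha>(2) by simp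
        moreover have "norm (\<Sum>k=m..<n. \<bar>a k\<bar> *\<^sub>R \<bar>d k\<bar>) = norm (\<Sum>k=m..<n. a k *\<^sub>R d k)"
          using abs_d[of "{m..<n}" a] by (metis finite_atLeastLessThan norm_abs_banach_lattice)
        moreover have "norm ((\<Sum>k=m..<n. a k *\<^sub>R x k) - (\<Sum>k=m..<n. a k *\<^sub>R d k)) \<le> ?e"
          by (rule p) (use xd' \<alpha>(2) in auto)
        moreover have "norm (\<Sum>k=m..<n. a k *\<^sub>R x k) < r / 3" using N1 m by simp
        ultimately have "norm (\<Sum>k=m..<n. \<bar>a k\<bar> *\<^sub>R \<bar>x k\<bar>) < r"
          using e norm_triangle_ineq2[of "\<Sum>k=m..<n. \<bar>a k\<bar> *\<^sub>R \<bar>x k\<bar>" "\<Sum>k=m..<n. \<bar>a k\<bar> *\<^sub>R \<bar>d k\<bar>"]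
            norm_triangle_ineq3[of "\<Sum>k=m..<n. a k *\<^sub>R x k" "\<Sum>k=m..<n. a k *\<^sub>R d k"] by linarith
        then show ?thesis by (simp add: abs_scaleR_banach_lattice)
      qed
      then show "\<exists>N. \<forall>m\<ge>N. \<forall>n. norm (\<Sum>k=m..<n. \<bar>a k *\<^sub>R x k\<bar>) < r" by blast
    qed
  qed
  then show ?thesis
    unfolding unconditional_uo_bibasic_def uo_bibasic_def
    using schauder_basic unconditional_basic by blast
qed

text \<open>A gliding hump argument: the sum of the moduli chosen so far is below a multiple of
  \<open>e\<close>, so a new vector with tiny \<open>inf \<bar>x\<bar> e\<close> is almost disjoint
  from all previous ones.\<close>

lemma exists_almost_disjoint:
  fixes V :: "'a::banach_lattice set"
  assumes e: "0 \<le> e" and bounded: "\<And>x. x \<in> V \<Longrightarrow> \<exists>m\<ge>0. \<bar>x\<bar> \<le> m *\<^sub>R e"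
    and small: "\<And>\<epsilon>. \<epsilon> > 0 \<Longrightarrow> \<exists>x\<in>V. norm x = 1 \<and> norm (inf \<bar>x\<bar> e) < \<epsilon>"
  shows "\<exists>x. range x \<subseteq> V \<and> unconditional_uo_bibasic x"
proof -
  define P :: "nat \<Rightarrow> 'a \<times> 'a \<Rightarrow> bool" where
    "P k s \<longleftrightarrow> snd s \<in> V \<and> norm (snd s) = 1 \<and> \<bar>snd s\<bar> \<le> fst s \<and> (\<exists>m\<ge>0. fst s \<le> m *\<^sub>R e)" for k s
  define Q :: "nat \<Rightarrow> 'a \<times> 'a \<Rightarrow> 'a \<times> 'a \<Rightarrow> bool" where
    "Q k s s' \<longleftrightarrow> fst s' = fst s + \<bar>snd s'\<bar> \<and> norm (inf \<bar>snd s'\<bar> (fst s)) \<le> 1/16 * (1/4) ^ Suc k" for k s s'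
  have "\<exists>s. \<forall>k. P k (s k) \<and> Q k (s k) (s (Suc k))"
  proof (rule dependent_nat_choice)
    obtain x where x: "x \<in> V" "norm x = 1" using small[of 1] by auto
    then have "P 0 (\<bar>x\<bar>, x)" using bounded by (simp add: P_def)
    then show "\<exists>s. P 0 s" ..
  next
    fix s k assume "P k s"
    then obtain m where s: "\<bar>snd s\<bar> \<le> fst s" "m \<ge> 0" "fst s \<le> m *\<^sub>R e" unfolding P_def by blast
    have s0: "0 \<le> fst s" using order_trans[OF abs_ge_zero s(1)] .
    \<comment> \<open>With \<open>fst s \<le> m *\<^sub>R e\<close>, the overlap with the past is at
      most \<open>m + 1\<close> times the overlap with \<open>e\<close>. Using \<open>m + 1\<close>
      also covers \<open>m < 1\<close>, where \<open>\<bar>x\<bar>\<close> would exceed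
      \<open>m *\<^sub>R \<bar>x\<bar>\<close>.\<close>
    define c where "c = 1/16 * (1/4::real) ^ Suc k / (m + 1)"
    have c: "c > 0" "(m + 1) * c = 1/16 * (1/4) ^ Suc k" proof -
    have m: "m + 1 > 0" using s(2) by simp
    then show "c > 0" by (simp add: c_def)
    show "(m + 1) * c = 1/16 * (1/4) ^ Suc k"
      unfolding c_def times_divide_eq_right using m by (intro nonzero_mult_div_cancel_left) simp
  qed
    obtain x where x: "x \<in> V" "norm x = 1" "norm (inf \<bar>x\<bar> e) < c" using small[OF c(1)] by blast
    obtain m' where m': "m' \<ge> 0" "\<bar>x\<bar> \<le> m' *\<^sub>R e" using bounded[OF x(1)] by blast
    have "\<bar>inf \<bar>x\<bar> (fst s)\<bar> \<le> (m + 1) *\<^sub>R inf \<bar>x\<bar> e"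
    proof -
      have "\<bar>x\<bar> \<le> (m + 1) *\<^sub>R \<bar>x\<bar>" using scaleR_right_mono[of 1 "m + 1" "\<bar>x\<bar>"] s(2) by simp
      moreover have "fst s \<le> (m + 1) *\<^sub>R e"
        by (rule order_trans[OF s(3) scaleR_right_mono[OF _ e]]) simp
      ultimately have "inf \<bar>x\<bar> (fst s) \<le> inf ((m + 1) *\<^sub>R \<bar>x\<bar>) ((m + 1) *\<^sub>R e)" by (rule inf_mono)
      also have "\<dots> = (m + 1) *\<^sub>R inf \<bar>x\<bar> e" using s(2) by (intro inf_scaleR) simp
      finally show ?thesis using s0 by simp
    qed
    then have "norm (inf \<bar>x\<bar> (fst s)) \<le> norm ((m + 1) *\<^sub>R inf \<bar>x\<bar> e)" by (rule norm_le_of_abs_le)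
    also have "\<dots> = (m + 1) * norm (inf \<bar>x\<bar> e)" using s(2) by simp
    also have "\<dots> \<le> (m + 1) * c" using x(3) s(2) by (intro mult_left_mono) auto
    finally have "Q k s (fst s + \<bar>x\<bar>, x)" using c(2) by (simp add: Q_def)
    moreover have "fst s + \<bar>x\<bar> \<le> (m + m') *\<^sub>R e" using add_mono[OF s(3) m'(2)] by (simp add: scaleR_left_distrib)
    then have "P (Suc k) (fst s + \<bar>x\<bar>, x)" using x s0 s(2) m'(1) by (auto simp: P_def intro!: exI[of _ "m + m'"])
    ultimately show "\<exists>s'. P (Suc k) s' \<and> Q k s s'" by blast
  qed
  then obtain s where s: "\<And>k. P k (s k)" "\<And>k. Q k (s k) (s (Suc k))" by blast
  define x where "x k = snd (s k)" for k
  define U where "U k = fst (s k)" for k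
  have x: "x k \<in> V" "norm (x k) = 1" "\<bar>x k\<bar> \<le> U k" for k
    using s(1)[of k] by (auto simp: P_def x_def U_def)
  have U: "U (Suc k) = U k + \<bar>x (Suc k)\<bar>" "norm (inf \<bar>x (Suc k)\<bar> (U k)) \<le> 1/16 * (1/4) ^ Suc k" for k
    using s(2)[of k] by (auto simp: Q_def x_def U_def)
  have Umono: "U j \<le> U k" if "j \<le> k" for j k
    by (rule lift_Suc_mono_le[OF _ that]) (simp add: U)
  \<comment> \<open>The power of \<open>1/4\<close> is split into a product symmetric in
    \<open>j\<close> and \<open>k\<close>. All overlaps of \<open>x k\<close> then sum to at most
    \<open>1/8 * (1/2) ^ k\<close>, which is exactly the tolerance
    \<open>1/4 * (1/2) ^ Suc k\<close> needed below.\<close>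
  have lt: "norm (inf \<bar>x k\<bar> \<bar>x j\<bar>) \<le> 1/16 * ((1/2) ^ k * (1/2) ^ j)" if jk: "j < k" for j k
  proof -
    obtain l where l: "k = Suc l" using jk by (cases k) auto
    have "inf \<bar>x k\<bar> \<bar>x j\<bar> \<le> inf \<bar>x k\<bar> (U l)"
      using order_trans[OF x(3) Umono[of j l]] jk l by (intro inf_mono) auto
    then have "norm (inf \<bar>x k\<bar> \<bar>x j\<bar>) \<le> norm (inf \<bar>x k\<bar> (U l))" by (intro norm_le_of_abs_le) simp
    also have "\<dots> \<le> 1/16 * (1/4) ^ k" using U(2)[of l] by (simp add: l)
    also have "(1/4::real) ^ k = (1/2) ^ k * (1/2) ^ k" by (simp add: power_mult_distrib[symmetric])
    also have "1/16 * ((1/2) ^ k * (1/2) ^ k) \<le> 1/16 * ((1/2) ^ k * (1/2::real) ^ j)"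
      using jk by (intro mult_left_mono power_decreasing) auto
    finally show ?thesis .
  qed
  define f where "f k j = (if j = k then 0 else inf \<bar>x k\<bar> \<bar>x j\<bar>)" for k j
  have f0: "0 \<le> f k j" for k j by (simp add: f_def)
  have fn: "norm (f k j) \<le> 1/8 * (1/2) ^ k * (1/2) ^ Suc j" for k j
    using lt[of j k] lt[of k j] by (cases j k rule: linorder_cases) (auto simp: f_def inf.commute mult.commute)
  have gs: "(\<lambda>j. 1/8 * (1/2) ^ k * (1/2::real) ^ Suc j) sums (1/8 * (1/2) ^ k)" for k
    using sums_mult[OF power_half_series, of "1/8 * (1/2) ^ k"] by simp
  have fns: "summable (\<lambda>j. norm (f k j))" for k
    by (rule summable_comparison_test'[OF sums_summable[OF gs[of k]], of 0]) (use fn in simp)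
  have fs: "summable (f k)" for k by (rule summable_norm_cancel[OF fns])
  have sn: "norm (suminf (f k)) \<le> 1/4 * (1/2) ^ Suc k" for k
  proof -
    have "norm (suminf (f k)) \<le> (\<Sum>j. norm (f k j))" by (rule summable_norm[OF fns])
    also have "\<dots> \<le> (\<Sum>j. 1/8 * (1/2) ^ k * (1/2) ^ Suc j)"
      by (rule suminf_le[OF fn fns sums_summable[OF gs]])
    also have "\<dots> = 1/8 * (1/2) ^ k" by (rule sums_unique[OF gs, symmetric])
    finally show ?thesis by simp
  qed
  have "inf \<bar>x k\<bar> \<bar>x j\<bar> \<le> suminf (f k)" if "j \<noteq> k" for j k
  proof -
    have "f k j = inf \<bar>x k\<bar> \<bar>x j\<bar>" using that by (simp add: f_def)
    then show ?thesis using nonneg_series_bounds(1)[OF fs[of k] f0[of k], of j] by simp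
  qed
  then obtain d where d: "\<And>j k. j \<noteq> k \<Longrightarrow> inf \<bar>d k\<bar> \<bar>d j\<bar> = 0" "\<And>k. \<bar>x k - d k\<bar> \<le> suminf (f k)"
    using disjointify[of "\<lambda>k. suminf (f k)" x] nonneg_series_bounds(2)[OF fs f0] by metis
  have "norm (x k - d k) \<le> 1/4 * (1/2) ^ Suc k" for k
    using norm_le_of_abs_le[OF d(2)[of k]] sn[of k] by linarith
  then have "unconditional_uo_bibasic x"
    by (intro almost_disjoint_unconditional_uo_bibasic[of x d] x d(1))
  then show ?thesis using x(1) by blast
qed

section \<open>Strongly embedded subspaces\<close>

lemma exists_mean_zero_sequence:
  fixes e :: "'a::banach_lattice"
  assumes cf: "component_functional e p \<phi>"
    and V: "subspace V" "infinite_dimensional V" "V \<subseteq> component_sequence.approximable e p"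
    and bounded: "\<And>x. x \<in> V \<Longrightarrow> \<exists>m\<ge>0. \<bar>x\<bar> \<le> m *\<^sub>R e" and \<epsilon>: "\<And>k. \<epsilon> k > 0"
  obtains y n G where "mean_zero_sequence e p \<phi> n G" "\<And>k. y k \<in> V" "\<And>k. norm (y k) = 1"
    "\<And>k. \<bar>y k - mean_zero_sequence.d e p n G k\<bar> \<le> \<epsilon> k *\<^sub>R e"
proof -
  interpret component_functional e p \<phi> by (rule cf)
  define step where "step n r s \<longleftrightarrow> (case s of (m, y, G) \<Rightarrow>
      y \<in> V \<and> norm y = 1 \<and> n \<le> m \<and> level_measurable m G \<and> \<bar>y - simple m G\<bar> \<le> r *\<^sub>R e \<and>
      (\<forall>A\<in>Pow {..<n}. (\<Sum>B\<in>{B\<in>Pow {..<m}. B \<inter> {..<n} = A}. \<phi> (atom m B) * G B) = 0))"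
    for n :: nat and r :: real and s :: "nat \<times> 'a \<times> (nat set \<Rightarrow> real)"
  have ex: "\<exists>s. step n r s" if r: "r > 0" for n r
  proof -
    obtain y m G where "y \<in> V \<and> norm y = 1 \<and> n \<le> m \<and> level_measurable m G \<and> \<bar>y - simple m G\<bar> \<le> r *\<^sub>R e \<and>
      (\<forall>A\<in>Pow {..<n}. (\<Sum>B\<in>{B\<in>Pow {..<m}. B \<inter> {..<n} = A}. \<phi> (atom m B) * G B) = 0)"
      using mean_zero_step[OF V bounded r] by blast
    then have "step n r (m, y, G)" unfolding step_def by simp
    then show ?thesis ..
  qed
  have "\<exists>s. \<forall>k. (k = 0 \<longrightarrow> step 0 (\<epsilon> 0) (s k)) \<and> step (fst (s k)) (\<epsilon> (Suc k)) (s (Suc k))"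
    by (rule dependent_nat_choice) (use ex \<epsilon> in auto)
  then obtain s where s0: "step 0 (\<epsilon> 0) (s 0)" and s1: "\<And>k. step (fst (s k)) (\<epsilon> (Suc k)) (s (Suc k))" by blast
  \<comment> \<open>Step \<open>k\<close> starts from level \<open>n k\<close> and ends at
    \<open>n (Suc k)\<close>, the level stored in the state \<open>s k\<close>; hence the shift by
    one.\<close>
  define n where "n k = (case k of 0 \<Rightarrow> 0 | Suc j \<Rightarrow> fst (s j))" for k
  define y where "y k = fst (snd (s k))" for k
  define G where "G k = snd (snd (s k))" for k
  have "step (n k) (\<epsilon> k) (s k)" for k using s0 s1 by (cases k) (auto simp: n_def)
  moreover have "s k = (n (Suc k), y k, G k)" for k by (simp add: n_def y_def G_def)
  ultimately have st: "step (n k) (\<epsilon> k) (n (Suc k), y k, G k)" for k by metis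
  interpret M: mean_zero_sequence e p \<phi> n G
  proof
    show "n 0 = 0" by (simp add: n_def)
  qed (use st in \<open>simp_all add: step_def\<close>)
  show ?thesis
  proof (rule that[OF M.mean_zero_sequence_axioms])
    show "\<bar>y k - M.d k\<bar> \<le> \<epsilon> k *\<^sub>R e" for k using st[of k] by (simp add: step_def M.d_def)
  qed (use st in \<open>simp_all add: step_def\<close>)
qed

text \<open>\<open>below\<close> makes a truncated mean control the norm on \<open>V\<close>.
  \<open>C\<close> is the factor \<open>2 * t / c\<close> of the weak type estimate when
  \<open>t\<close> is a norm \<open>r\<close> and
  \<open>c = \<eta> * r / (4 * (\<phi> e + 1))\<close>; \<open>\<kappa>\<close> is chosen so that
  the perturbation, even multiplied by \<open>C + 1\<close>, stays below
  \<open>\<eta> / 4\<close>.\<close>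

locale perturbed_mean_zero_sequence = mean_zero_sequence e p \<phi> n G
  for e :: "'a::banach_lattice" and p \<phi> n G +
  fixes y :: "nat \<Rightarrow> 'a" and V :: "'a set" and \<eta> \<kappa> C :: real
  assumes V: "subspace V" and bounded: "\<And>x. x \<in> V \<Longrightarrow> \<exists>m\<ge>0. \<bar>x\<bar> \<le> m *\<^sub>R e"
    and \<eta>: "\<eta> > 0" and below: "\<And>x. x \<in> V \<Longrightarrow> norm x = 1 \<Longrightarrow> \<eta> \<le> \<phi> (inf \<bar>x\<bar> e)"
    and C: "C = 8 * (\<phi> e + 1) / \<eta>" and \<kappa>: "\<kappa> = \<eta> / (4 * (C + 1) * (\<phi> e + 1))"
    and yV: "\<And>k. y k \<in> V" and y1: "\<And>k. norm (y k) = 1"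
    and yd: "\<And>k. \<bar>y k - d k\<bar> \<le> (\<kappa> * (1/2) ^ Suc k) *\<^sub>R e"
begin

lemma phi_e_nonneg: "0 \<le> \<phi> e"
  by (rule pos[OF e])

lemma C_pos: "C > 0"
  using \<eta> phi_e_nonneg by (simp add: C)

lemma \<kappa>_pos: "\<kappa> > 0"
  using \<eta> phi_e_nonneg C_pos by (simp add: \<kappa>)

lemma \<kappa>_bound: "(C + 1) * (\<kappa> * \<phi> e) \<le> \<eta> / 4"
proof -
  have "4 * (C + 1) * (\<phi> e + 1) \<noteq> 0" using C_pos phi_e_nonneg by simp
  then have "(4 * (C + 1) * (\<phi> e + 1)) * \<kappa> = \<eta>" unfolding \<kappa> times_divide_eq_right
    by (rule nonzero_mult_div_cancel_left)
  then have "4 * ((C + 1) * (\<kappa> * (\<phi> e + 1))) = \<eta>" by (simp only: mult_ac)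
  moreover have "(C + 1) * (\<kappa> * \<phi> e) \<le> (C + 1) * (\<kappa> * (\<phi> e + 1))"
    using C_pos \<kappa>_pos by (intro mult_left_mono) auto
  ultimately show ?thesis by linarith
qed

lemma sum_in_V: "(\<Sum>k\<in>A. a k *\<^sub>R y k) \<in> V"
  by (intro subspace_sum V subspace_scale yV)

lemma below_homogeneous:
  assumes x: "x \<in> V" shows "\<eta> * norm x \<le> \<phi> (inf \<bar>x\<bar> (norm x *\<^sub>R e))"
proof (cases "x = 0")
  case True
  then show ?thesis using e by (simp add: inf_absorb1 linear_0[OF lin])
next
  case False
  define x1 where "x1 = (1 / norm x) *\<^sub>R x"
  have x1: "x1 \<in> V" "norm x1 = 1" using x V False by (simp_all add: x1_def subspace_scale)
  have "\<bar>x\<bar> = norm x *\<^sub>R \<bar>x1\<bar>" using False by (simp add: x1_def abs_scaleR_banach_lattice)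
  then have "\<phi> (inf \<bar>x\<bar> (norm x *\<^sub>R e)) = norm x * \<phi> (inf \<bar>x1\<bar> e)"
    by (simp add: inf_scaleR linear_scale[OF lin])
  then show ?thesis using mult_left_mono[OF below[OF x1], of "norm x"] by (simp add: mult.commute)
qed

text \<open>The cutoff \<open>M\<close> serves two uses: \<open>M = 0\<close> for multipliers, and
  large \<open>M\<close> for tails of an expansion, where the factor \<open>(1/2) ^ M\<close> makes
  the error vanish.\<close>

lemma perturbation_le:
  assumes b: "\<And>k. k < N \<Longrightarrow> \<bar>b k\<bar> \<le> \<alpha>" "\<And>k. k < M \<Longrightarrow> b k = 0" and \<alpha>: "0 \<le> \<alpha>"
  shows "\<bar>(\<Sum>k<N. b k *\<^sub>R y k) - (\<Sum>k<N. b k *\<^sub>R d k)\<bar> \<le> (\<alpha> * \<kappa> * (1/2) ^ M) *\<^sub>R e"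
proof -
  have "(\<Sum>k<N. b k *\<^sub>R y k) - (\<Sum>k<N. b k *\<^sub>R d k) = (\<Sum>k<N. b k *\<^sub>R (y k - d k))"
    by (simp add: sum_subtractf scaleR_right_diff_distrib)
  also have "\<bar>\<dots>\<bar> \<le> (\<Sum>k<N. \<bar>b k *\<^sub>R (y k - d k)\<bar>)" by (rule sum_abs)
  also have "\<dots> \<le> (\<Sum>k<N. (\<alpha> * \<kappa> * (if M \<le> k then (1/2) ^ Suc k else 0)) *\<^sub>R e)"
  proof (rule sum_mono)
    fix k assume "k \<in> {..<N}"
    then have k: "k < N" by simp
    show "\<bar>b k *\<^sub>R (y k - d k)\<bar> \<le> (\<alpha> * \<kappa> * (if M \<le> k then (1/2) ^ Suc k else 0)) *\<^sub>R e"
    proof (cases "M \<le> k")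
      case True
      have "\<bar>b k\<bar> *\<^sub>R \<bar>y k - d k\<bar> \<le> \<alpha> *\<^sub>R ((\<kappa> * (1/2) ^ Suc k) *\<^sub>R e)"
        by (rule scaleR_mono'[OF b(1)[OF k] yd]) auto
      then show ?thesis using True by (simp add: abs_scaleR_banach_lattice mult.assoc)
    qed (use b(2)[of k] in simp)
  qed
  also have "\<dots> = (\<alpha> * \<kappa> * (\<Sum>k<N. if M \<le> k then (1/2) ^ Suc k else 0)) *\<^sub>R e"
    by (simp only: scaleR_sum_left[symmetric] sum_distrib_left)
  also have "\<dots> \<le> (\<alpha> * \<kappa> * (1/2) ^ M) *\<^sub>R e"
    using \<alpha> \<kappa>_pos by (intro scaleR_right_mono[OF _ e] mult_left_mono[OF geometric_tail_le]) simp
  finally show ?thesis .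
qed

lemma phi_le: "\<bar>x\<bar> \<le> r *\<^sub>R e \<Longrightarrow> \<phi> \<bar>x\<bar> \<le> r * \<phi> e"
  using mono[of "\<bar>x\<bar>" "r *\<^sub>R e"] linear_scale[OF lin, of r e] by simp

lemma phi_abs_le_norm: "\<phi> \<bar>x\<bar> \<le> norm x"
  using le_norm[of "\<bar>x\<bar>"] by simp

lemma phi_triangle: "\<phi> \<bar>x\<bar> \<le> \<phi> \<bar>z\<bar> + \<phi> \<bar>x - z\<bar>"
proof -
  have "\<bar>x\<bar> \<le> \<bar>z\<bar> + \<bar>x - z\<bar>" using abs_triangle_ineq[of z "x - z"] by simp
  then have "\<phi> \<bar>x\<bar> \<le> \<phi> (\<bar>z\<bar> + \<bar>x - z\<bar>)" by (rule mono)
  then show ?thesis by (simp add: linear_add[OF lin])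
qed

lemma phi_inf_le:
  assumes "0 \<le> u" shows "\<phi> (inf \<bar>x\<bar> u) \<le> \<phi> (inf \<bar>z\<bar> u) + \<phi> \<bar>x - z\<bar>"
proof -
  have "inf \<bar>x\<bar> u \<le> inf (\<bar>z\<bar> + \<bar>x - z\<bar>) u"
    using abs_triangle_ineq[of z "x - z"] by (intro inf_mono) simp_all
  also have "\<dots> \<le> inf \<bar>z\<bar> u + inf \<bar>x - z\<bar> u" using assms by (intro inf_add_le) auto
  also have "\<dots> \<le> inf \<bar>z\<bar> u + \<bar>x - z\<bar>" by (intro add_left_mono) simp
  finally have "\<phi> (inf \<bar>x\<bar> u) \<le> \<phi> (inf \<bar>z\<bar> u + \<bar>x - z\<bar>)" by (rule mono)
  then show ?thesis by (simp add: linear_add[OF lin])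
qed

text \<open>\<open>Y\<close> lies in \<open>V\<close>, so its norm is bounded by a truncated mean;
  this passes to the differences, where the weak type estimate applies, and then back to
  \<open>F\<close>, whose mean is at most its norm. A quarter of \<open>\<eta> * r\<close> is
  absorbed on the left, hence the factor \<open>3/4\<close>.\<close>

lemma multiplier_norm_estimate:
  fixes \<theta> a :: "nat \<Rightarrow> real"
  assumes \<theta>: "\<And>k. \<bar>\<theta> k\<bar> \<le> 1" and a: "\<And>k. k < N \<Longrightarrow> \<bar>a k\<bar> \<le> \<alpha>" and \<alpha>: "0 \<le> \<alpha>"
  shows "3/4 * (\<eta> * norm (\<Sum>k<N. (\<theta> k * a k) *\<^sub>R y k)) \<le> C * norm (\<Sum>k<N. a k *\<^sub>R y k) + \<eta> / 4 * \<alpha>"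
proof -
  define Y where "Y = (\<Sum>k<N. (\<theta> k * a k) *\<^sub>R y k)"
  define T where "T = (\<Sum>k<N. (\<theta> k * a k) *\<^sub>R d k)"
  define F where "F = (\<Sum>k<N. a k *\<^sub>R y k)"
  define D where "D = (\<Sum>k<N. a k *\<^sub>R d k)"
  define r where "r = norm Y"
  have \<theta>a: "\<bar>\<theta> k * a k\<bar> \<le> \<alpha>" if "k < N" for k
    using mult_mono[OF \<theta>[of k] a[OF that]] by (simp add: abs_mult)
  have YT: "\<phi> \<bar>Y - T\<bar> \<le> \<alpha> * \<kappa> * \<phi> e"
    unfolding Y_def T_def by (rule phi_le) (use perturbation_le[of N "\<lambda>k. \<theta> k * a k" \<alpha> 0] \<theta>a \<alpha> in simp)
  have "\<phi> \<bar>D - F\<bar> \<le> \<alpha> * \<kappa> * \<phi> e"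
    unfolding F_def D_def abs_minus_commute[of "\<Sum>k<N. a k *\<^sub>R d k"]
    by (rule phi_le) (use perturbation_le[of N a \<alpha> 0] a \<alpha> in simp)
  then have D: "\<phi> \<bar>D\<bar> \<le> norm F + \<alpha> * \<kappa> * \<phi> e"
    using phi_triangle[of D F] phi_abs_le_norm[of F] by simp
  have "3/4 * (\<eta> * r) \<le> C * \<phi> \<bar>D\<bar> + \<alpha> * \<kappa> * \<phi> e"
  proof (cases "r = 0")
    case True
    then show ?thesis using C_pos \<kappa>_pos phi_e_nonneg \<alpha> pos[of "\<bar>D\<bar>"] by simp
  next
    case False
    then have r: "r > 0" by (simp add: r_def)
    \<comment> \<open>This level makes \<open>c * \<phi> e\<close> at most a quarter of
      \<open>\<eta> * r\<close> while \<open>2 * r / c\<close> is the constant \<open>C\<close>,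
      independent of \<open>r\<close>.\<close>
    define c where "c = \<eta> * r / (4 * (\<phi> e + 1))"
    have c: "c > 0" using \<eta> r phi_e_nonneg by (simp add: c_def)
    have c4: "c * (4 * (\<phi> e + 1)) = \<eta> * r" using phi_e_nonneg by (simp add: c_def)
    have "c * \<phi> e \<le> \<eta> * r / 4" using c c4 by (simp add: algebra_simps)
    moreover have "2 * r / c = C"
      using c r \<eta> phi_e_nonneg unfolding C c_def by (simp add: field_simps)
    moreover have "\<eta> * r \<le> \<phi> (inf \<bar>Y\<bar> (r *\<^sub>R e))"
      unfolding r_def by (rule below_homogeneous) (simp add: Y_def sum_in_V)
    moreover have "\<phi> (inf \<bar>Y\<bar> (r *\<^sub>R e)) \<le> \<phi> (inf \<bar>T\<bar> (r *\<^sub>R e)) + \<phi> \<bar>Y - T\<bar>"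
      using r e by (intro phi_inf_le scaleR_nonneg_nonneg) auto
    moreover have "\<phi> (inf \<bar>T\<bar> (r *\<^sub>R e)) \<le> c * \<phi> e + 2 * r / c * \<phi> \<bar>D\<bar>"
      unfolding T_def D_def by (rule multiplier_estimate[OF \<theta> c]) (use r in simp)
    ultimately show ?thesis using YT by simp
  qed
  also have "\<dots> \<le> C * (norm F + \<alpha> * \<kappa> * \<phi> e) + \<alpha> * \<kappa> * \<phi> e"
    using D C_pos by simp
  also have "\<dots> = C * norm F + ((C + 1) * (\<kappa> * \<phi> e)) * \<alpha>" by (simp add: algebra_simps)
  also have "\<dots> \<le> C * norm F + \<eta> / 4 * \<alpha>"
    using mult_right_mono[OF \<kappa>_bound \<alpha>] by simp
  finally show ?thesis unfolding r_def Y_def F_def .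
qed

lemma suppression_unconditional: "suppression_unconditional y (2 * C / \<eta>)"
proof
  show "y k \<noteq> 0" for k using y1[of k] by auto
  fix A :: "nat set" and N and a :: "nat \<Rightarrow> real" assume A: "A \<subseteq> {..<N}"
  show "norm (\<Sum>k\<in>A. a k *\<^sub>R y k) \<le> 2 * C / \<eta> * norm (\<Sum>k<N. a k *\<^sub>R y k)"
  proof (cases "N = 0")
    case False
    let ?F = "norm (\<Sum>k<N. a k *\<^sub>R y k)"
    define \<alpha> where "\<alpha> = Max ((\<lambda>k. \<bar>a k\<bar>) ` {..<N})"
    have "\<alpha> \<in> (\<lambda>k. \<bar>a k\<bar>) ` {..<N}" unfolding \<alpha>_def using False by (intro Max_in) auto
    then obtain j where j: "j < N" "\<alpha> = \<bar>a j\<bar>" by auto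
    have le: "\<bar>a k\<bar> \<le> \<alpha>" if "k < N" for k unfolding \<alpha>_def using that by (intro Max_ge) auto
    have est: "3/4 * (\<eta> * norm (\<Sum>k\<in>B. a k *\<^sub>R y k)) \<le> C * ?F + \<eta> / 4 * \<alpha>" if B: "B \<subseteq> {..<N}" for B
    proof -
      have "(\<Sum>k<N. (of_bool (k \<in> B) * a k) *\<^sub>R y k) = (\<Sum>k\<in>B. a k *\<^sub>R y k)"
        by (rule sum.mono_neutral_cong_right) (use B in auto)
      then show ?thesis using multiplier_norm_estimate[of "\<lambda>k. of_bool (k \<in> B)" N a \<alpha>] le j by simp
    qed
    \<comment> \<open>The estimate on the single index of the largest coefficient bounds
      \<open>\<eta> * \<alpha>\<close> by \<open>2 * (C * ?F)\<close>, which removes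
      \<open>\<alpha>\<close> from the estimate for \<open>A\<close>.\<close>
    have "3/4 * (\<eta> * \<alpha>) \<le> C * ?F + \<eta> / 4 * \<alpha>"
      using est[of "{j}"] j y1 by simp
    then have "\<eta> * \<alpha> \<le> 2 * (C * ?F)" by (simp add: mult.commute)
    then have "\<eta> * norm (\<Sum>k\<in>A. a k *\<^sub>R y k) \<le> 2 * (C * ?F)" using est[OF A] by linarith
    then show ?thesis using \<eta> by (simp add: field_simps)
  qed (use A in simp)
qed

lemma disjoint_from_V:
  assumes w: "0 \<le> w" "inf w e = 0" and x: "x \<in> V" shows "inf w \<bar>x\<bar> = 0"
proof -
  obtain m where m: "m \<ge> 0" "\<bar>x\<bar> \<le> m *\<^sub>R e" using bounded[OF x] by blast
  have "inf (1 *\<^sub>R w) (m *\<^sub>R e) = 0" by (rule inf_scaleR_eq_0) (use w e m in auto)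
  then show ?thesis by (rule inf_eq_0_mono) (use w m in auto)
qed

text \<open>The maximal estimate is applied to the differences with coefficients from
  \<open>N\<close> on. It bounds all partial sums of this tail by one \<open>h\<close> with small
  \<open>\<phi> (inf h e)\<close>, and \<open>norm_small\<close> converts this into small
  norm.\<close>

lemma uo_converges_partial_sums:
  assumes oc: "order_continuous TYPE('a)"
    and norm_small: "\<And>\<epsilon>. \<epsilon> > 0 \<Longrightarrow> \<exists>\<delta>>0. \<forall>g. 0 \<le> g \<longrightarrow> g \<le> e \<longrightarrow> \<phi> g \<le> \<delta> \<longrightarrow> norm g < \<epsilon>"
    and v: "(\<lambda>k. a k *\<^sub>R y k) sums v"
  shows "uo_converges UNIV (\<le>) (\<lambda>m. \<Sum>k\<le>m. a k *\<^sub>R y k) v"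
proof (rule uo_converges_of_maximal[OF oc e])
  define S where "S m = (\<Sum>k<m. a k *\<^sub>R y k)" for m
  have S: "S \<longlonglongrightarrow> v" using v by (simp add: sums_def S_def[abs_def])
  have zS: "(\<Sum>k\<le>m. a k *\<^sub>R y k) = S (Suc m)" for m by (simp add: S_def lessThan_Suc_atMost)
  obtain \<alpha> where \<alpha>: "\<alpha> \<ge> 0" "\<And>k. \<bar>a k\<bar> \<le> \<alpha>"
    using suppression_unconditional.coeff_bounded_of_sums[OF suppression_unconditional y1 v] by blast
  show "inf w \<bar>(\<Sum>k\<le>m. a k *\<^sub>R y k) - v\<bar> = 0" if w: "0 \<le> w" "inf w e = 0" for w m
  proof -
    \<comment> \<open>The limit \<open>v\<close> need not lie in \<open>V\<close>, but differences
      of partial sums do, and disjointness from \<open>w\<close> passes to the norm limit.\<close>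
    have "(\<lambda>j. inf w \<bar>S (Suc m) - S j\<bar>) \<longlonglongrightarrow> inf w \<bar>S (Suc m) - v\<bar>"
      by (intro tendsto_inf_banach_lattice tendsto_abs_banach_lattice tendsto_diff tendsto_const S)
    moreover have "inf w \<bar>S (Suc m) - S j\<bar> = 0" for j
      unfolding S_def by (intro disjoint_from_V w subspace_diff[OF V] sum_in_V)
    ultimately have "(\<lambda>j. 0) \<longlonglongrightarrow> inf w \<bar>S (Suc m) - v\<bar>" by simp
    then show ?thesis unfolding zS by (simp add: LIMSEQ_const_iff)
  qed
  fix \<epsilon> :: real assume \<epsilon>: "\<epsilon> > 0"
  then obtain \<delta> where \<delta>: "\<delta> > 0" "\<And>g. 0 \<le> g \<Longrightarrow> g \<le> e \<Longrightarrow> \<phi> g \<le> \<delta> \<Longrightarrow> norm g < \<epsilon>/3"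
    using norm_small[of "\<epsilon>/3"] by auto
  define c where "c = \<delta> / (2 * (\<phi> e + 1))"
  have c: "c > 0" using \<delta>(1) phi_e_nonneg by (simp add: c_def)
  have "c * (2 * (\<phi> e + 1)) = \<delta>" using phi_e_nonneg by (simp add: c_def)
  then have ce: "c * \<phi> e \<le> \<delta> / 2" using c by (simp add: algebra_simps)
  \<comment> \<open>The tail of the martingale has mean at most \<open>3 * \<beta>\<close>, two
    parts from the Cauchy property and one from the perturbation. The condition
    \<open>12 * \<beta> \<le> \<delta> * c\<close> keeps \<open>2 / c * (3 * \<beta>)\<close> within
    \<open>\<delta> / 2\<close>; the other half of \<delta> is left for
    \<open>c * \<phi> e\<close>.\<close>
  define \<beta> where "\<beta> = min (\<epsilon>/3) (\<delta> * c / 12)"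
  have \<beta>: "\<beta> > 0" "\<beta> \<le> \<epsilon>/3" "12 * \<beta> \<le> \<delta> * c" using \<epsilon> \<delta>(1) c by (auto simp: \<beta>_def)
  define \<tau> where "\<tau> N = \<alpha> * \<kappa> * (1/2) ^ N" for N :: nat
  have \<tau>0: "0 \<le> \<tau> N" for N using \<alpha> \<kappa>_pos by (simp add: \<tau>_def)
  have "(\<lambda>N. \<tau> N * (\<phi> e + norm e)) \<longlonglongrightarrow> (\<alpha> * \<kappa> * 0) * (\<phi> e + norm e)"
    unfolding \<tau>_def by (intro tendsto_mult tendsto_const LIMSEQ_power_zero) simp
  then have "\<forall>\<^sub>F N in sequentially. \<tau> N * (\<phi> e + norm e) < \<beta>"
    using \<beta>(1) by (intro order_tendstoD(2)[of _ "(\<alpha> * \<kappa> * 0) * (\<phi> e + norm e)"]) auto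
  then obtain N1 where N1: "\<And>N. N \<ge> N1 \<Longrightarrow> \<tau> N * (\<phi> e + norm e) < \<beta>"
    unfolding eventually_sequentially by blast
  obtain N2 where N2: "\<And>m. m \<ge> N2 \<Longrightarrow> norm (S m - v) < \<beta>" using LIMSEQ_D[OF S \<beta>(1)] by blast
  define N where "N = max N1 N2"
  have "\<tau> N * \<phi> e + \<tau> N * norm e < \<beta>"
    using N1[of N] unfolding distrib_left by (simp add: N_def)
  moreover have "0 \<le> \<tau> N * \<phi> e" "0 \<le> \<tau> N * norm e"
    using \<tau>0[of N] phi_e_nonneg by simp_all
  ultimately have \<tau>e: "\<tau> N * \<phi> e \<le> \<beta>" "\<tau> N * norm e \<le> \<beta>" by linarith+
  define b where "b k = (if N \<le> k then a k else 0)" for k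
  have b\<alpha>: "\<bar>b k\<bar> \<le> \<alpha>" for k using \<alpha> by (simp add: b_def)
  have Sb: "S m - S N = (\<Sum>k<m. b k *\<^sub>R y k)" if "N \<le> m" for m
  proof -
    have "S m - S N = (\<Sum>k\<in>{..<m} - {..<N}. a k *\<^sub>R y k)"
      unfolding S_def by (rule sum_diff[symmetric]) (use that in auto)
    also have "\<dots> = (\<Sum>k<m. b k *\<^sub>R y k)"
      by (rule sum.mono_neutral_cong_left) (auto simp: b_def)
    finally show ?thesis .
  qed
  have pert: "\<bar>(\<Sum>k<m. b k *\<^sub>R y k) - (\<Sum>k<m. b k *\<^sub>R d k)\<bar> \<le> \<tau> N *\<^sub>R e" for m
    unfolding \<tau>_def by (rule perturbation_le[OF b\<alpha> _ \<alpha>(1)]) (simp add: b_def)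
  have "\<exists>h. (\<forall>m. N \<le> m \<longrightarrow> m \<le> M \<longrightarrow> \<bar>(\<Sum>k\<le>m. a k *\<^sub>R y k) - v\<bar> \<le> h) \<and> norm (inf h e) \<le> \<epsilon>"
    if M: "M \<ge> N" for M
  proof -
    obtain h where h: "\<And>m. m \<le> Suc M \<Longrightarrow> \<bar>\<Sum>k<m. b k *\<^sub>R d k\<bar> \<le> h"
      "\<phi> (inf h e) \<le> c * \<phi> e + 2 / c * \<phi> \<bar>\<Sum>k<Suc M. b k *\<^sub>R d k\<bar>"
      using maximal_estimate[OF c, of "Suc M" b] by blast
    have h0: "0 \<le> h" using h(1)[of 0] by simp
    define B where "B = (\<Sum>k<Suc M. b k *\<^sub>R d k)"
    have "\<phi> \<bar>B\<bar> \<le> \<phi> \<bar>S (Suc M) - S N\<bar> + \<phi> \<bar>B - (S (Suc M) - S N)\<bar>" by (rule phi_triangle)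
    also have "\<phi> \<bar>S (Suc M) - S N\<bar> \<le> norm (S (Suc M) - S N)" by (rule phi_abs_le_norm)
    also have "\<phi> \<bar>B - (S (Suc M) - S N)\<bar> \<le> \<tau> N * \<phi> e"
      unfolding abs_minus_commute[of B]
      by (rule phi_le) (use pert[of "Suc M"] M in \<open>simp only: Sb le_SucI B_def\<close>)
    also have "norm (S (Suc M) - S N) \<le> 2 * \<beta>"
      using norm_triangle_ineq4[of "S (Suc M) - v" "S N - v"] N2[of "Suc M"] N2[of N] M by (simp add: N_def)
    finally have B3: "\<phi> \<bar>B\<bar> \<le> 3 * \<beta>" using \<tau>e by simp
    have "2 / c * \<phi> \<bar>B\<bar> \<le> 2 / c * (3 * \<beta>)" using c by (intro mult_left_mono[OF B3]) simp
    also have "\<dots> \<le> \<delta> / 2" using c \<beta>(3) by (simp add: field_simps)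
    finally have "\<phi> (inf h e) \<le> \<delta>" using h(2) ce unfolding B_def by simp
    then have nh: "norm (inf h e) < \<epsilon>/3" using h0 e by (intro \<delta>(2)) auto
    \<comment> \<open>The deviation after \<open>N\<close> splits into the error at
      \<open>N\<close>, the martingale tail and the perturbation; after truncation by
      \<open>e\<close> each has norm at most \<epsilon>/3.\<close>
    define g where "g = \<bar>S N - v\<bar> + (h + \<tau> N *\<^sub>R e)"
    have \<tau>e0: "0 \<le> \<tau> N *\<^sub>R e" using \<tau>0 e by (simp add: scaleR_nonneg_nonneg)
    have "\<bar>(\<Sum>k\<le>m. a k *\<^sub>R y k) - v\<bar> \<le> g" if m: "N \<le> m" "m \<le> M" for m
    proof -
      let ?D = "\<Sum>k<Suc m. b k *\<^sub>R d k"
      have "S (Suc m) - v = (S N - v) + (?D + ((S (Suc m) - S N) - ?D))" by simp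
      then have "\<bar>S (Suc m) - v\<bar> \<le> \<bar>S N - v\<bar> + \<bar>?D + ((S (Suc m) - S N) - ?D)\<bar>"
        by (metis abs_triangle_ineq)
      also have "\<dots> \<le> \<bar>S N - v\<bar> + (\<bar>?D\<bar> + \<bar>(S (Suc m) - S N) - ?D\<bar>)"
        by (intro add_left_mono abs_triangle_ineq)
      also have "\<dots> \<le> g"
        unfolding g_def
      proof (intro add_left_mono add_mono)
        show "\<bar>?D\<bar> \<le> h" by (rule h(1)) (use m in simp)
        show "\<bar>(S (Suc m) - S N) - ?D\<bar> \<le> \<tau> N *\<^sub>R e"
          using pert[of "Suc m"] m by (simp only: Sb le_SucI)
      qed
      finally show ?thesis unfolding zS .
    qed
    moreover have "norm (inf g e) \<le> \<epsilon>"
    proof -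
      have "inf g e \<le> inf \<bar>S N - v\<bar> e + inf (h + \<tau> N *\<^sub>R e) e"
        unfolding g_def using h0 \<tau>e0 e by (intro inf_add_le) auto
      also have "\<dots> \<le> \<bar>S N - v\<bar> + (inf h e + inf (\<tau> N *\<^sub>R e) e)"
        using h0 \<tau>e0 e by (intro add_mono inf_add_le) auto
      also have "\<dots> \<le> \<bar>S N - v\<bar> + (inf h e + \<tau> N *\<^sub>R e)"
        by (intro add_left_mono) simp
      finally have "inf g e \<le> \<bar>S N - v\<bar> + (inf h e + \<tau> N *\<^sub>R e)" .
      moreover have "0 \<le> inf g e" using h0 \<tau>e0 e by (simp add: g_def)
      ultimately have "norm (inf g e) \<le> norm (\<bar>S N - v\<bar> + (inf h e + \<tau> N *\<^sub>R e))"
        by (intro norm_le_of_abs_le) simp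
      also have "\<dots> \<le> norm \<bar>S N - v\<bar> + (norm (inf h e) + norm (\<tau> N *\<^sub>R e))"
        by (intro order_trans[OF norm_triangle_ineq] add_left_mono norm_triangle_ineq)
      also have "\<dots> \<le> \<epsilon>/3 + (\<epsilon>/3 + \<epsilon>/3)"
        using N2[of N] nh \<tau>e(2) \<tau>0[of N] \<beta>(2) by (intro add_mono) (auto simp: N_def)
      finally show ?thesis by simp
    qed
    ultimately show ?thesis by blast
  qed
  then show "\<exists>N. \<forall>M\<ge>N. \<exists>h. (\<forall>m. N \<le> m \<longrightarrow> m \<le> M \<longrightarrow> \<bar>(\<Sum>k\<le>m. a k *\<^sub>R y k) - v\<bar> \<le> h) \<and> norm (inf h e) \<le> \<epsilon>"
    by blast
qed

end

lemma exists_unconditional_uo_bibasic_of_below: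
  fixes t :: "nat \<Rightarrow> 'a::banach_lattice"
  assumes oc: "order_continuous TYPE('a)" and e: "0 \<le> e"
    and inf_dim: "infinite_dimensional (span (range t))"
    and bounded: "\<And>x. x \<in> span (range t) \<Longrightarrow> \<exists>m\<ge>0. \<bar>x\<bar> \<le> m *\<^sub>R e"
    and \<delta>: "\<delta> > 0" and below: "\<And>x. x \<in> span (range t) \<Longrightarrow> norm x = 1 \<Longrightarrow> \<delta> \<le> norm (inf \<bar>x\<bar> e)"
  shows "\<exists>y. range y \<subseteq> span (range t) \<and> unconditional_uo_bibasic y"
proof -
  have "\<exists>m\<ge>0. \<bar>t j\<bar> \<le> m *\<^sub>R e" for j by (intro bounded span_base) simp
  then obtain p where pa: "component_sequence e p" "span (range t) \<subseteq> component_sequence.approximable e p"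
    using exists_component_sequence[OF oc e] by blast
  obtain \<phi> where \<phi>: "positive_functional \<phi>"
    "\<And>\<epsilon>. \<epsilon> > 0 \<Longrightarrow> \<exists>\<eta>>0. \<forall>g. 0 \<le> g \<longrightarrow> g \<le> e \<longrightarrow> \<phi> g \<le> \<eta> \<longrightarrow> norm g < \<epsilon>"
    using functional_controls_norm[OF oc, of e] by blast
  obtain \<eta> where \<eta>: "\<eta> > 0" "\<And>g. 0 \<le> g \<Longrightarrow> g \<le> e \<Longrightarrow> \<phi> g \<le> \<eta> \<Longrightarrow> norm g < \<delta>" using \<phi>(2)[OF \<delta>] by blast
  have cf: "component_functional e p \<phi>" using pa(1) \<phi>(1) by (rule component_functional.intro)
  interpret component_functional e p \<phi> by (rule cf)
  have \<phi>e: "0 \<le> \<phi> e" by (rule pos[OF e])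
  define C where "C = 8 * (\<phi> e + 1) / \<eta>"
  define \<kappa> where "\<kappa> = \<eta> / (4 * (C + 1) * (\<phi> e + 1))"
  have "C > 0" using \<eta>(1) \<phi>e by (simp add: C_def)
  then have \<kappa>: "\<kappa> > 0" using \<eta>(1) \<phi>e by (simp add: \<kappa>_def)
  then have \<epsilon>: "\<kappa> * (1/2) ^ Suc k > 0" for k by simp
  \<comment> \<open>The contrapositive of the norm control on the interval up to \<open>e\<close>
    turns the lower bound in norm into one for \<open>\<phi>\<close>.\<close>
  have low: "\<eta> \<le> \<phi> (inf \<bar>x\<bar> e)" if "x \<in> span (range t)" "norm x = 1" for x
  proof (rule ccontr)
    assume "\<not> \<eta> \<le> \<phi> (inf \<bar>x\<bar> e)"
    then have "norm (inf \<bar>x\<bar> e) < \<delta>" using e by (intro \<eta>(2)) auto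
    then show False using below[OF that] by simp
  qed
  show ?thesis
  proof (rule exists_mean_zero_sequence[OF cf subspace_span inf_dim pa(2) bounded \<epsilon>])
    fix y n G
    assume y: "mean_zero_sequence e p \<phi> n G" "\<And>k. y k \<in> span (range t)" "\<And>k. norm (y k) = 1"
      "\<And>k. \<bar>y k - mean_zero_sequence.d e p n G k\<bar> \<le> (\<kappa> * (1/2) ^ Suc k) *\<^sub>R e"
  interpret perturbed_mean_zero_sequence e p \<phi> n G y "span (range t)" \<eta> \<kappa> C
  proof (intro perturbed_mean_zero_sequence.intro perturbed_mean_zero_sequence_axioms.intro)
    show "\<exists>m\<ge>0. \<bar>x\<bar> \<le> m *\<^sub>R e" if "x \<in> span (range t)" for x using that by (rule bounded)
    show "\<eta> \<le> \<phi> (inf \<bar>x\<bar> e)" if "x \<in> span (range t)" "norm x = 1" for x using that by (rule low)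
  qed (rule y subspace_span \<eta>(1) C_def \<kappa>_def)+
  interpret suppression_unconditional y "2 * C / \<eta>" by (rule suppression_unconditional)
  have "unconditional_uo_bibasic y"
    unfolding unconditional_uo_bibasic_def uo_bibasic_def
  proof (intro conjI ballI allI impI schauder_basic unconditional_basic)
    show "uo_converges UNIV (\<le>) (\<lambda>m. \<Sum>k\<le>m. a k *\<^sub>R y k) v" if "(\<lambda>k. a k *\<^sub>R y k) sums v" for a v
      by (rule uo_converges_partial_sums[OF oc \<phi>(2) that])
  qed
  then show ?thesis using y(2) by blast
  qed
qed

section \<open>A dominating element for a countable span, and the two cases\<close>

lemma infinite_dimensional_span:
  fixes t :: "nat \<Rightarrow> 'a::real_vector"
  assumes "inj t" "independent (range t)" shows "infinite_dimensional (span (range t))"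
  unfolding infinite_dimensional_def
proof
  assume "\<exists>B. finite B \<and> span (range t) \<subseteq> span B"
  then obtain B where B: "finite B" "span (range t) \<subseteq> span B" by blast
  then have "range t \<subseteq> span B" using span_superset by blast
  then have "finite (range t)" using independent_span_bound[OF B(1) assms(2)] by blast
  then show False using assms(1) by (simp add: finite_image_iff)
qed

text \<open>\<open>e\<close> is the sum of the normalized moduli of the \<open>t k\<close> with
  weights \<open>(1/2) ^ k\<close>. Elements dominated by multiples of \<open>e\<close> form a
  subspace containing every \<open>t k\<close>.\<close>

lemma exists_order_unit_of_span:
  fixes t :: "nat \<Rightarrow> 'a::banach_lattice"
  assumes t: "\<And>k. t k \<noteq> 0"
  obtains e where "0 \<le> e" "\<And>x. x \<in> span (range t) \<Longrightarrow> \<exists>m\<ge>0. \<bar>x\<bar> \<le> m *\<^sub>R e"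
proof -
  define c where "c k = (1/2) ^ k / norm (t k)" for k
  have c: "c k > 0" for k using t[of k] by (simp add: c_def)
  define f where "f k = c k *\<^sub>R \<bar>t k\<bar>" for k
  have "norm (f k) = (1/2) ^ k" for k using t[of k] by (simp add: f_def c_def)
  then have "summable (\<lambda>k. norm (f k))" by (simp add: summable_geometric)
  then have f: "summable f" by (rule summable_norm_cancel)
  have f0: "0 \<le> f k" for k using c[of k] by (simp add: f_def scaleR_nonneg_nonneg)
  define e where "e = suminf f"
  have e0: "0 \<le> e" unfolding e_def by (rule nonneg_series_bounds(2)[OF f f0])
  define W where "W = {x. \<exists>m\<ge>0. \<bar>x\<bar> \<le> m *\<^sub>R e}"
  have "subspace W"
  proof (rule subspaceI)
    show "0 \<in> W" unfolding W_def by (auto intro: exI[of _ 0])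
    fix x y assume "x \<in> W" "y \<in> W"
    then obtain m l where m: "m \<ge> 0" "\<bar>x\<bar> \<le> m *\<^sub>R e" "l \<ge> 0" "\<bar>y\<bar> \<le> l *\<^sub>R e" unfolding W_def by blast
    have "\<bar>x + y\<bar> \<le> (m + l) *\<^sub>R e"
      unfolding scaleR_left_distrib by (rule order_trans[OF abs_triangle_ineq add_mono[OF m(2,4)]])
    then show "x + y \<in> W" unfolding W_def using m(1,3) by (intro CollectI exI[of _ "m + l"]) simp
  next
    fix r x assume "x \<in> W"
    then obtain m where m: "m \<ge> 0" "\<bar>x\<bar> \<le> m *\<^sub>R e" unfolding W_def by blast
    have "\<bar>r *\<^sub>R x\<bar> \<le> (\<bar>r\<bar> * m) *\<^sub>R e"
      unfolding abs_scaleR_banach_lattice scaleR_scaleR[symmetric] by (rule scaleR_left_mono[OF m(2)]) simp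
    then show "r *\<^sub>R x \<in> W" unfolding W_def using m(1) by (intro CollectI exI[of _ "\<bar>r\<bar> * m"]) simp
  qed
  moreover have "t k \<in> W" for k
  proof -
    have "(1 / c k) *\<^sub>R f k \<le> (1 / c k) *\<^sub>R e"
      unfolding e_def using c[of k] by (intro scaleR_left_mono nonneg_series_bounds(1)[OF f f0]) simp
    moreover have "(1 / c k) *\<^sub>R f k = \<bar>t k\<bar>" using c[of k] by (simp add: f_def)
    ultimately show ?thesis unfolding W_def using c[of k] by (intro CollectI exI[of _ "1 / c k"]) simp
  qed
  ultimately have "span (range t) \<subseteq> W" by (intro span_minimal) auto
  then show ?thesis using that[OF e0] unfolding W_def by blast
qed

theorem theorem10p5:
  fixes S :: "'a::banach_lattice set"
  assumes "order_continuous TYPE('a)"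
    and "subspace S" and "closed S" and "infinite_dimensional S"
  shows "\<exists>x::nat \<Rightarrow> 'a. range x \<subseteq> S \<and> unconditional_uo_bibasic x"
proof -
  obtain B where B: "B \<subseteq> S" "independent B" "S \<subseteq> span B"
    using maximal_independent_subset[of S] by blast
  then have "infinite B" using assms(4) unfolding infinite_dimensional_def by blast
  \<comment> \<open>A sequence of independent vectors is enough: the basic sequence is found inside
    its algebraic span, which a single positive element dominates.\<close>
  then obtain t :: "nat \<Rightarrow> 'a" where t: "inj t" "range t \<subseteq> B"
    using infinite_countable_subset by blast
  have ind: "independent (range t)" by (rule independent_mono[OF B(2) t(2)])
  have "t k \<noteq> 0" for k using ind dependent_zero[of "range t"] rangeI[of t k] by auto
  then obtain e where e: "0 \<le> e" "\<And>x. x \<in> span (range t) \<Longrightarrow> \<exists>m\<ge>0. \<bar>x\<bar> \<le> m *\<^sub>R e"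
    using exists_order_unit_of_span by blast
  have "\<exists>x. range x \<subseteq> span (range t) \<and> unconditional_uo_bibasic x"
  proof (cases "\<exists>\<delta>>0. \<forall>x\<in>span (range t). norm x = 1 \<longrightarrow> \<delta> \<le> norm (inf \<bar>x\<bar> e)")
    case True
    then show ?thesis
      using exists_unconditional_uo_bibasic_of_below[OF assms(1) e(1) infinite_dimensional_span[OF t(1) ind] e(2)] by blast
  next
    case False
    then have "\<exists>x\<in>span (range t). norm x = 1 \<and> norm (inf \<bar>x\<bar> e) < \<epsilon>" if "\<epsilon> > 0" for \<epsilon>
      using that by (meson not_le)
    then show ?thesis using exists_almost_disjoint[OF e] by blast
  qed
  moreover have "span (range t) \<subseteq> S" using t(2) B(1) by (intro span_minimal assms(2)) blast
  ultimately show ?thesis by blast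
qed

end
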